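(* Let $q$ be a prime power, $A=\mathbb F_q[T]$, $m,s\ge1$, $n=ms$, let $\mathfrak p\in A$ be monic irreducible of degree $d$, let $\kappa=A/\mathfrak p$, let $c\in\kappa^\times$, and let $e_0$ be an integer with $\gcd(e_0,m)=1$. There exist infinitely many monic irreducible $\mathfrak p_0\in A$ with $$\mathfrak p_0\equiv c\pmod{\mathfrak p},\qquad \gcd(\deg\mathfrak p_0,\,n)=1,\qquad \deg\mathfrak p_0\equiv e_0\pmod m.$$ For each such $\mathfrak p_0$ and each root $t$ of $\mathfrak p_0$ (in $\mathbb F_{q^r}$, $r=\deg\mathfrak p_0$), the Drinfeld module $\phi_T=t+\tau^n$ is supersingular, $\mathfrak p\ne\mathfrak p_0$, and its $\mathfrak p$-torsion realizes these parameters: $\mathfrak p_0\bmod\mathfrak p=c$, $R_0\cong\kappa[u]/(u^s-c)$ and $R\cong\operatorname{Mat}_m(R_0)$, the associated skew cyclic codes being the left ideals of $R$. If $\gcd(m,d)=1$, the automorphism $\sigma$ of $K$ induced by conjugation by $\pi=\tau^r$ is $\operatorname{Frob}^e|_K$ with $e\equiv e_0\pmod m$, $e\equiv0\pmod d$.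
   Context: $\overline{\mathbb F}_q$ is a fixed algebraic closure, $[i]=q^i$, $\beta^{[i]}=\beta^{q^i}$. Twisted polynomials in $\tau$ satisfy $\tau a=a^q\tau$ and act on $\overline{\mathbb F}_q$ with $\tau$ acting as $x\mapsto x^q$ and constants by multiplication. Given $\mathfrak p_0$ of degree $r$ and a root $t\in\mathbb F_{q^r}$, the Drinfeld module $\phi\colon A\to\mathbb F_{q^r}\{\tau\}$, $a\mapsto\phi_a$, is the $\mathbb F_q$-algebra homomorphism with $\phi_T=t+\tau^n$; it has rank $n$ and $A$-characteristic $\mathfrak p_0$. For $a\in A$, $\phi[a]=\{v\in\overline{\mathbb F}_q:\phi_a(v)=0\}$. The module $\phi$ is supersingular if its height equals $n$, where the height $H(\phi)\in\{1,\dots,n\}$ is defined by $\phi[\mathfrak p_0]\cong(A/\mathfrak p_0)^{n-H(\phi)}$; equivalently $\phi[\mathfrak p_0]=0$. Put $M=\phi[\mathfrak p]$, a $\kappa$-vector space of dimension $n$ (for $\mathfrak p\neq\mathfrak p_0$) via $a\cdot v=\phi_a(v)$; $E=\operatorname{End}_\kappa(M)$; $\pi=\tau^r$, acting on $M$ by $v\mapsto v^{[r]}$; $R_0=\kappa[\pi^m|_M]$; $R=\operatorname{Cent}_E(R_0)$ (centralizer of $R_0$ in $E$). $L=\mathbb F_{q^m}$ acts on $M$ by scalar multiplication, so $L\subseteq R$, and $K\subseteq R$ is the image of $L\otimes_{\mathbb F_q}\kappa$ under multiplication. When $\gcd(m,d)=1$, $K\cong\mathbb F_{q^{md}}$ is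 a field preserved by conjugation $x\mapsto\pi x\pi^{-1}$, whose restriction to $K$ is $\sigma$; $\operatorname{Frob}\colon x\mapsto x^q$. *)

theory Defs
  imports
    "HOL-Algebra.Algebra"
    "HOL-Algebra.Algebraic_Closure_Type"
    "HOL-Library.Cardinality"
    "HOL-Number_Theory.Cong"
begin

text \<open>
  Throughout, the finite field \<open>F_q\<close> is a type \<open>'a\<close> of class \<open>finite_field\<close>, so \<open>q = CARD('a)\<close>,
  the polynomial ring \<open>A = F_q[T]\<close> is the type \<open>'a poly\<close>, and the fixed algebraic closure of
  \<open>F_q\<close> is the type \<open>'a alg_closure\<close>.
\<close>

section \<open>Algebraic generalities\<close>

definition module_hom ::
  "('r, 'c) ring_scheme \<Rightarrow> ('r, 'v, 'd) module_scheme \<Rightarrow> ('r, 'w, 'e) module_scheme \<Rightarrow> ('v \<Rightarrow> 'w) set"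
  where "module_hom R M N =
    {f \<in> carrier M \<rightarrow>\<^sub>E carrier N.
      (\<forall>v\<in>carrier M. \<forall>w\<in>carrier M. f (v \<oplus>\<^bsub>M\<^esub> w) = f v \<oplus>\<^bsub>N\<^esub> f w) \<and>
      (\<forall>a\<in>carrier R. \<forall>v\<in>carrier M. f (a \<odot>\<^bsub>M\<^esub> v) = a \<odot>\<^bsub>N\<^esub> f v)}"

definition module_isomorphic ::
  "('r, 'c) ring_scheme \<Rightarrow> ('r, 'v, 'd) module_scheme \<Rightarrow> ('r, 'w, 'e) module_scheme \<Rightarrow> bool"
  where "module_isomorphic R M N \<longleftrightarrow>
    (\<exists>f\<in>module_hom R M N. bij_betw f (carrier M) (carrier N))"

text \<open>
  The multiplicative fields of a module record are irrelevant for modules.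
\<close>
definition free_module :: "('r, 'c) ring_scheme \<Rightarrow> nat \<Rightarrow> ('r, nat \<Rightarrow> 'r) module"
  where "free_module R k =
    \<lparr>carrier = {..<k} \<rightarrow>\<^sub>E carrier R, monoid.mult = undefined, one = undefined,
     ring.zero = (\<lambda>i\<in>{..<k}. \<zero>\<^bsub>R\<^esub>), add = (\<lambda>x y. \<lambda>i\<in>{..<k}. x i \<oplus>\<^bsub>R\<^esub> y i),
     module.smult = (\<lambda>a x. \<lambda>i\<in>{..<k}. a \<otimes>\<^bsub>R\<^esub> x i)\<rparr>"

definition End_ring :: "('r, 'c) ring_scheme \<Rightarrow> ('r, 'v, 'd) module_scheme \<Rightarrow> ('v \<Rightarrow> 'v) ring"
  where "End_ring R M =
    \<lparr>carrier = module_hom R M M, monoid.mult = compose (carrier M), one = (\<lambda>v\<in>carrier M. v),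
     ring.zero = (\<lambda>v\<in>carrier M. \<zero>\<^bsub>M\<^esub>), add = (\<lambda>f g. \<lambda>v\<in>carrier M. f v \<oplus>\<^bsub>M\<^esub> g v)\<rparr>"

definition mat_ring :: "nat \<Rightarrow> ('r, 'c) ring_scheme \<Rightarrow> (nat \<times> nat \<Rightarrow> 'r) ring"
  where "mat_ring m R =
    \<lparr>carrier = ({..<m} \<times> {..<m}) \<rightarrow>\<^sub>E carrier R,
     monoid.mult = (\<lambda>P Q. restrict (\<lambda>(i, j). \<Oplus>\<^bsub>R\<^esub>k\<in>{..<m}. P (i, k) \<otimes>\<^bsub>R\<^esub> Q (k, j)) ({..<m} \<times> {..<m})),
     one = restrict (\<lambda>(i, j). if i = j then \<one>\<^bsub>R\<^esub> else \<zero>\<^bsub>R\<^esub>) ({..<m} \<times> {..<m}),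
     ring.zero = (\<lambda>_\<in>{..<m} \<times> {..<m}. \<zero>\<^bsub>R\<^esub>),
     add = (\<lambda>P Q. \<lambda>x\<in>{..<m} \<times> {..<m}. P x \<oplus>\<^bsub>R\<^esub> Q x)\<rparr>"

definition scalar_mat :: "nat \<Rightarrow> ('r, 'c) ring_scheme \<Rightarrow> 'r \<Rightarrow> nat \<times> nat \<Rightarrow> 'r"
  where "scalar_mat m R x = restrict (\<lambda>(i, j). if i = j then x else \<zero>\<^bsub>R\<^esub>) ({..<m} \<times> {..<m})"

definition left_ideal :: "'r set \<Rightarrow> ('r, 'c) ring_scheme \<Rightarrow> bool"
  where "left_ideal I R \<longleftrightarrow>
    subgroup I (add_monoid R) \<and> (\<forall>x\<in>carrier R. \<forall>y\<in>I. x \<otimes>\<^bsub>R\<^esub> y \<in> I)"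

definition centralizer :: "('r, 'c) ring_scheme \<Rightarrow> 'r set \<Rightarrow> 'r set"
  where "centralizer R S = {x \<in> carrier R. \<forall>y\<in>S. x \<otimes>\<^bsub>R\<^esub> y = y \<otimes>\<^bsub>R\<^esub> x}"

text \<open>
  Isomorphism of \<open>k\<close>-algebras; the algebra structures are given by the maps
  \<open>\<iota>\<close> and \<open>\<iota>'\<close> from \<open>k\<close> to the two rings.
\<close>
definition algebra_isomorphic ::
  "('k, 'c) ring_scheme \<Rightarrow> ('k \<Rightarrow> 'r) \<Rightarrow> ('r, 'd) ring_scheme \<Rightarrow> ('k \<Rightarrow> 's) \<Rightarrow> ('s, 'e) ring_scheme \<Rightarrow> bool"
  where "algebra_isomorphic k \<iota> R \<iota>' S \<longleftrightarrow>
    (\<exists>h\<in>ring_iso R S. \<forall>x\<in>carrier k. h (\<iota> x) = \<iota>' x)"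

section \<open>Residue rings of \<open>A\<close>\<close>

abbreviation A_ring :: "'a::finite_field poly ring"
  where "A_ring \<equiv> ring_of_type_algebra"

definition residue_ring_poly :: "'a::finite_field poly \<Rightarrow> 'a poly set ring"
  where "residue_ring_poly f = A_ring Quot (PIdl\<^bsub>A_ring\<^esub> f)"

definition residue_class :: "'a::finite_field poly \<Rightarrow> 'a poly \<Rightarrow> 'a poly set"
  where "residue_class f a = (PIdl\<^bsub>A_ring\<^esub> f) +>\<^bsub>A_ring\<^esub> a"

definition binomial_poly :: "('k, 'c) ring_scheme \<Rightarrow> nat \<Rightarrow> 'k \<Rightarrow> nat \<Rightarrow> 'k"
  where "binomial_poly k s c =
    up_ring.monom (UP k) \<one>\<^bsub>k\<^esub> s \<ominus>\<^bsub>UP k\<^esub> up_ring.monom (UP k) c 0"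

definition binomial_quot :: "('k, 'c) ring_scheme \<Rightarrow> nat \<Rightarrow> 'k \<Rightarrow> (nat \<Rightarrow> 'k) set ring"
  where "binomial_quot k s c = UP k Quot (PIdl\<^bsub>UP k\<^esub> (binomial_poly k s c))"

definition binomial_quot_const :: "('k, 'c) ring_scheme \<Rightarrow> nat \<Rightarrow> 'k \<Rightarrow> 'k \<Rightarrow> (nat \<Rightarrow> 'k) set"
  where "binomial_quot_const k s c x =
    (PIdl\<^bsub>UP k\<^esub> (binomial_poly k s c)) +>\<^bsub>UP k\<^esub> up_ring.monom (UP k) x 0"

section \<open>Twisted polynomials\<close>

text \<open>The subfield with \<open>q^k\<close> elements, for \<open>k \<ge> 1\<close>.\<close>
definition GF_ac :: "nat \<Rightarrow> 'a::finite_field alg_closure set"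
  where "GF_ac k = {x. x ^ (CARD('a) ^ k) = x}"

text \<open>
  A twisted polynomial with coefficients \<open>c\<^sub>i\<close> (written to the left of \<open>\<tau>^i\<close>) is stored as the
  ordinary polynomial with the same coefficients; only the product differs, by
  \<open>\<tau>^i b = b^(q^i) \<tau>^i\<close>.
\<close>
definition twisted_mult ::
  "'a::finite_field alg_closure poly \<Rightarrow> 'a alg_closure poly \<Rightarrow> 'a alg_closure poly"
  where "twisted_mult f g =
    (\<Sum>i\<le>Polynomial.degree f. \<Sum>j\<le>Polynomial.degree g.
      Polynomial.monom (Polynomial.coeff f i * Polynomial.coeff g j ^ (CARD('a) ^ i)) (i + j))"

definition twisted_ring :: "nat \<Rightarrow> 'a::finite_field alg_closure poly ring"
  where "twisted_ring r =
    \<lparr>carrier = {f. \<forall>i. Polynomial.coeff f i \<in> GF_ac r}, monoid.mult = twisted_mult, one = 1,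
     ring.zero = 0, add = (+)\<rparr>"

definition twisted_act ::
  "'a::finite_field alg_closure poly \<Rightarrow> 'a alg_closure \<Rightarrow> 'a alg_closure"
  where "twisted_act f v = (\<Sum>i\<le>Polynomial.degree f. Polynomial.coeff f i * v ^ (CARD('a) ^ i))"

section \<open>The Drinfeld module and its torsion\<close>

text \<open>
  The \<open>F_q\<close>-algebra homomorphism \<open>\<phi>: A \<rightarrow> F_(q^r){\<tau>}\<close> with \<open>\<phi>_T = t + \<tau>^n\<close>, \<open>t \<in> F_(q^r)\<close>:
  it sends \<open>\<Sum> a\<^sub>i T^i\<close> to \<open>\<Sum> a\<^sub>i \<phi>_T^i\<close>.
\<close>
definition drinfeld ::
  "nat \<Rightarrow> nat \<Rightarrow> 'a::finite_field alg_closure \<Rightarrow> 'a poly \<Rightarrow> 'a alg_closure poly"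
  where "drinfeld r n t a =
    (\<Oplus>\<^bsub>twisted_ring r\<^esub>i\<in>{..Polynomial.degree a}.
      [:to_ac (Polynomial.coeff a i):] \<otimes>\<^bsub>twisted_ring r\<^esub>
      ([:t:] + Polynomial.monom 1 n) [^]\<^bsub>twisted_ring r\<^esub> i)"

text \<open>
  The torsion \<open>\<phi>[f]\<close> as a module over \<open>A/f\<close>; for \<open>f = p\<close> this is the \<open>\<kappa>\<close>-vector space
  \<open>M\<close>.  The action \<open>a \<cdot> v = \<phi>_a(v)\<close> does not depend on the representative \<open>a\<close> of a residue
  class, so the set of values over the class is a singleton.
\<close>
definition torsion ::
  "nat \<Rightarrow> nat \<Rightarrow> 'a::finite_field alg_closure \<Rightarrow> 'a poly \<Rightarrow> ('a poly set, 'a alg_closure) module"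
  where "torsion r n t f =
    \<lparr>carrier = {v. twisted_act (drinfeld r n t f) v = 0},
     monoid.mult = undefined, one = undefined, ring.zero = 0, add = (+),
     module.smult = (\<lambda>C v. the_elem ((\<lambda>a. twisted_act (drinfeld r n t a) v) ` C))\<rparr>"

definition height ::
  "nat \<Rightarrow> nat \<Rightarrow> 'a::finite_field alg_closure \<Rightarrow> 'a poly \<Rightarrow> nat"
  where "height r n t p0 =
    (THE h. h \<in> {1..n} \<and>
      module_isomorphic (residue_ring_poly p0) (torsion r n t p0)
        (free_module (residue_ring_poly p0) (n - h)))"

definition supersingular ::
  "nat \<Rightarrow> nat \<Rightarrow> 'a::finite_field alg_closure \<Rightarrow> 'a poly \<Rightarrow> bool"
  where "supersingular r n t p0 \<longleftrightarrow> height r n t p0 = n"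

section \<open>The rings acting on \<open>M = \<phi>[p]\<close>\<close>

definition E_ring ::
  "nat \<Rightarrow> nat \<Rightarrow> 'a::finite_field alg_closure \<Rightarrow> 'a poly \<Rightarrow> ('a alg_closure \<Rightarrow> 'a alg_closure) ring"
  where "E_ring r n t p = End_ring (residue_ring_poly p) (torsion r n t p)"

definition kappa_scalar ::
  "nat \<Rightarrow> nat \<Rightarrow> 'a::finite_field alg_closure \<Rightarrow> 'a poly \<Rightarrow> 'a poly set \<Rightarrow> 'a alg_closure \<Rightarrow> 'a alg_closure"
  where "kappa_scalar r n t p C =
    (\<lambda>v\<in>carrier (torsion r n t p). C \<odot>\<^bsub>torsion r n t p\<^esub> v)"

definition pi_op ::
  "nat \<Rightarrow> nat \<Rightarrow> 'a::finite_field alg_closure \<Rightarrow> 'a poly \<Rightarrow> 'a alg_closure \<Rightarrow> 'a alg_closure"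
  where "pi_op r n t p = (\<lambda>v\<in>carrier (torsion r n t p). v ^ (CARD('a) ^ r))"

definition R0_ring ::
  "nat \<Rightarrow> nat \<Rightarrow> nat \<Rightarrow> 'a::finite_field alg_closure \<Rightarrow> 'a poly \<Rightarrow> ('a alg_closure \<Rightarrow> 'a alg_closure) ring"
  where "R0_ring m r n t p = (E_ring r n t p)
    \<lparr>carrier := generate_ring (E_ring r n t p)
       (kappa_scalar r n t p ` carrier (residue_ring_poly p) \<union>
        {pi_op r n t p [^]\<^bsub>E_ring r n t p\<^esub> m})\<rparr>"

definition R_ring ::
  "nat \<Rightarrow> nat \<Rightarrow> nat \<Rightarrow> 'a::finite_field alg_closure \<Rightarrow> 'a poly \<Rightarrow> ('a alg_closure \<Rightarrow> 'a alg_closure) ring"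
  where "R_ring m r n t p = (E_ring r n t p)
    \<lparr>carrier := centralizer (E_ring r n t p) (carrier (R0_ring m r n t p))\<rparr>"

text \<open>
  The associated skew cyclic codes are by definition the left ideals of \<open>R\<close>; no separate
  description through skew polynomials is used.
\<close>
definition skew_cyclic_codes ::
  "nat \<Rightarrow> nat \<Rightarrow> nat \<Rightarrow> 'a::finite_field alg_closure \<Rightarrow> 'a poly \<Rightarrow> ('a alg_closure \<Rightarrow> 'a alg_closure) set set"
  where "skew_cyclic_codes m r n t p = {C. left_ideal C (R_ring m r n t p)}"

text \<open>
  The image of \<open>L \<otimes> \<kappa>\<close>, with \<open>L = F_(q^m)\<close>, under multiplication: an element
  \<open>\<Sum> l\<^sub>i \<otimes> C\<^sub>i\<close> acts by \<open>v \<mapsto> \<Sum> l\<^sub>i (C\<^sub>i \<cdot> v)\<close>.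
\<close>
definition K_ring ::
  "nat \<Rightarrow> nat \<Rightarrow> nat \<Rightarrow> 'a::finite_field alg_closure \<Rightarrow> 'a poly \<Rightarrow> ('a alg_closure \<Rightarrow> 'a alg_closure) ring"
  where "K_ring m r n t p = (E_ring r n t p)
    \<lparr>carrier := {f. \<exists>(k::nat) l C.
       (\<forall>i<k. l i \<in> GF_ac m \<and> C i \<in> carrier (residue_ring_poly p)) \<and>
       f = (\<lambda>v\<in>carrier (torsion r n t p). \<Sum>i<k. l i * (C i \<odot>\<^bsub>torsion r n t p\<^esub> v))}\<rparr>"

text \<open>Conjugation by \<open>\<pi> = \<tau>^r\<close>, inverted in \<open>E\<close>; it is only of interest on \<open>K\<close>.\<close>
definition sigma ::
  "nat \<Rightarrow> nat \<Rightarrow> 'a::finite_field alg_closure \<Rightarrow> 'a poly \<Rightarrow>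
    ('a alg_closure \<Rightarrow> 'a alg_closure) \<Rightarrow> ('a alg_closure \<Rightarrow> 'a alg_closure)"
  where "sigma r n t p x =
    pi_op r n t p \<otimes>\<^bsub>E_ring r n t p\<^esub> x \<otimes>\<^bsub>E_ring r n t p\<^esub> inv\<^bsub>E_ring r n t p\<^esub> pi_op r n t p"

definition Frob ::
  "nat \<Rightarrow> nat \<Rightarrow> nat \<Rightarrow> 'a::finite_field alg_closure \<Rightarrow> 'a poly \<Rightarrow>
    ('a alg_closure \<Rightarrow> 'a alg_closure) \<Rightarrow> ('a alg_closure \<Rightarrow> 'a alg_closure)"
  where "Frob m r n t p x = x [^]\<^bsub>K_ring m r n t p\<^esub> CARD('a)"

section \<open>The primes\<close>

definition admissible_primes ::
  "'a::finite_field poly \<Rightarrow> 'a poly set \<Rightarrow> nat \<Rightarrow> nat \<Rightarrow> int \<Rightarrow> 'a poly set"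
  where "admissible_primes p c n m e0 =
    {p0. Polynomial.lead_coeff p0 = 1 \<and> Factorial_Ring.irreducible p0 \<and> residue_class p p0 = c \<and>
         gcd (Polynomial.degree p0) n = 1 \<and> [int (Polynomial.degree p0) = e0] (mod int m)}"

end

theory Submission
  imports Defs "HOL-Analysis.FPS_Convergence" "HOL-Library.Function_Algebras"
begin

text \<open>
  The statement combines a theorem of Dirichlet type for \<open>A\<close> with a computation on one explicit
  Drinfeld module.

  \<^emph>\<open>Existence of the primes.\<close>  As \<open>e0\<close> is a unit modulo \<open>m\<close>, some \<open>e \<equiv> e0 (mod m)\<close> is coprime to
  \<open>n\<close>, and it suffices to find infinitely many primes in the class of \<open>c\<close> whose degree is \<open>e\<close>
  modulo \<open>n\<close>.  Both conditions are detected by the characters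
  \<open>\<psi>(f) = \<theta>(f)^j z^(l deg f)\<close>, where \<open>\<theta>\<close> is a faithful character of \<open>\<kappa>\<^sup>\<times>\<close> and \<open>z\<close> a primitive
  \<open>n\<close>-th root of unity.  Put \<open>L(\<psi>, u) = \<Sum> \<psi>(f) u^(deg f)\<close> and let \<open>S(\<psi>, u) = u L'(u) / L(u)\<close>, which
  is a sum over prime powers.  For \<open>j = 0\<close> the function \<open>S\<close> is explicit, with a pole at \<open>u = 1/q\<close>
  only if \<open>l = 0\<close>.  For \<open>j \<noteq> 0\<close> the series \<open>L\<close> is a polynomial, and \<open>L_nonvanishing\<close> says that it
  has no zero at \<open>1/q\<close>, so \<open>S\<close> has no pole there.  Orthogonality of characters then gives
  a pole at \<open>1/q\<close> for the sum over the prime powers of the wanted kind; finitely many primes and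
  all proper prime powers contribute too little for that (\<open>infinite_irreducibles_in_class\<close>).

  \<^emph>\<open>The relation \<open>\<phi>\<^sub>p\<^sub>0 = \<tau>^(nr)\<close>.\<close>  Since \<open>gcd(r, n) = 1\<close>, the map \<open>x \<mapsto> x^[n]\<close> permutes the roots of \<open>p0\<close>
  cyclically, so \<open>p0 = \<Prod>\<^sub>i\<^sub><\<^sub>r (T - t^[ni])\<close>.  Substituting \<open>\<phi>\<^sub>T = t + \<tau>^n\<close>, the product telescopes
  to \<open>\<tau>^(nr)\<close> (\<open>phi_characteristic\<close>).  As \<open>\<tau>\<close> is injective, \<open>\<phi>[p0] = 0\<close>, which is
  supersingularity.  On \<open>M = \<phi>[p]\<close> the same relation reads \<open>\<pi>^n = c\<close>, that is \<open>(\<pi>^m)^s = c\<close>.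

  \<^emph>\<open>There are no further relations.\<close>  \<open>M\<close> is free of rank one over
  \<open>\<kappa>[\<pi>] = \<kappa>[x]/(x^n - c)\<close> (\<open>exists_cyclic_vector\<close>).  First, the action is faithful: the
  operators \<open>\<Sum>\<^sub>i\<^sub><\<^sub>n \<phi>\<^sub>A\<^sub>i \<pi>^i\<close> span, over the algebraic closure, all powers of \<open>\<tau>\<close> on \<open>M\<close>, and of these
  \<open>1, \<tau>, \<dots>, \<tau>^(nd-1)\<close> are linearly independent because a nonzero \<open>q\<close>-polynomial of degree
  below \<open>q^(nd)\<close> cannot vanish on the \<open>q^(nd)\<close> elements of \<open>M\<close>; so there are at least \<open>q^(nd)\<close>
  operators.  Second, a faithful module over a finite commutative principal ring contains a
  vector with zero annihilator, and counting shows that it generates \<open>M\<close>.  If \<open>v\<^sub>0\<close> is such a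
  vector, then \<open>v\<^sub>0, \<pi> v\<^sub>0, \<dots>, \<pi>^(m-1) v\<^sub>0\<close> is a basis of \<open>M\<close> over \<open>R\<^sub>0 = \<kappa>[\<pi>^m]\<close>.  Hence
  \<open>R\<^sub>0 = \<kappa>[u]/(u^s - c)\<close>, and \<open>R\<close>, the ring of \<open>R\<^sub>0\<close>-linear endomorphisms of \<open>M\<close>, is the matrix ring.

  \<^emph>\<open>Conjugation on \<open>K\<close>.\<close>  \<open>K\<close> is the image of \<open>L[T]\<close> with \<open>L = GF(q^m)\<close>, where \<open>T\<close> acts as
  \<open>\<phi>\<^sub>T\<close>.  Conjugation by \<open>\<pi>\<close> raises the coefficients of a polynomial to the power \<open>q^r\<close>, whereas
  \<open>Frob^e\<close> sends \<open>\<Sum> g\<^sub>i T^i\<close> to \<open>\<Sum> g\<^sub>i^[e] T^(i q^e)\<close>.  These agree on \<open>M\<close> when \<open>e \<equiv> r (mod m)\<close> and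
  \<open>d\<close> divides \<open>e\<close>, because then \<open>T^(q^e) \<equiv> T (mod p)\<close> (\<open>sigma_eq_Frob_funpow\<close>).
\<close>

section \<open>Residue rings of polynomials over a finite field\<close>

lemma A_ring_simps [simp]:
  "carrier A_ring = UNIV" "x \<oplus>\<^bsub>A_ring\<^esub> y = x + y" "x \<otimes>\<^bsub>A_ring\<^esub> y = x * y"
  "\<zero>\<^bsub>A_ring\<^esub> = 0" "\<one>\<^bsub>A_ring\<^esub> = 1"
  by (simp_all add: ring_of_type_algebra_def)

lemma A_ring_cring: "cring (A_ring :: 'a::finite_field poly ring)"
  by (rule cring_from_type_algebra)

lemma PIdl_A_ring: "PIdl\<^bsub>A_ring\<^esub> f = {g. f dvd g}"
  unfolding cgenideal_def by (auto simp: dvd_def mult.commute)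

lemma ideal_PIdl_A_ring: "ideal (PIdl\<^bsub>A_ring\<^esub> f) A_ring"
  by (rule cring.cgenideal_ideal[OF A_ring_cring]) simp

lemma residue_class_altdef: "residue_class f a = {b. f dvd b - a}"
proof -
  have "residue_class f a = (\<lambda>h. h + a) ` {g. f dvd g}"
    unfolding residue_class_def PIdl_A_ring a_r_coset_def' by auto
  also have "\<dots> = {b. f dvd b - a}"
    by (force simp: image_iff intro: exI[of _ "_ - a"])
  finally show ?thesis .
qed

lemma residue_class_eq_iff: "residue_class f a = residue_class f b \<longleftrightarrow> f dvd a - b"
proof
  assume "residue_class f a = residue_class f b"
  moreover have "a \<in> residue_class f a" by (simp add: residue_class_altdef)
  ultimately show "f dvd a - b" by (simp add: residue_class_altdef)
next
  assume *: "f dvd a - b"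
  have "f dvd x - a \<longleftrightarrow> f dvd x - b" for x
    using dvd_add_left_iff[OF *, of "x - a"] by simp
  thus "residue_class f a = residue_class f b"
    by (auto simp: residue_class_altdef)
qed

lemma residue_class_self: "a \<in> residue_class f a"
  by (simp add: residue_class_altdef)

lemma residue_class_mod: "residue_class f (a mod f) = residue_class f a"
  by (simp add: residue_class_eq_iff mod_eq_dvd_iff[symmetric])

lemma carrier_residue_ring_poly: "carrier (residue_ring_poly f) = range (residue_class f)"
  unfolding residue_ring_poly_def FactRing_def A_RCOSETS_defs residue_class_def a_r_coset_defs
  by auto

lemma residue_class_in_carrier [simp]: "residue_class f a \<in> carrier (residue_ring_poly f)"
  by (simp add: carrier_residue_ring_poly)

lemma residue_ring_poly_cring: "cring (residue_ring_poly f)"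
  unfolding residue_ring_poly_def by (rule ideal.quotient_is_cring[OF ideal_PIdl_A_ring A_ring_cring])

lemma residue_class_hom: "residue_class f \<in> ring_hom A_ring (residue_ring_poly f)"
  unfolding residue_ring_poly_def residue_class_def[abs_def]
  by (rule ideal.rcos_ring_hom[OF ideal_PIdl_A_ring])

lemma residue_class_simps:
  "residue_class f a \<oplus>\<^bsub>residue_ring_poly f\<^esub> residue_class f b = residue_class f (a + b)"
  "residue_class f a \<otimes>\<^bsub>residue_ring_poly f\<^esub> residue_class f b = residue_class f (a * b)"
  "\<one>\<^bsub>residue_ring_poly f\<^esub> = residue_class f 1"
  using ring_hom_add[OF residue_class_hom, of a b f] ring_hom_mult[OF residue_class_hom, of a b f]
    ring_hom_one[OF residue_class_hom, of f] by simp_all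

lemma residue_class_zero: "\<zero>\<^bsub>residue_ring_poly f\<^esub> = residue_class f 0"
  using ring_hom_zero[OF residue_class_hom[of f] cring.axioms(1)[OF A_ring_cring]
      cring.axioms(1)[OF residue_ring_poly_cring]] by simp

lemma residue_class_pow:
  "residue_class f a [^]\<^bsub>residue_ring_poly f\<^esub> (k::nat) = residue_class f (a ^ k)"
  by (induction k) (simp_all add: residue_class_simps mult.commute)

lemma card_field_gt_1: "CARD('a::finite_field) > 1"
proof -
  have "card {0, 1 :: 'a} \<le> CARD('a)" by (intro card_mono) auto
  thus ?thesis by simp
qed

text \<open>
  Lists of \<open>k\<close> coefficients represent the polynomials of degree below \<open>k\<close>, each once; this needs
  \<open>k > 0\<close> because the zero polynomial has degree \<open>0\<close>.
\<close>
lemma card_poly_degree_less: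
  assumes "k > 0"
  shows "finite {f :: 'a::finite_field poly. Polynomial.degree f < k}"
    and "card {f :: 'a::finite_field poly. Polynomial.degree f < k} = CARD('a) ^ k"
proof -
  let ?S = "{f :: 'a poly. Polynomial.degree f < k}" and ?L = "{xs :: 'a list. length xs = k}"
  have inj: "inj_on Poly ?L"
  proof (rule inj_onI)
    fix xs ys :: "'a list" assume *: "xs \<in> ?L" "ys \<in> ?L" "Poly xs = Poly ys"
    have "nth_default 0 xs i = nth_default 0 ys i" for i
      using *(3) by (metis coeff_Poly_eq)
    thus "xs = ys"
      using *(1,2) by (intro nth_equalityI) (auto simp: nth_default_def split: if_splits, metis)
  qed
  have "Poly ` ?L = ?S"
  proof (intro equalityI subsetI)
    fix f assume "f \<in> Poly ` ?L"
    then obtain xs where "f = Poly xs" "length xs = k" by auto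
    thus "f \<in> ?S" using degree_Poly[of xs] assms
      by (auto intro!: le_less_trans[OF degree_le[of "k - 1"]] simp: nth_default_def)
  next
    fix f assume f: "f \<in> ?S"
    have "f = Poly (map (poly.coeff f) [0..<k])"
      using f by (intro poly_eqI) (auto simp: nth_default_def coeff_eq_0)
    thus "f \<in> Poly ` ?L" by (rule image_eqI) simp
  qed
  moreover have "finite ?L" "card ?L = CARD('a) ^ k"
    using finite_lists_length_eq[of "UNIV :: 'a set" k] card_lists_length_eq[of "UNIV :: 'a set" k]
    by simp_all
  ultimately show "finite ?S" "card ?S = CARD('a) ^ k"
    using inj card_image[of Poly ?L] finite_imageI[of ?L Poly] by simp_all
qed

lemma degree_mod_less_pos:
  fixes f g :: "'a::field poly"
  assumes "Polynomial.degree g > 0"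
  shows "Polynomial.degree (f mod g) < Polynomial.degree g"
  using degree_mod_less'[of g f] assms by fastforce

lemma bij_betw_residue_class:
  fixes f :: "'a::finite_field poly"
  assumes "Polynomial.degree f > 0"
  shows "bij_betw (residue_class f) {a. Polynomial.degree a < Polynomial.degree f}
           (carrier (residue_ring_poly f))"
proof (rule bij_betw_imageI)
  show "inj_on (residue_class f) {a. Polynomial.degree a < Polynomial.degree f}"
  proof (rule inj_onI)
    fix a b assume *: "a \<in> {a. Polynomial.degree a < Polynomial.degree f}"
      "b \<in> {a. Polynomial.degree a < Polynomial.degree f}" "residue_class f a = residue_class f b"
    hence "Polynomial.degree (a - b) < Polynomial.degree f"
      by (auto intro: degree_diff_less)
    moreover have "f dvd a - b" using * by (simp add: residue_class_eq_iff)
    ultimately show "a = b"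
      using dvd_imp_degree_le[of f "a - b"] by fastforce
  qed
  show "residue_class f ` {a. Polynomial.degree a < Polynomial.degree f} = carrier (residue_ring_poly f)"
  proof -
    have "residue_class f a \<in> residue_class f ` {a. Polynomial.degree a < Polynomial.degree f}" for a
      using residue_class_mod[of f a] degree_mod_less_pos[OF assms, of a]
      by (metis (mono_tags, lifting) imageI mem_Collect_eq)
    thus ?thesis by (auto simp: carrier_residue_ring_poly)
  qed
qed

lemma card_residue_ring_poly:
  fixes f :: "'a::finite_field poly"
  assumes "Polynomial.degree f > 0"
  shows "finite (carrier (residue_ring_poly f))"
    and "card (carrier (residue_ring_poly f)) = CARD('a) ^ Polynomial.degree f"
  using bij_betw_finite[OF bij_betw_residue_class[OF assms]]
    bij_betw_same_card[OF bij_betw_residue_class[OF assms]] card_poly_degree_less[OF assms, where 'a='a]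
  by simp_all

lemma irreducible_degree_pos:
  "Factorial_Ring.irreducible p \<Longrightarrow> Polynomial.degree p > 0" for p :: "'a::field poly"
  using irreducible_not_unit[of p] by (cases "Polynomial.degree p = 0")
    (auto simp: is_unit_iff_degree Factorial_Ring.irreducible_def)

lemma irreducible_dvd_mult_iff:
  "Factorial_Ring.irreducible p \<Longrightarrow> p dvd a * b \<longleftrightarrow> p dvd a \<or> p dvd b" for p :: "'a::field poly"
  using field_poly_irreducible_imp_prime prime_elem_dvd_mult_iff by blast

lemma bij_betw_mult_mod_irreducible:
  fixes p a :: "'a::finite_field poly"
  assumes "Factorial_Ring.irreducible p" "\<not> p dvd a"
  defines "S \<equiv> {b. Polynomial.degree b < Polynomial.degree p}"
  shows "bij_betw (\<lambda>b. (a * b) mod p) S S"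
proof -
  have pos: "Polynomial.degree p > 0" by (rule irreducible_degree_pos[OF assms(1)])
  have "inj_on (\<lambda>b. (a * b) mod p) S"
  proof (rule inj_onI)
    fix b c assume *: "b \<in> S" "c \<in> S" "(a * b) mod p = (a * c) mod p"
    hence "p dvd a * (b - c)" by (simp add: mod_eq_dvd_iff right_diff_distrib)
    hence "p dvd b - c" using assms(1,2) by (simp add: irreducible_dvd_mult_iff)
    hence "residue_class p b = residue_class p c" by (simp add: residue_class_eq_iff)
    thus "b = c" using bij_betw_residue_class[OF pos] * by (auto simp: bij_betw_def inj_on_def S_def)
  qed
  moreover have "(\<lambda>b. (a * b) mod p) ` S \<subseteq> S" using degree_mod_less_pos[OF pos] by (auto simp: S_def)
  moreover have "finite S" unfolding S_def by (rule card_poly_degree_less(1)[OF pos])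
  ultimately show ?thesis by (metis endo_inj_surj bij_betw_def)
qed

text \<open>
  Multiplication by \<open>a\<close> permutes the remainders modulo \<open>p\<close>, so it reaches \<open>1\<close>. The permutation
  is also used to translate character sums.
\<close>
lemma exists_inverse_mod_irreducible:
  fixes p a :: "'a::finite_field poly"
  assumes "Factorial_Ring.irreducible p" "\<not> p dvd a"
  shows "\<exists>b. p dvd a * b - 1"
proof -
  let ?S = "{b. Polynomial.degree b < Polynomial.degree p}"
  have pos: "Polynomial.degree p > 0" by (rule irreducible_degree_pos[OF assms(1)])
  have "(\<lambda>b. (a * b) mod p) ` ?S = ?S"
    using bij_betw_mult_mod_irreducible[OF assms] by (simp add: bij_betw_def)
  moreover have "1 \<in> ?S" using pos by simp
  ultimately have "1 \<in> (\<lambda>b. (a * b) mod p) ` ?S" by simp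
  then obtain b where "1 = (a * b) mod p" by (rule imageE)
  hence "(a * b) mod p = 1 mod p" using mod_mod_trivial[of "a * b" p] by simp
  thus ?thesis by (auto simp: mod_eq_dvd_iff)
qed

lemma residue_ring_poly_field:
  fixes p :: "'a::finite_field poly"
  assumes "Factorial_Ring.irreducible p"
  shows "field (residue_ring_poly p)"
proof (rule cring.cring_fieldI2[OF residue_ring_poly_cring])
  have "\<not> p dvd 1" using irreducible_not_unit[OF assms] .
  thus "\<zero>\<^bsub>residue_ring_poly p\<^esub> \<noteq> \<one>\<^bsub>residue_ring_poly p\<^esub>"
    by (simp add: residue_class_zero residue_class_simps residue_class_eq_iff)
next
  fix x assume "x \<in> carrier (residue_ring_poly p)" and "x \<noteq> \<zero>\<^bsub>residue_ring_poly p\<^esub>"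
  then obtain a where x: "x = residue_class p a" and "\<not> p dvd a"
    unfolding carrier_residue_ring_poly residue_class_zero
    by (metis diff_zero imageE residue_class_eq_iff)
  then obtain b where "p dvd a * b - 1" using exists_inverse_mod_irreducible[OF assms] by blast
  thus "\<exists>y\<in>carrier (residue_ring_poly p). x \<otimes>\<^bsub>residue_ring_poly p\<^esub> y = \<one>\<^bsub>residue_ring_poly p\<^esub>"
    using x residue_class_eq_iff[of p "a * b" 1]
    by (intro bexI[of _ "residue_class p b"]) (simp_all add: residue_class_simps)
qed

section \<open>Series over monic polynomials\<close>

definition monics :: "nat \<Rightarrow> 'a::finite_field poly set"
  where "monics k = {f. Polynomial.lead_coeff f = 1 \<and> Polynomial.degree f = k}"

lemma monics_0 [simp]: "monics 0 = {1}"
  by (auto simp: monics_def elim!: degree_eq_zeroE)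

lemma monics_mult: "g \<in> monics j \<Longrightarrow> h \<in> monics k \<Longrightarrow> g * h \<in> monics (j + k)"
proof -
  assume *: "g \<in> monics j" "h \<in> monics k"
  hence nz: "g \<noteq> 0" "h \<noteq> 0" by (auto simp: monics_def)
  have "Polynomial.lead_coeff (g * h) = 1"
    using * unfolding lead_coeff_mult by (auto simp: monics_def)
  thus "g * h \<in> monics (j + k)" using * nz by (auto simp: monics_def degree_mult_eq)
qed

lemma monics_power: "g \<in> monics j \<Longrightarrow> g ^ i \<in> monics (i * j)"
  by (induction i) (auto intro: monics_mult)

text \<open>
  Division with remainder: monic polynomials of degree at least that of \<open>g\<close> fall into complete
  blocks of remainders, so that they can be counted and nontrivial character sums over them
  vanish.
\<close>
lemma bij_betw_monics_div:
  fixes g :: "'a::finite_field poly"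
  assumes "Polynomial.lead_coeff g = 1" "Polynomial.degree g = e" "e > 0"
  shows "bij_betw (\<lambda>(h, r). g * h + r) (monics j \<times> {r. Polynomial.degree r < e}) (monics (e + j))"
proof -
  have g0: "g \<noteq> 0" using assms by auto
  have *: "Polynomial.degree (g * h + r) = e + j \<and> Polynomial.lead_coeff (g * h + r) = 1"
    if "h \<in> monics j" "Polynomial.degree r < e" for h r
  proof -
    have "h \<noteq> 0" using that by (auto simp: monics_def)
    hence deg: "Polynomial.degree (g * h) = e + j" using that g0 assms
      by (simp add: degree_mult_eq monics_def)
    hence "Polynomial.degree (g * h + r) = e + j" using that by (simp add: degree_add_eq_left)
    moreover have "Polynomial.lead_coeff (g * h + r) = Polynomial.lead_coeff (g * h)"
      using deg that by (simp add: degree_add_eq_left coeff_eq_0)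
    moreover have "Polynomial.lead_coeff (g * h) = 1"
      using that assms unfolding lead_coeff_mult by (auto simp: monics_def)
    ultimately show ?thesis by simp
  qed
  show ?thesis
  proof (rule bij_betw_byWitness[where f' = "\<lambda>f. (f div g, f mod g)"], safe)
    fix h r :: "'a poly" assume "h \<in> monics j" "Polynomial.degree r < e"
    thus "g * h + r \<in> monics (e + j)" using *[of h r] unfolding monics_def by blast
    have "(r + h * g) div g = h + r div g" "(r + h * g) mod g = r mod g"
      using g0 by simp_all
    moreover have "r div g = 0" "r mod g = r"
      using \<open>Polynomial.degree r < e\<close> assms by (auto simp: div_poly_less mod_poly_less)
    ultimately show "(g * h + r) div g = h" "(g * h + r) mod g = r"
      by (simp_all add: add.commute mult.commute)
  next
    fix f :: "'a poly" assume f: "f \<in> monics (e + j)"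
    show "Polynomial.degree (f mod g) < e" using degree_mod_less_pos[of g f] assms by simp
    show "f div g \<in> monics j"
    proof -
      obtain h r where eq: "f = g * h + r" and h: "h = f div g" and r: "Polynomial.degree r < e"
        using \<open>Polynomial.degree (f mod g) < e\<close> mult_div_mod_eq[of g f] by metis
      have "h \<noteq> 0" using f eq r by (auto simp: monics_def)
      hence deg: "Polynomial.degree (g * h) = e + Polynomial.degree h"
        using g0 assms by (simp add: degree_mult_eq)
      have "Polynomial.degree f = e + Polynomial.degree h"
        unfolding eq using deg r by (simp add: degree_add_eq_left)
      moreover have "Polynomial.lead_coeff f = Polynomial.lead_coeff (g * h)"
        unfolding eq using deg r by (simp add: degree_add_eq_left coeff_eq_0)
      hence "Polynomial.lead_coeff h = 1" using f assms unfolding lead_coeff_mult by (auto simp: monics_def)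
      ultimately show ?thesis using f by (auto simp: monics_def h)
    qed
  qed auto
qed

lemma finite_monics: "finite (monics k :: 'a::finite_field poly set)"
  and card_monics: "card (monics k :: 'a::finite_field poly set) = CARD('a) ^ k"
proof -
  have "finite (monics k :: 'a poly set) \<and> card (monics k :: 'a poly set) = CARD('a) ^ k"
  proof (cases "k = 0")
    case False
    hence bij: "bij_betw (\<lambda>(h, r). Polynomial.monom 1 k * h + r)
       (monics 0 \<times> {r :: 'a poly. Polynomial.degree r < k}) (monics (k + 0))"
      by (intro bij_betw_monics_div) (auto simp: Polynomial.degree_monom_eq)
    show ?thesis
      using bij_betw_finite[OF bij] bij_betw_same_card[OF bij] False
        card_poly_degree_less[of k, where 'a='a] by simp
  qed simp
  thus "finite (monics k :: 'a poly set)" "card (monics k :: 'a poly set) = CARD('a) ^ k" by auto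
qed

definition monic_irreducible :: "'a::finite_field poly \<Rightarrow> bool"
  where "monic_irreducible P \<longleftrightarrow> Factorial_Ring.irreducible P \<and> Polynomial.lead_coeff P = 1"

definition prime_powers :: "nat \<Rightarrow> ('a::finite_field poly \<times> nat) set"
  where "prime_powers k = {(P, i). monic_irreducible P \<and> i \<ge> 1 \<and> i * Polynomial.degree P = k}"

text \<open>
  The set on which the von Mangoldt function of \<open>f\<close> is supported.
\<close>
definition prime_power_divisors :: "'a::finite_field poly \<Rightarrow> ('a poly \<times> nat) set"
  where "prime_power_divisors f = {(P, i). monic_irreducible P \<and> i \<ge> 1 \<and> P ^ i dvd f}"

lemma monic_irreducible_degree_pos: "monic_irreducible P \<Longrightarrow> Polynomial.degree P > 0"
  by (simp add: monic_irreducible_def irreducible_degree_pos)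

lemma monic_irreducible_dvd_iff:
  assumes "monic_irreducible P" "monic_irreducible Q"
  shows "P dvd Q \<longleftrightarrow> P = Q"
proof
  assume "P dvd Q"
  then obtain g where g: "Q = P * g" by auto
  hence "is_unit P \<or> is_unit g"
    using assms Factorial_Ring.irreducibleD by (auto simp: monic_irreducible_def)
  hence "is_unit g" using assms irreducible_not_unit by (auto simp: monic_irreducible_def)
  then obtain a where a: "g = [:a:]" by (auto simp: is_unit_poly_iff)
  hence "Polynomial.lead_coeff Q = Polynomial.lead_coeff P * a" by (simp add: g lead_coeff_mult)
  hence "a = 1" using assms by (simp add: monic_irreducible_def)
  thus "P = Q" using g a by (simp add: one_pCons[symmetric])
qed simp

lemma degree_power_monic: "Polynomial.degree (P ^ i) = i * Polynomial.degree P"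
  for P :: "'a::idom poly"
  by (cases "P = 0") (auto simp: degree_power_eq power_0_left)

lemma finite_prime_powers: "finite (prime_powers k :: ('a::finite_field poly \<times> nat) set)"
proof (rule finite_subset)
  show "(prime_powers k :: ('a poly \<times> nat) set) \<subseteq> {P. Polynomial.degree P < Suc k} \<times> {..k}"
    by (auto simp: prime_powers_def less_Suc_eq_le dest!: monic_irreducible_degree_pos)
  show "finite ({P :: 'a poly. Polynomial.degree P < Suc k} \<times> {..k})"
    using card_poly_degree_less(1)[of "Suc k", where 'a='a] by simp
qed

lemma finite_prime_power_divisors:
  fixes f :: "'a::finite_field poly"
  assumes "f \<noteq> 0"
  shows "finite (prime_power_divisors f)"
proof (rule finite_subset)
  let ?k = "Polynomial.degree f"
  have "Polynomial.degree P < Suc ?k \<and> i \<le> ?k" if "monic_irreducible P" "i \<ge> 1" "P ^ i dvd f" for P i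
  proof -
    have "i * Polynomial.degree P \<le> ?k"
      using dvd_imp_degree_le[OF that(3) assms] by (simp add: degree_power_monic)
    moreover have "i \<le> i * Polynomial.degree P" "Polynomial.degree P \<le> i * Polynomial.degree P"
      using monic_irreducible_degree_pos[OF that(1)] that(2) by simp_all
    ultimately show ?thesis by linarith
  qed
  thus "prime_power_divisors f \<subseteq> {P. Polynomial.degree P < Suc ?k} \<times> {..?k}"
    by (auto simp: prime_power_divisors_def)
  show "finite ({P :: 'a poly. Polynomial.degree P < Suc ?k} \<times> {..?k})"
    using card_poly_degree_less(1)[of "Suc ?k", where 'a='a] by simp
qed

text \<open>
  A nonconstant divisor of least degree is irreducible; scaling makes it monic.
\<close>
lemma exists_monic_irreducible_divisor:
  fixes f :: "'a::finite_field poly"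
  assumes "Polynomial.degree f > 0"
  shows "\<exists>P. monic_irreducible P \<and> P dvd f"
proof -
  have ex: "\<exists>k. \<exists>P. Polynomial.degree P = k \<and> k > 0 \<and> P dvd f" using assms by auto
  define k where "k = (LEAST k. \<exists>P. Polynomial.degree P = k \<and> k > 0 \<and> P dvd f)"
  obtain P where P: "Polynomial.degree P = k" "k > 0" "P dvd f"
    using LeastI_ex[OF ex] unfolding k_def by blast
  have min: "k \<le> Polynomial.degree Q" if "Q dvd f" "Polynomial.degree Q > 0" for Q
    unfolding k_def using that by (intro Least_le) blast
  have P0: "P \<noteq> 0" using P by auto
  have irr: "Factorial_Ring.irreducible P"
  proof (rule Factorial_Ring.irreducibleI)
    show "P \<noteq> 0" by fact
    show "\<not> is_unit P" using P by (simp add: is_unit_iff_degree P0)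
    fix a b assume ab: "P = a * b"
    hence nz: "a \<noteq> 0" "b \<noteq> 0" using P0 by auto
    hence deg: "k = Polynomial.degree a + Polynomial.degree b" using P ab by (simp add: degree_mult_eq)
    have "a dvd f" "b dvd f" using P(3) ab dvd_trans by (blast intro: dvd_triv_left dvd_triv_right)+
    hence "Polynomial.degree a = 0 \<or> Polynomial.degree b = 0"
      using min[of a] min[of b] deg by linarith
    thus "is_unit a \<or> is_unit b" using nz by (simp add: is_unit_iff_degree)
  qed
  define c where "c = inverse (Polynomial.lead_coeff P)"
  have c: "c \<noteq> 0" using P0 by (simp add: c_def)
  have un: "is_unit [:c:]" using c by (simp add: is_unit_const_poly_iff dvd_field_iff)
  have "Polynomial.smult c P = [:c:] * P" by simp
  hence "Factorial_Ring.irreducible (Polynomial.smult c P)"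
    using irr un by (metis irreducible_mult_unit_left)
  moreover have "Polynomial.lead_coeff (Polynomial.smult c P) = 1" using P0 by (simp add: c_def)
  moreover have "Polynomial.smult c P dvd f" using P(3) c by (simp add: smult_dvd_iff)
  ultimately show ?thesis by (auto simp: monic_irreducible_def)
qed

lemma irreducible_power_dvd_mult:
  fixes P Q g :: "'a::field poly"
  assumes "Factorial_Ring.irreducible P" "\<not> P dvd Q" "P ^ i dvd Q * g"
  shows "P ^ i dvd g"
  using assms(3)
proof (induction i)
  case (Suc i)
  have P0: "P \<noteq> 0" using assms(1) by (simp add: Factorial_Ring.irreducible_def)
  have "P ^ i dvd Q * g" using Suc.prems by (metis dvd_mult_right power_Suc)
  then obtain h where h: "g = P ^ i * h" using Suc.IH by auto
  have "P ^ i * P dvd P ^ i * (Q * h)" using Suc.prems by (simp add: h ac_simps)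
  hence "P dvd Q * h" using P0 by (subst (asm) dvd_mult_cancel_left) auto
  hence "P dvd h" using assms irreducible_dvd_mult_iff by blast
  thus ?case by (auto simp: h)
qed simp

text \<open>
  If \<open>v\<close> is the exponent of \<open>Q\<close> in \<open>g\<close>, multiplying \<open>g\<close> by \<open>Q\<close> adds only the new prime power
  divisor \<open>Q^(v+1)\<close>. So the induction below removes one factor at a time and needs no unique
  factorization.
\<close>
lemma prime_power_divisors_mult:
  fixes g :: "'a::finite_field poly"
  assumes "monic_irreducible Q" "g \<noteq> 0"
  obtains v where "prime_power_divisors (Q * g) = insert (Q, Suc v) (prime_power_divisors g)"
    and "(Q, Suc v) \<notin> prime_power_divisors g"
proof -
  have Q: "Q \<noteq> 0" "\<not> is_unit Q" "Factorial_Ring.irreducible Q"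
    using assms by (auto simp: monic_irreducible_def Factorial_Ring.irreducible_def)
  \<comment> \<open>The exponent of \<open>Q\<close> in \<open>g\<close>, which is bounded by the degree of \<open>g\<close>.\<close>
  define v where "v = (GREATEST i. Q ^ i dvd g)"
  have bound: "i \<le> Polynomial.degree g" if "Q ^ i dvd g" for i
    using dvd_imp_degree_le[OF that assms(2)] monic_irreducible_degree_pos[OF assms(1)]
    by (auto simp: degree_power_monic elim: le_trans[rotated])
  have "Q ^ v dvd g"
    unfolding v_def by (rule GreatestI_nat[where b = "Polynomial.degree g" and k = 0]) (use bound in auto)
  moreover have "i \<le> v" if "Q ^ i dvd g" for i
    unfolding v_def by (rule Greatest_le_nat[where P = "\<lambda>i. Q ^ i dvd g", OF that, where b = "Polynomial.degree g"]) (use bound in auto)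
  ultimately have le: "Q ^ i dvd g \<longleftrightarrow> i \<le> v" for i
    using dvd_trans[OF le_imp_power_dvd[of i v Q]] by blast
  have notin: "(Q, Suc v) \<notin> prime_power_divisors g"
    by (simp add: prime_power_divisors_def le del: power_Suc)
  have "P ^ i dvd Q * g \<longleftrightarrow> (P = Q \<and> i = Suc v) \<or> P ^ i dvd g"
    if P: "monic_irreducible P" "i \<ge> 1" for P i
  proof (cases "P = Q")
    case True
    obtain j where j: "i = Suc j" using P(2) by (cases i) auto
    have "Q ^ i dvd Q * g \<longleftrightarrow> j \<le> v" using Q by (simp add: j le)
    thus ?thesis using True le[of i] j by auto
  next
    case False
    hence "\<not> P dvd Q" using monic_irreducible_dvd_iff P assms by blast
    thus ?thesis using False irreducible_power_dvd_mult[of P Q i g] P by (auto simp: monic_irreducible_def)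
  qed
  hence "prime_power_divisors (Q * g) = insert (Q, Suc v) (prime_power_divisors g)"
    using assms(1) by (auto simp: prime_power_divisors_def)
  thus ?thesis using notin that by blast
qed

text \<open>
  The identity \<open>log |f| = \<Sum>\<^sub>h\<^sub>|\<^sub>f \<Lambda>(h)\<close> of the von Mangoldt function, in degrees.
\<close>
lemma degree_eq_sum_prime_power_divisors:
  fixes f :: "'a::finite_field poly"
  assumes "f \<in> monics k"
  shows "(\<Sum>(P, i)\<in>prime_power_divisors f. Polynomial.degree P) = k"
  using assms
proof (induction k arbitrary: f rule: less_induct)
  case (less k)
  show ?case
  proof (cases "k = 0")
    case True
    hence "f = 1" using less.prems by simp
    hence "prime_power_divisors f = {}"
      by (auto simp: prime_power_divisors_def monic_irreducible_def is_unit_power_iff Factorial_Ring.irreducible_def)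
    thus ?thesis using True by simp
  next
    case False
    then obtain Q where Q: "monic_irreducible Q" "Q dvd f"
      using exists_monic_irreducible_divisor[of f] less.prems by (auto simp: monics_def)
    then obtain g where g: "f = Q * g" by auto
    have "f \<noteq> 0" using less.prems by (auto simp: monics_def)
    hence nz: "Q \<noteq> 0" "g \<noteq> 0" using g by auto
    have deg: "k = Polynomial.degree Q + Polynomial.degree g"
      using less.prems nz by (simp add: g degree_mult_eq monics_def)
    have "Polynomial.lead_coeff g = 1"
      using less.prems Q(1) by (simp add: g lead_coeff_mult monics_def monic_irreducible_def)
    hence "g \<in> monics (Polynomial.degree g)" by (simp add: monics_def)
    moreover have "Polynomial.degree g < k" using deg monic_irreducible_degree_pos[OF Q(1)] by simp
    ultimately have "(\<Sum>(P, i)\<in>prime_power_divisors g. Polynomial.degree P) = Polynomial.degree g"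
      using less.IH by blast
    moreover obtain v where "prime_power_divisors (Q * g) = insert (Q, Suc v) (prime_power_divisors g)"
      "(Q, Suc v) \<notin> prime_power_divisors g"
      by (rule prime_power_divisors_mult[OF Q(1) nz(2)])
    ultimately show ?thesis
      using finite_prime_power_divisors[OF nz(2)] deg
      by (simp add: g)
  qed
qed

text \<open>
  The coefficients of \<open>L(\<psi>, u) = \<Sum> \<psi>(f) u^(deg f)\<close> and, below, of its logarithmic derivative
  \<open>u L' / L\<close>.
\<close>
definition L_coeff :: "('a::finite_field poly \<Rightarrow> complex) \<Rightarrow> nat \<Rightarrow> complex"
  where "L_coeff \<psi> k = (\<Sum>f\<in>monics k. \<psi> f)"

definition S_coeff :: "('a::finite_field poly \<Rightarrow> complex) \<Rightarrow> nat \<Rightarrow> complex"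
  where "S_coeff \<psi> k = (\<Sum>(P, i)\<in>prime_powers k. of_nat (Polynomial.degree P) * \<psi> P ^ i)"

text \<open>
  This covers Dirichlet characters multiplied by \<open>z^(l deg f)\<close>, with the value zero at multiples
  of the modulus; the bound on the norm provides convergence inside the disc of radius \<open>1 / q\<close>.
\<close>
definition multiplicative_char :: "('a::finite_field poly \<Rightarrow> complex) \<Rightarrow> bool"
  where "multiplicative_char \<psi> \<longleftrightarrow>
    \<psi> 1 = 1 \<and> (\<forall>f g. \<psi> (f * g) = \<psi> f * \<psi> g) \<and> (\<forall>f. norm (\<psi> f) \<le> 1)"

lemma multiplicative_char_power: "multiplicative_char \<psi> \<Longrightarrow> \<psi> (f ^ i) = \<psi> f ^ i"
  by (induction i) (auto simp: multiplicative_char_def)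

text \<open>
  This is \<open>u L' = S L\<close> in coefficients. It is von Mangoldt's identity summed against \<open>\<psi>\<close>: a pair
  of \<open>f\<close> and a prime power \<open>P^i\<close> dividing \<open>f\<close> is the same as a pair of \<open>P^i\<close> and a cofactor \<open>h\<close>.
\<close>
lemma L_coeff_log_deriv:
  fixes \<psi> :: "'a::finite_field poly \<Rightarrow> complex"
  assumes "multiplicative_char \<psi>"
  shows "of_nat k * L_coeff \<psi> k = (\<Sum>j\<le>k. S_coeff \<psi> j * L_coeff \<psi> (k - j))"
proof -
  have nz: "f \<noteq> 0" if "f \<in> monics k" for f :: "'a poly" using that by (auto simp: monics_def)
  have "of_nat k * L_coeff \<psi> k =
      (\<Sum>f\<in>monics k. \<Sum>x\<in>prime_power_divisors f. of_nat (Polynomial.degree (fst x)) * \<psi> f)"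
    unfolding L_coeff_def sum_distrib_left
  proof (rule sum.cong)
    fix f :: "'a poly" assume f: "f \<in> monics k"
    have "of_nat k = (\<Sum>x\<in>prime_power_divisors f. of_nat (Polynomial.degree (fst x)) :: complex)"
      using degree_eq_sum_prime_power_divisors[OF f] unfolding case_prod_unfold
      by (metis of_nat_sum)
    thus "of_nat k * \<psi> f = (\<Sum>x\<in>prime_power_divisors f. of_nat (Polynomial.degree (fst x)) * \<psi> f)"
      by (simp add: sum_distrib_right)
  qed simp
  also have "\<dots> = (\<Sum>(f, x)\<in>Sigma (monics k) prime_power_divisors. of_nat (Polynomial.degree (fst x)) * \<psi> f)"
    using finite_monics finite_prime_power_divisors nz by (intro sum.Sigma) auto
  also have "\<dots> = (\<Sum>(j, x, h)\<in>Sigma {..k} (\<lambda>j. prime_powers j \<times> monics (k - j)).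
      of_nat (Polynomial.degree (fst x)) * \<psi> (fst x) ^ snd x * \<psi> h)"
  proof (rule sum.reindex_bij_witness[where
        i = "\<lambda>(j, x, h). (fst x ^ snd x * h, x)" and
        j = "\<lambda>(f, x). (snd x * Polynomial.degree (fst x), x, f div fst x ^ snd x)"])
    fix a assume "a \<in> Sigma (monics k) (prime_power_divisors :: 'a poly \<Rightarrow> _)"
    then obtain f P i where a: "a = (f, (P, i))" and f: "f \<in> monics k" and
      P: "monic_irreducible P" "i \<ge> 1" and "P ^ i dvd f"
      by (auto simp: prime_power_divisors_def)
    then obtain h where h: "f = P ^ i * h" by (elim dvdE)
    have P0: "P \<noteq> 0" using P by (auto simp: monic_irreducible_def)
    have h0: "h \<noteq> 0" using nz[OF f] h by auto
    have lc: "Polynomial.lead_coeff h = 1" using f P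
      by (simp add: h lead_coeff_mult monics_def monic_irreducible_def lead_coeff_power)
    have deg: "k = i * Polynomial.degree P + Polynomial.degree h"
      using f P0 h0 by (simp add: h degree_mult_eq monics_def degree_power_eq)
    have dv: "f div P ^ i = h" using P0 by (simp add: h)
    show "(case case a of (f, x) \<Rightarrow> (snd x * Polynomial.degree (fst x), x, f div fst x ^ snd x) of
         (j, x, h) \<Rightarrow> (fst x ^ snd x * h, x)) = a"
      using dv h by (simp add: a)
    show "(case a of (f, x) \<Rightarrow> (snd x * Polynomial.degree (fst x), x, f div fst x ^ snd x))
        \<in> (SIGMA j:{..k}. prime_powers j \<times> monics (k - j))"
      using dv P deg lc by (simp add: a prime_powers_def monics_def)
    show "(case case a of (f, x) \<Rightarrow> (snd x * Polynomial.degree (fst x), x, f div fst x ^ snd x) of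
         (j, x, h) \<Rightarrow> of_nat (Polynomial.degree (fst x)) * \<psi> (fst x) ^ snd x * \<psi> h) =
         (case a of (f, x) \<Rightarrow> of_nat (Polynomial.degree (fst x)) * \<psi> f)"
      using dv assms multiplicative_char_power[OF assms, of P i]
      by (simp add: a h multiplicative_char_def)
  next
    fix b assume "b \<in> (SIGMA j:{..k}. (prime_powers j :: ('a poly \<times> nat) set) \<times> (monics (k - j) :: 'a poly set))"
    then obtain P i h where b: "b = (i * Polynomial.degree P, (P, i), h)" and
      P: "monic_irreducible P" "i \<ge> 1" and le: "i * Polynomial.degree P \<le> k" and
      h: "h \<in> monics (k - i * Polynomial.degree P)"
      by (auto simp: prime_powers_def)
    have P0: "P \<noteq> 0" using P by (auto simp: monic_irreducible_def)
    have h0: "h \<noteq> 0" using h by (auto simp: monics_def)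
    show "(case case b of (j, x, h) \<Rightarrow> (fst x ^ snd x * h, x) of
          (f, x) \<Rightarrow> (snd x * Polynomial.degree (fst x), x, f div fst x ^ snd x)) = b"
      using P0 by (simp add: b)
    show "(case b of (j, x, h) \<Rightarrow> (fst x ^ snd x * h, x)) \<in> Sigma (monics k) prime_power_divisors"
    proof -
      have "P \<in> monics (Polynomial.degree P)" using P by (simp add: monics_def monic_irreducible_def)
      hence "P ^ i * h \<in> monics k" using monics_mult[OF monics_power[of P _ i] h] le by fastforce
      thus ?thesis using P by (simp add: b prime_power_divisors_def)
    qed
  qed
  also have "\<dots> = (\<Sum>j\<le>k. \<Sum>(x, h)\<in>prime_powers j \<times> monics (k - j).
      of_nat (Polynomial.degree (fst x)) * \<psi> (fst x) ^ snd x * \<psi> h)"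
    by (subst sum.Sigma) (auto simp: finite_prime_powers finite_monics)
  also have "\<dots> = (\<Sum>j\<le>k. S_coeff \<psi> j * L_coeff \<psi> (k - j))"
    by (intro sum.cong refl)
      (simp add: S_coeff_def L_coeff_def sum_product sum.cartesian_product case_prod_unfold)
  finally show ?thesis .
qed

lemma S_coeff_0: "S_coeff \<psi> 0 = 0"
proof -
  have "(prime_powers 0 :: ('a poly \<times> nat) set) = {}"
    by (auto simp: prime_powers_def dest: monic_irreducible_degree_pos)
  thus ?thesis by (simp add: S_coeff_def)
qed

lemma multiplicative_char_one: "multiplicative_char (\<lambda>_. 1)"
  by (simp add: multiplicative_char_def)

lemma L_coeff_one: "L_coeff (\<lambda>_ :: 'a::finite_field poly. 1) k = of_nat CARD('a) ^ k"
  by (simp add: L_coeff_def card_monics)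

text \<open>
  The prime number theorem for \<open>A\<close>, exact since the zeta function is \<open>1 / (1 - q u)\<close>: the
  recursion for the logarithmic derivative determines its coefficients.
\<close>
lemma S_coeff_one:
  "S_coeff (\<lambda>_ :: 'a::finite_field poly. 1) k = (if k = 0 then 0 else of_nat CARD('a) ^ k)"
proof (induction k rule: less_induct)
  case (less k)
  show ?case
  proof (cases "k = 0")
    case False
    let ?q = "of_nat CARD('a) :: complex" and ?S = "S_coeff (\<lambda>_ :: 'a poly. 1)"
    have "of_nat k * ?q ^ k = (\<Sum>j\<le>k. ?S j * ?q ^ (k - j))"
      using L_coeff_log_deriv[OF multiplicative_char_one, of k, where 'a='a] by (simp add: L_coeff_one)
    also have "\<dots> = ?S k + (\<Sum>j<k. ?S j * ?q ^ (k - j))"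
      by (simp add: lessThan_Suc_atMost[symmetric])
    also have "(\<Sum>j<k. ?S j * ?q ^ (k - j)) = (\<Sum>j<k. if j = 0 then 0 else ?q ^ k)"
      using less by (intro sum.cong) (auto simp flip: power_add)
    also have "\<dots> = (\<Sum>j\<in>{1..<k}. ?q ^ k)"
      by (rule sum.mono_neutral_cong_right) auto
    also have "\<dots> = of_nat (k - 1) * ?q ^ k" by simp
    finally have "?S k = of_nat k * ?q ^ k - of_nat (k - 1) * ?q ^ k" by simp
    also have "\<dots> = ?q ^ k" using False by (simp add: of_nat_diff algebra_simps)
    finally show ?thesis using False by simp
  qed (simp add: S_coeff_0)
qed

lemma norm_S_coeff_le:
  fixes \<psi> :: "'a::finite_field poly \<Rightarrow> complex"
  assumes "multiplicative_char \<psi>"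
  shows "norm (S_coeff \<psi> k) \<le> real CARD('a) ^ k"
proof -
  have "norm (S_coeff \<psi> k) \<le> (\<Sum>(P, i)\<in>(prime_powers k :: ('a poly \<times> nat) set). real (Polynomial.degree P))"
    unfolding S_coeff_def
  proof (rule sum_norm_le, clarify)
    fix P :: "'a poly" and i
    have "norm (\<psi> P) ^ i \<le> 1" using assms by (intro power_le_one) (auto simp: multiplicative_char_def)
    thus "norm (of_nat (Polynomial.degree P) * \<psi> P ^ i) \<le> real (Polynomial.degree P)"
      by (simp add: norm_mult norm_power mult_left_le)
  qed
  also have "\<dots> = norm (S_coeff (\<lambda>_ :: 'a poly. 1) k)"
  proof -
    have "S_coeff (\<lambda>_ :: 'a poly. 1) k = of_nat (\<Sum>(P, i)\<in>(prime_powers k :: ('a poly \<times> nat) set). Polynomial.degree P)"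
      unfolding S_coeff_def case_prod_unfold by simp
    thus ?thesis unfolding case_prod_unfold by (metis norm_of_nat of_nat_sum)
  qed
  also have "\<dots> \<le> real CARD('a) ^ k" by (simp add: S_coeff_one norm_power)
  finally show ?thesis .
qed

section \<open>Non-vanishing at the edge of convergence\<close>

unbundle fps_syntax

lemma fps_XD_nth': "(fps_X * fps_deriv F) $ k = of_nat k * (F $ k :: complex)"
  by (cases k) simp_all

lemma fps_log_deriv:
  assumes "multiplicative_char \<psi>"
  shows "fps_X * fps_deriv (Abs_fps (L_coeff \<psi>)) = Abs_fps (S_coeff \<psi>) * Abs_fps (L_coeff \<psi>)"
  by (rule fps_ext, unfold fps_XD_nth')
    (simp add: fps_mult_nth L_coeff_log_deriv[OF assms] atLeast0AtMost)

text \<open>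
  The recursion \<open>k F\<^sub>k = \<Sum>\<^sub>j B\<^sub>j F\<^sub>k\<^sub>-\<^sub>j\<close> keeps the coefficients of \<open>F\<close> nonnegative, and the
  single term \<open>B\<^sub>d F\<^sub>k\<^sub>-\<^sub>d\<close> propagates positivity from \<open>0\<close> to all multiples of \<open>d\<close>.
\<close>
lemma log_deriv_nonneg_imp_infinitely_many_coeffs:
  fixes F B :: "complex fps"
  assumes eq: "fps_X * fps_deriv F = B * F" and F0: "F $ 0 = 1"
    and B: "\<And>k. B $ k \<in> \<real>\<^sub>\<ge>\<^sub>0" and d: "d > 0" "Re (B $ d) > 0"
  shows "F $ (d * i) \<noteq> 0"
proof -
  have rec: "of_nat k * F $ k = (\<Sum>j\<le>k. B $ j * F $ (k - j))" for k
    using arg_cong[OF eq, of "\<lambda>f. f $ k"]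
    unfolding fps_XD_nth' by (simp add: fps_mult_nth atLeast0AtMost)
  have B0: "B $ 0 = 0" using rec[of 0] F0 by simp
  have real_part: "of_nat k * Re (F $ k) = (\<Sum>j\<le>k. Re (B $ j) * Re (F $ (k - j)))"
    if "\<And>j. j < k \<Longrightarrow> F $ j \<in> \<real>\<^sub>\<ge>\<^sub>0" for k
  proof -
    have "of_nat k * Re (F $ k) = Re (of_nat k * F $ k)" by simp
    also have "\<dots> = (\<Sum>j\<le>k. Re (B $ j * F $ (k - j)))" by (simp only: rec Re_sum)
    also have "\<dots> = (\<Sum>j\<le>k. Re (B $ j) * Re (F $ (k - j)))"
      using B by (intro sum.cong) (auto simp: complex_nonneg_Reals_iff)
    finally show ?thesis .
  qed
  have nonneg: "F $ k \<in> \<real>\<^sub>\<ge>\<^sub>0" for k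
  proof (induction k rule: less_induct)
    case (less k)
    show ?case
    proof (cases "k = 0")
      case False
      have "B $ j * F $ (k - j) \<in> \<real>\<^sub>\<ge>\<^sub>0" if "j \<le> k" for j
        using B less[of "k - j"] B0 that False by (cases "j = 0") (auto intro: nonneg_Reals_mult_I)
      hence "(\<Sum>j\<le>k. B $ j * F $ (k - j)) \<in> \<real>\<^sub>\<ge>\<^sub>0"
        unfolding complex_nonneg_Reals_iff Re_sum Im_sum by (auto intro!: sum_nonneg sum.neutral)
      hence "of_nat k * F $ k \<in> \<real>\<^sub>\<ge>\<^sub>0" by (simp add: rec)
      thus ?thesis using False by (auto simp: complex_nonneg_Reals_iff zero_le_mult_iff)
    qed (simp add: F0)
  qed
  have "Re (F $ (d * i)) > 0"
  proof (induction i)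
    case (Suc i)
    let ?k = "d * Suc i"
    have "0 < Re (B $ d) * Re (F $ (?k - d))" using Suc d by simp
    also have "\<dots> \<le> (\<Sum>j\<le>?k. Re (B $ j) * Re (F $ (?k - j)))"
      using nonneg B by (intro member_le_sum) (auto simp: complex_nonneg_Reals_iff)
    also have "\<dots> = of_nat ?k * Re (F $ ?k)" using real_part[of ?k] nonneg by simp
    finally have "0 < of_nat ?k * Re (F $ ?k)" .
    thus ?case by (rule zero_less_mult_pos) (use d in \<open>simp add: add_pos_nonneg\<close>)
  qed (simp add: F0)
  thus ?thesis by auto
qed

lemma exists_poly_with_coeffs:
  fixes l :: "nat \<Rightarrow> complex"
  assumes "\<And>k. k \<ge> D \<Longrightarrow> l k = 0"
  obtains Lp where "Abs_fps l = fps_of_poly Lp" "\<And>z. poly Lp z = (\<Sum>k<D. l k * z ^ k)"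
proof -
  define Lp where "Lp = (\<Sum>k<D. Polynomial.monom (l k) k)"
  have "poly.coeff Lp k = l k" for k
    using assms[of k] by (auto simp: Lp_def coeff_sum not_less)
  hence "Abs_fps l = fps_of_poly Lp" by (intro fps_ext) simp
  moreover have "poly Lp z = (\<Sum>k<D. l k * z ^ k)" for z
    by (simp add: Lp_def poly_sum poly_monom)
  ultimately show ?thesis by (rule that)
qed

text \<open>
  A zero at \<open>1 / q\<close> cancels a factor \<open>1 - q u\<close>, which is the inverse of the zeta series.
\<close>
lemma poly_root_factor:
  fixes l :: "nat \<Rightarrow> complex" and q :: complex
  assumes "\<And>k. k \<ge> D \<Longrightarrow> l k = 0" "(\<Sum>k<D. l k * (1 / q) ^ k) = 0" "q \<noteq> 0"
  obtains M where "Abs_fps l = (1 - fps_const q * fps_X) * fps_of_poly M"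
proof -
  obtain Lp where Lp: "Abs_fps l = fps_of_poly Lp" "\<And>z. poly Lp z = (\<Sum>k<D. l k * z ^ k)"
    using exists_poly_with_coeffs[of D l] assms(1) by blast
  have "poly Lp (1 / q) = 0" using assms Lp by simp
  hence "[:- (1 / q), 1:] dvd Lp" by (simp only: poly_eq_0_iff_dvd)
  then obtain N where N: "Lp = [:- (1 / q), 1:] * N" by (elim dvdE)
  have "Lp = [:1, - q:] * Polynomial.smult (- (1 / q)) N"
    using assms(3) by (simp add: N smult_add_right smult_diff_right)
  hence eq1: "fps_of_poly Lp = fps_of_poly [:1, - q:] * fps_of_poly (Polynomial.smult (- (1 / q)) N)"
    by (simp only: fps_of_poly_mult)
  have eq2: "fps_of_poly [:1, - q:] = 1 - fps_const q * fps_X"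
    by (rule fps_ext) (auto simp: coeff_pCons split: nat.splits)
  show ?thesis
    by (rule that[of "Polynomial.smult (- (1 / q)) N"]) (simp only: Lp(1) eq1 eq2)
qed

lemma L_coeff_cnj: "L_coeff (\<lambda>f. cnj (\<psi> f)) k = cnj (L_coeff \<psi> k)"
  by (simp add: L_coeff_def)

lemma multiplicative_char_cnj: "multiplicative_char \<psi> \<Longrightarrow> multiplicative_char (\<lambda>f. cnj (\<psi> f))"
  by (simp add: multiplicative_char_def)

text \<open>
  The argument of de la Vallee Poussin, on formal power series. If \<open>L(\<psi>, 1/q) = 0\<close>, the same
  holds for the conjugate character, and in \<open>F = Z\<^sup>2 L(\<psi>) L(cnj \<psi>)\<close>, \<open>Z = 1 / (1 - q u)\<close>, both
  poles cancel: \<open>F\<close> is a polynomial. But the logarithmic derivative of \<open>F\<close> has the nonnegative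
  coefficients \<open>\<Sum> deg P (2 + 2 Re \<psi>(P)^i)\<close>, with a positive one coming from \<open>P = p\<close>, where \<open>\<psi>\<close>
  vanishes; so \<open>F\<close> has infinitely many nonzero coefficients. Real and complex characters need no
  separate treatment.
\<close>
lemma L_nonvanishing:
  fixes \<psi> :: "'a::finite_field poly \<Rightarrow> complex"
  assumes \<psi>: "multiplicative_char \<psi>" and p: "monic_irreducible p" "\<psi> p = 0"
    and poly: "\<And>k. k \<ge> D \<Longrightarrow> L_coeff \<psi> k = 0"
  shows "(\<Sum>k<D. L_coeff \<psi> k * (1 / of_nat CARD('a)) ^ k) \<noteq> 0"
proof
  let ?q = "of_nat CARD('a) :: complex"
  assume root: "(\<Sum>k<D. L_coeff \<psi> k * (1 / ?q) ^ k) = 0"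
  have q0: "?q \<noteq> 0" by simp
  define \<psi>' where "\<psi>' = (\<lambda>f. cnj (\<psi> f))"
  have \<psi>': "multiplicative_char \<psi>'" unfolding \<psi>'_def by (rule multiplicative_char_cnj[OF \<psi>])
  obtain M where M: "Abs_fps (L_coeff \<psi>) = (1 - fps_const ?q * fps_X) * fps_of_poly M"
    using poly_root_factor[OF poly root q0] by blast
  have "(\<Sum>k<D. L_coeff \<psi>' k * (1 / ?q) ^ k) = cnj (\<Sum>k<D. L_coeff \<psi> k * (1 / ?q) ^ k)"
    by (simp add: \<psi>'_def L_coeff_cnj)
  hence "(\<Sum>k<D. L_coeff \<psi>' k * (1 / ?q) ^ k) = 0" using root by simp
  moreover have "L_coeff \<psi>' k = 0" if "k \<ge> D" for k using poly[OF that] by (simp add: \<psi>'_def L_coeff_cnj)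
  ultimately obtain M' where M': "Abs_fps (L_coeff \<psi>') = (1 - fps_const ?q * fps_X) * fps_of_poly M'"
    using poly_root_factor[of D "L_coeff \<psi>'" ?q] q0 by blast
  define Z where "Z = Abs_fps (L_coeff (\<lambda>_ :: 'a poly. 1))"
  have Z: "Z * (1 - fps_const ?q * fps_X) = 1"
  proof -
    have "Z * (1 - fps_const ?q * fps_X) = Z - fps_const ?q * (Z * fps_X)"
      by (simp add: right_diff_distrib mult.left_commute)
    also have "\<dots> = 1"
    proof (rule fps_ext)
      fix k show "(Z - fps_const ?q * (Z * fps_X)) $ k = 1 $ k"
        by (cases k) (simp_all add: Z_def L_coeff_one)
    qed
    finally show ?thesis .
  qed
  \<comment> \<open>The polynomial \<open>Z\<^sup>2 L(\<psi>) L(cnj \<psi>)\<close> and the coefficients \<open>B\<close> of its logarithmic derivative.\<close>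
  define F where "F = fps_of_poly (M * M')"
  have F: "F = Z * Z * (Abs_fps (L_coeff \<psi>) * Abs_fps (L_coeff \<psi>'))"
  proof -
    have "Z * Z * (Abs_fps (L_coeff \<psi>) * Abs_fps (L_coeff \<psi>')) =
        (Z * (1 - fps_const ?q * fps_X)) * (Z * (1 - fps_const ?q * fps_X)) * (fps_of_poly M * fps_of_poly M')"
      unfolding M M' by (simp only: mult_ac)
    thus ?thesis by (simp add: Z F_def fps_of_poly_mult)
  qed
  define B where "B = Abs_fps (S_coeff (\<lambda>_ :: 'a poly. 1)) + Abs_fps (S_coeff (\<lambda>_ :: 'a poly. 1)) +
    Abs_fps (S_coeff \<psi>) + Abs_fps (S_coeff \<psi>')"
  have "fps_X * fps_deriv F = B * F"
  proof -
    let ?L = "Abs_fps (L_coeff \<psi>)" and ?L' = "Abs_fps (L_coeff \<psi>')"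
    have "fps_X * fps_deriv F = 2 * (fps_X * fps_deriv Z) * Z * ?L * ?L' + Z * Z * (fps_X * fps_deriv ?L) * ?L'
        + Z * Z * ?L * (fps_X * fps_deriv ?L')"
      by (simp add: F algebra_simps)
    also have "fps_X * fps_deriv Z = Abs_fps (S_coeff (\<lambda>_ :: 'a poly. 1)) * Z"
      unfolding Z_def by (rule fps_log_deriv[OF multiplicative_char_one])
    also note fps_log_deriv[OF \<psi>]
    also note fps_log_deriv[OF \<psi>']
    finally show ?thesis by (simp add: B_def F algebra_simps)
  qed
  moreover have "F $ 0 = 1"
    using \<psi> \<psi>' by (simp add: F Z_def L_coeff_def multiplicative_char_def)
  moreover have Bk: "B $ k = of_real (\<Sum>x\<in>(prime_powers k :: ('a poly \<times> nat) set).
      real (Polynomial.degree (fst x)) * (2 + 2 * Re (\<psi> (fst x) ^ snd x)))" for k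
  proof -
    have "B $ k = (\<Sum>x\<in>(prime_powers k :: ('a poly \<times> nat) set).
        of_nat (Polynomial.degree (fst x)) * (1 + 1 + \<psi> (fst x) ^ snd x + cnj (\<psi> (fst x) ^ snd x)))"
      by (simp add: B_def \<psi>'_def S_coeff_def case_prod_unfold sum.distrib distrib_left)
        (simp add: sum_distrib_left mult.commute)
    also have "\<dots> = (\<Sum>x\<in>(prime_powers k :: ('a poly \<times> nat) set).
        of_real (real (Polynomial.degree (fst x)) * (2 + 2 * Re (\<psi> (fst x) ^ snd x))))"
      by (intro sum.cong refl) (simp add: complex_add_cnj[unfolded of_real_mult] add.assoc del: complex_cnj_power)
    finally show ?thesis by simp
  qed
  have pos: "2 + 2 * Re (\<psi> f ^ i) \<ge> 0" for f i
  proof -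
    have "norm (\<psi> f ^ i) \<le> 1" using \<psi>
      by (auto simp: multiplicative_char_def norm_power intro: power_le_one)
    thus ?thesis using abs_Re_le_cmod[of "\<psi> f ^ i"] by linarith
  qed
  have "B $ k \<in> \<real>\<^sub>\<ge>\<^sub>0" for k
    unfolding Bk nonneg_Reals_of_real_iff using pos by (intro sum_nonneg mult_nonneg_nonneg) auto
  moreover have d: "Polynomial.degree p > 0" by (rule monic_irreducible_degree_pos[OF p(1)])
  moreover have "Re (B $ Polynomial.degree p) > 0"
  proof -
    have "0 < real (Polynomial.degree (fst (p, 1 :: nat))) * (2 + 2 * Re (\<psi> (fst (p, 1 :: nat)) ^ snd (p, 1 :: nat)))"
      using d p by simp
    also have "\<dots> \<le> (\<Sum>x\<in>(prime_powers (Polynomial.degree p) :: ('a poly \<times> nat) set).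
      real (Polynomial.degree (fst x)) * (2 + 2 * Re (\<psi> (fst x) ^ snd x)))"
      using pos finite_prime_powers p by (intro member_le_sum) (auto simp: prime_powers_def)
    finally show ?thesis by (simp add: Bk)
  qed
  ultimately have nz: "F $ (Polynomial.degree p * i) \<noteq> 0" for i
    using log_deriv_nonneg_imp_infinitely_many_coeffs by blast
  \<comment> \<open>A multiple of \<open>deg p\<close> beyond the degree of the polynomial.\<close>
  have "Polynomial.degree p * Suc (Polynomial.degree (M * M')) > Polynomial.degree (M * M')"
    using d mult_le_mono1[of 1 "Polynomial.degree p" "Suc (Polynomial.degree (M * M'))"] by simp
  hence "F $ (Polynomial.degree p * Suc (Polynomial.degree (M * M'))) = 0"
    by (simp add: F_def coeff_eq_0)
  thus False using nz by blast
qed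

abbreviation S_fun :: "('a::finite_field poly \<Rightarrow> complex) \<Rightarrow> real \<Rightarrow> complex"
  where "S_fun \<psi> u \<equiv> eval_fps (Abs_fps (S_coeff \<psi>)) (of_real u)"

lemma fps_conv_radius_geI:
  fixes F :: "complex fps"
  assumes "\<And>k. norm (F $ k) \<le> C * a ^ k" "a > 0"
  shows "fps_conv_radius F \<ge> ereal (1 / a)"
  unfolding fps_conv_radius_def
proof (rule conv_radius_geI_ex')
  fix r :: real assume r: "0 < r" "ereal r < ereal (1 / a)"
  have "summable (\<lambda>k. C * (a * r) ^ k)"
    using r assms(2) by (intro summable_mult summable_geometric) (auto simp: field_simps)
  thus "summable (\<lambda>n. F $ n * of_real r ^ n)"
    using r assms by (elim summable_comparison_test'[where N = 0])
      (auto simp: norm_mult norm_power power_mult_distrib mult.assoc[symmetric] intro!: mult_right_mono)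
qed

lemma tendsto_eval_fps_at_left:
  fixes F :: "complex fps"
  assumes "ereal a < fps_conv_radius F" "a > 0"
  shows "((\<lambda>u. eval_fps F (of_real u)) \<longlongrightarrow> eval_fps F (of_real a)) (at_left a)"
proof -
  have "isCont (eval_fps F) (of_real a)"
    using assms by (intro continuous_eval_fps) auto
  moreover have "((\<lambda>u. of_real u :: complex) \<longlongrightarrow> of_real a) (at_left a)"
    by (intro tendsto_intros)
  ultimately show ?thesis by (rule isCont_tendsto_compose)
qed

text \<open>
  Inside the disc \<open>S = u L' / L\<close>, and the right-hand side stays bounded as \<open>u\<close> tends to \<open>1 / q\<close>
  because \<open>L\<close> is a polynomial without zero there.
\<close>
lemma residue_zero_if_L_polynomial:
  fixes \<psi> :: "'a::finite_field poly \<Rightarrow> complex"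
  defines "q \<equiv> real CARD('a)"
  assumes \<psi>: "multiplicative_char \<psi>" and p: "monic_irreducible p" "\<psi> p = 0"
    and poly: "\<And>k. k \<ge> D \<Longrightarrow> L_coeff \<psi> k = 0"
  shows "((\<lambda>u. of_real (1 - q * u) * S_fun \<psi> u) \<longlongrightarrow> 0) (at_left (1 / q))"
proof -
  have q: "q > 0" by (simp add: q_def)
  obtain Lp where Lf: "Abs_fps (L_coeff \<psi>) = fps_of_poly Lp"
      and Lp: "\<And>z. poly Lp z = (\<Sum>k<D. L_coeff \<psi> k * z ^ k)"
    using exists_poly_with_coeffs[of D "L_coeff \<psi>"] poly by blast
  have rad: "fps_conv_radius (Abs_fps (S_coeff \<psi>)) \<ge> ereal (1 / q)"
    using norm_S_coeff_le[OF \<psi>] q by (intro fps_conv_radius_geI[of _ 1]) (auto simp: q_def)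
  have eq: "of_real u * poly (pderiv Lp) (of_real u) =
      S_fun \<psi> u * poly Lp (of_real u)" if "0 < u" "u < 1 / q" for u
  proof -
    have "eval_fps (fps_X * fps_deriv (fps_of_poly Lp)) (of_real u) =
      eval_fps (Abs_fps (S_coeff \<psi>) * fps_of_poly Lp) (of_real u)"
      using fps_log_deriv[OF \<psi>] by (simp add: Lf)
    moreover have "fps_X * fps_deriv (fps_of_poly Lp) = fps_of_poly (pCons 0 (pderiv Lp))"
      by (rule fps_ext) (simp add: fps_XD_nth' coeff_pCons coeff_pderiv split: nat.splits)
    moreover have "ereal (norm (of_real u :: complex)) < fps_conv_radius (Abs_fps (S_coeff \<psi>))"
      using that rad by (intro less_le_trans[OF _ rad]) simp
    ultimately show ?thesis by (simp add: eval_fps_mult)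
  qed
  have nz: "poly Lp (of_real (1 / q)) \<noteq> 0"
    using L_nonvanishing[OF \<psi> p poly] by (simp add: Lp q_def)
  have lim1: "((\<lambda>u. of_real (1 - q * u) * (of_real u * poly (pderiv Lp) (of_real u) / poly Lp (of_real u)))
     \<longlongrightarrow> of_real (1 - q * (1 / q)) * (of_real (1 / q) * poly (pderiv Lp) (of_real (1 / q)) / poly Lp (of_real (1 / q))))
     (at_left (1 / q))"
    by (intro tendsto_intros nz)
  have "\<forall>\<^sub>F u in at_left (1 / q). poly Lp (of_real u) \<noteq> 0"
    by (rule tendsto_imp_eventually_ne[OF _ nz]) (intro tendsto_intros)
  moreover have "\<forall>\<^sub>F u in at_left (1 / q). u \<in> {0<..<1 / q}"
    using q by (intro eventually_at_left_real) auto
  ultimately have "\<forall>\<^sub>F u in at_left (1 / q).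
     of_real (1 - q * u) * (of_real u * poly (pderiv Lp) (of_real u) / poly Lp (of_real u)) =
     of_real (1 - q * u) * S_fun \<psi> u"
    by eventually_elim (simp add: eq)
  from Lim_transform_eventually[OF lim1 this] q show ?thesis by simp
qed

section \<open>Characters of the residue field\<close>

lemma cis_root_of_unity_eq_iff:
  assumes "N \<ge> 1"
  shows "cis (2 * pi / real N) ^ a = cis (2 * pi / real N) ^ b \<longleftrightarrow> [a = b] (mod N)"
proof -
  have *: "cis (2 * pi / real N) ^ k = exp (2 * of_real pi * \<i> * of_nat k / of_nat N)" for k
    by (simp add: cis_conv_exp mult_ac flip: exp_of_nat_mult)
  show ?thesis
    unfolding * complex_root_unity_eq[OF assms] cong_def ..
qed

text \<open>
  Orthogonality on a cyclic group: the number \<open>z * cnj w\<close> is an \<open>N\<close>-th root of unity, equal to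
  \<open>1\<close> only if \<open>z = w\<close>.
\<close>
lemma sum_powers_root_of_unity:
  fixes z w :: complex
  assumes "norm z = 1" "norm w = 1" "z ^ N = 1" "w ^ N = 1"
  shows "(\<Sum>j<N. (z * cnj w) ^ j) = (if z = w then of_nat N else 0)"
proof (cases "z = w")
  case True
  have "w * cnj w = 1" using assms by (simp add: complex_norm_square[symmetric])
  thus ?thesis using True by simp
next
  case False
  have "w * cnj w = 1" using assms by (simp add: complex_norm_square[symmetric])
  hence "z * cnj w \<noteq> 1" using False
    by (metis mult.assoc mult.commute mult.right_neutral)
  moreover have "(z * cnj w) ^ N = 1" using assms by (simp add: power_mult_distrib flip: complex_cnj_power)
  ultimately have "(\<Sum>j<N. (z * cnj w) ^ j) = 0" by (simp add: sum_gp_strict)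
  thus ?thesis using False by simp
qed

text \<open>
  The multiplicative group of the residue field is cyclic of order \<open>N\<close>.
\<close>
lemma exists_generator_mod_irreducible:
  fixes p :: "'a::finite_field poly"
  assumes "Factorial_Ring.irreducible p"
  defines "N \<equiv> CARD('a) ^ Polynomial.degree p - 1"
  obtains g where "\<And>f. \<not> p dvd f \<Longrightarrow> \<exists>i. p dvd f - g ^ i" "\<not> p dvd g" "N \<ge> 1"
    "\<And>i j. p dvd g ^ i - g ^ j \<longleftrightarrow> [i = j] (mod N)"
proof -
  let ?k = "residue_ring_poly p"
  interpret field ?k by (rule residue_ring_poly_field[OF assms(1)])
  have pos: "Polynomial.degree p > 0" by (rule irreducible_degree_pos[OF assms(1)])
  have fin: "finite (carrier ?k)" by (rule card_residue_ring_poly[OF pos])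
  obtain a where a: "a \<in> carrier (Multiplicative_Group.mult_of ?k)" "carrier (Multiplicative_Group.mult_of ?k) = {a [^]\<^bsub>?k\<^esub> i | i::nat. i \<in> UNIV}"
    using finite_field_mult_group_has_gen[OF fin] by (rule bexE) (rule that)
  have "a \<in> carrier ?k" using a(1) by simp
  then obtain g where g: "a = residue_class p g" by (auto simp: carrier_residue_ring_poly)
  have "\<not> p dvd g" using a(1) by (auto simp: g residue_class_zero residue_class_eq_iff)
  have gen: "\<exists>i. p dvd f - g ^ i" if "\<not> p dvd f" for f
  proof -
    have "residue_class p f \<noteq> residue_class p 0" using that unfolding residue_class_eq_iff by simp
    hence "residue_class p f \<in> carrier (Multiplicative_Group.mult_of ?k)" by (simp add: residue_class_zero)
    then obtain i :: nat where "residue_class p f = a [^]\<^bsub>?k\<^esub> i" using a(2) by blast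
    thus ?thesis unfolding g residue_class_pow residue_class_eq_iff by blast
  qed
  interpret G: group "Multiplicative_Group.mult_of ?k" by (rule field_mult_group)
  let ?N = "G.ord a"
  have fin': "finite (carrier (Multiplicative_Group.mult_of ?k))" using fin by simp
  have "carrier (Multiplicative_Group.mult_of ?k) = (\<lambda>i. a [^]\<^bsub>Multiplicative_Group.mult_of ?k\<^esub> i) ` {0..?N - 1}"
    using G.ord_elems[OF fin' a(1)] a(2) by (auto simp: Multiplicative_Group.nat_pow_mult_of)
  hence "card (carrier (Multiplicative_Group.mult_of ?k)) = card {0..?N - 1}"
    using G.ord_inj[OF a(1)] by (simp add: card_image)
  moreover have N1: "?N \<ge> 1" by (rule G.ord_ge_1[OF fin' a(1)])
  moreover have "card (carrier (Multiplicative_Group.mult_of ?k)) = N"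
    using card_residue_ring_poly[OF pos] by (simp add: card_Diff_singleton N_def)
  ultimately have N: "?N = N" by simp
  have "p dvd g ^ i - g ^ j \<longleftrightarrow> [i = j] (mod N)" for i j
  proof -
    have "p dvd g ^ i - g ^ j \<longleftrightarrow> a [^]\<^bsub>?k\<^esub> i = a [^]\<^bsub>?k\<^esub> j"
      unfolding g residue_class_pow residue_class_eq_iff ..
    also have "\<dots> \<longleftrightarrow> a [^]\<^bsub>Multiplicative_Group.mult_of ?k\<^esub> (int i) = a [^]\<^bsub>Multiplicative_Group.mult_of ?k\<^esub> (int j)"
      by (simp add: int_pow_int Multiplicative_Group.nat_pow_mult_of)
    also have "\<dots> \<longleftrightarrow> int N dvd int j - int i" by (simp add: G.int_pow_eq[OF a(1)] N)
    also have "\<dots> \<longleftrightarrow> [i = j] (mod N)"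
      by (metis cong_iff_dvd_diff cong_int_iff cong_sym_eq)
    finally show ?thesis .
  qed
  moreover have "N \<ge> 1" using N N1 by simp
  ultimately show ?thesis using that[OF gen \<open>\<not> p dvd g\<close>] by blast
qed

text \<open>
  Send a generator of the cyclic group \<open>\<kappa>\<^sup>\<times>\<close> to a primitive \<open>N\<close>-th root of unity. Its powers
  \<open>\<theta>^j\<close> are then all characters modulo \<open>p\<close>, so that no duality theory is needed.
\<close>
lemma exists_faithful_character:
  fixes p :: "'a::finite_field poly"
  assumes irr: "Factorial_Ring.irreducible p"
  defines "N \<equiv> CARD('a) ^ Polynomial.degree p - 1"
  obtains \<theta> :: "'a poly \<Rightarrow> complex" where "N \<ge> 1" "\<And>f g. \<theta> (f * g) = \<theta> f * \<theta> g"
    "\<And>f. p dvd f \<Longrightarrow> \<theta> f = 0" "\<And>f. \<not> p dvd f \<Longrightarrow> \<theta> f ^ N = 1" "\<And>f. \<not> p dvd f \<Longrightarrow> norm (\<theta> f) = 1"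
    "\<And>f g. \<not> p dvd f \<Longrightarrow> \<not> p dvd g \<Longrightarrow> \<theta> f = \<theta> g \<longleftrightarrow> p dvd f - g"
    "\<And>j. 0 < j \<Longrightarrow> j < N \<Longrightarrow> \<exists>b. \<not> p dvd b \<and> \<theta> b ^ j \<noteq> 1"
proof -
  obtain g where g: "\<And>f. \<not> p dvd f \<Longrightarrow> \<exists>i. p dvd f - g ^ i" "\<not> p dvd g" "N \<ge> 1"
    "\<And>i j. p dvd g ^ i - g ^ j \<longleftrightarrow> [i = j] (mod N)"
    using exists_generator_mod_irreducible[OF irr] unfolding N_def by blast
  define \<omega> where "\<omega> = cis (2 * pi / real N)"
  have \<omega>: "\<omega> ^ i = \<omega> ^ j \<longleftrightarrow> [i = j] (mod N)" for i j
    unfolding \<omega>_def by (rule cis_root_of_unity_eq_iff[OF g(3)])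
  define \<theta> where "\<theta> = (\<lambda>f. if p dvd f then 0 else \<omega> ^ (SOME i. p dvd f - g ^ i))"
  have gp: "\<not> p dvd g ^ i" for i
    using g(2) irr by (induction i) (auto simp: irreducible_dvd_mult_iff)
  have \<theta>: "\<theta> f = \<omega> ^ i" if "p dvd f - g ^ i" for f i
  proof -
    have "\<not> p dvd f" using dvd_diff[OF _ that, of f] gp[of i] by auto
    moreover have "p dvd f - g ^ (SOME i. p dvd f - g ^ i)" using that by (rule someI)
    hence "p dvd g ^ (SOME i. p dvd f - g ^ i) - g ^ i"
      using that dvd_diff[OF that, of "f - g ^ (SOME i. p dvd f - g ^ i)"] by simp
    hence "\<omega> ^ (SOME i. p dvd f - g ^ i) = \<omega> ^ i" by (simp add: \<omega> g)
    ultimately show ?thesis by (simp add: \<theta>_def)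
  qed
  have norm1: "norm (\<omega> ^ i) = 1" for i by (simp add: \<omega>_def norm_power)
  show ?thesis
  proof (rule that)
    show "N \<ge> 1" by (rule g)
    show "\<theta> f = 0" if "p dvd f" for f using that by (simp add: \<theta>_def)
    show "\<theta> (f * f') = \<theta> f * \<theta> f'" for f f'
    proof (cases "p dvd f \<or> p dvd f'")
      case True
      thus ?thesis by (auto simp: \<theta>_def)
    next
      case False
      then obtain i j where ij: "p dvd f - g ^ i" "p dvd f' - g ^ j" using g(1)[of f] g(1)[of f'] by blast
      have "f * f' - g ^ (i + j) = (f - g ^ i) * f' + g ^ i * (f' - g ^ j)"
        by (simp add: algebra_simps power_add)
      hence "p dvd f * f' - g ^ (i + j)" using ij by simp
      thus ?thesis using \<theta>[OF ij(1)] \<theta>[OF ij(2)] \<theta>[of "f * f'" "i + j"] by (simp add: power_add)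
    qed
    show "\<theta> f ^ N = 1" if nd: "\<not> p dvd f" for f
    proof -
      obtain i where i: "p dvd f - g ^ i" using g(1)[OF nd] by blast
      have "\<omega> ^ (i * N) = \<omega> ^ 0" unfolding \<omega> by (simp add: cong_def)
      thus ?thesis using \<theta>[OF i] by (simp add: power_mult)
    qed
    show "norm (\<theta> f) = 1" if "\<not> p dvd f" for f
      using g(1)[OF that] \<theta> norm1 by metis
    show "\<theta> f = \<theta> f' \<longleftrightarrow> p dvd f - f'" if nd: "\<not> p dvd f" "\<not> p dvd f'" for f f'
    proof -
      obtain i j where ij: "p dvd f - g ^ i" "p dvd f' - g ^ j" using g(1)[OF nd(1)] g(1)[OF nd(2)] by blast
      have "\<theta> f = \<theta> f' \<longleftrightarrow> p dvd g ^ i - g ^ j" using \<theta>[OF ij(1)] \<theta>[OF ij(2)] \<omega> g(4) by simp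
      also have "\<dots> \<longleftrightarrow> residue_class p f = residue_class p f'"
        using ij unfolding residue_class_eq_iff[symmetric] by simp
      finally show ?thesis by (simp add: residue_class_eq_iff)
    qed
    show "\<exists>b. \<not> p dvd b \<and> \<theta> b ^ j \<noteq> 1" if "0 < j" "j < N" for j
    proof -
      have "\<theta> g = \<omega> ^ 1" by (rule \<theta>) simp
      moreover have "\<omega> ^ j \<noteq> \<omega> ^ 0" unfolding \<omega> using that by (simp add: cong_def)
      ultimately show ?thesis using g(2) by auto
    qed
  qed
qed

text \<open>
  The monic polynomials of degree at least \<open>deg p\<close> are equally distributed over the residues
  modulo \<open>p\<close>, and the sum of a nontrivial character over all residues is zero. Therefore the
  \<open>L\<close>-series of such a character is a polynomial.
\<close>
lemma sum_character_monics_eq_0: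
  fixes p :: "'a::finite_field poly" and \<theta> :: "'a poly \<Rightarrow> complex"
  assumes p: "monic_irreducible p" and mult: "\<And>f g. \<theta> (f * g) = \<theta> f * \<theta> g"
    and per: "\<And>f g. p dvd f - g \<Longrightarrow> \<theta> f = \<theta> g"
    and b: "\<not> p dvd b" "\<theta> b \<noteq> 1" and k: "k \<ge> Polynomial.degree p"
  shows "(\<Sum>f\<in>monics k. \<theta> f) = 0"
proof -
  let ?d = "Polynomial.degree p" and ?S = "{r :: 'a poly. Polynomial.degree r < Polynomial.degree p}"
  have irr: "Factorial_Ring.irreducible p" and pos: "?d > 0"
    using p by (auto simp: monic_irreducible_def irreducible_degree_pos)
  have bij: "bij_betw (\<lambda>r. (b * r) mod p) ?S ?S"
    by (rule bij_betw_mult_mod_irreducible[OF irr b(1)])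
  have "(\<Sum>r\<in>?S. \<theta> r) = (\<Sum>r\<in>?S. \<theta> ((b * r) mod p))"
    by (rule sum.reindex_bij_betw[OF bij, symmetric])
  also have "\<dots> = (\<Sum>r\<in>?S. \<theta> b * \<theta> r)"
  proof (rule sum.cong)
    fix r
    have "p dvd (b * r) mod p - b * r" by (metis mod_eq_dvd_iff mod_mod_trivial)
    thus "\<theta> ((b * r) mod p) = \<theta> b * \<theta> r" using per mult by simp
  qed simp
  also have "\<dots> = \<theta> b * (\<Sum>r\<in>?S. \<theta> r)" by (rule sum_distrib_left[symmetric])
  finally have "(1 - \<theta> b) * (\<Sum>r\<in>?S. \<theta> r) = 0" by (simp add: left_diff_distrib)
  hence zero: "(\<Sum>r\<in>?S. \<theta> r) = 0" using b by simp
  obtain j where j: "k = ?d + j" using k le_Suc_ex by blast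
  have "(\<Sum>f\<in>monics k. \<theta> f) = (\<Sum>x\<in>monics j \<times> ?S. \<theta> (case x of (h, r) \<Rightarrow> p * h + r))"
    unfolding j using p pos by (intro sum.reindex_bij_betw[OF bij_betw_monics_div, symmetric])
      (auto simp: monic_irreducible_def)
  also have "\<dots> = (\<Sum>x\<in>(monics j :: 'a poly set) \<times> ?S. \<theta> (snd x))"
    by (rule sum.cong[OF refl]) (auto intro: per)
  also have "\<dots> = (\<Sum>h\<in>(monics j :: 'a poly set). \<Sum>r\<in>?S. \<theta> r)"
    by (simp only: sum.cartesian_product case_prod_unfold)
  finally show ?thesis by (simp add: zero)
qed

section \<open>Irreducible polynomials in a residue class with prescribed degree class\<close>

lemma sum_degree_prime_powers:
  "(\<Sum>x\<in>(prime_powers k :: ('a::finite_field poly \<times> nat) set). Polynomial.degree (fst x)) =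
     (if k = 0 then 0 else CARD('a) ^ k)"
proof -
  have "of_nat (\<Sum>x\<in>(prime_powers k :: ('a poly \<times> nat) set). Polynomial.degree (fst x)) =
      S_coeff (\<lambda>_ :: 'a poly. 1) k"
    by (simp add: S_coeff_def case_prod_unfold)
  also have "\<dots> = of_nat (if k = 0 then 0 else CARD('a) ^ k)" by (simp add: S_coeff_one)
  finally show ?thesis by (simp only: of_nat_eq_iff)
qed

text \<open>
  A proper power \<open>P^i\<close> of degree \<open>k\<close> has \<open>deg P \<le> k / 2\<close>, so for each \<open>i\<close> the degrees of these
  \<open>P\<close> add up to at most \<open>q^(k/2)\<close>.
\<close>
lemma sum_degree_higher_prime_powers_le:
  "(\<Sum>x\<in>{x \<in> (prime_powers k :: ('a::finite_field poly \<times> nat) set). snd x \<ge> 2}. Polynomial.degree (fst x))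
     \<le> k * CARD('a) ^ (k div 2)"
proof -
  let ?A = "{x \<in> (prime_powers k :: ('a poly \<times> nat) set). snd x \<ge> 2}"
  have "(\<Sum>x\<in>?A. Polynomial.degree (fst x)) =
      (\<Sum>i\<in>{2..k}. \<Sum>x\<in>{x \<in> ?A. snd x = i}. Polynomial.degree (fst x))"
  proof (rule sum.group[symmetric])
    show "finite ?A" by (rule finite_subset[OF _ finite_prime_powers[of k]]) auto
    show "snd ` ?A \<subseteq> {2..k}"
      by (auto simp: prime_powers_def dest: monic_irreducible_degree_pos)
  qed simp
  also have "\<dots> \<le> (\<Sum>i\<in>{2..k}. CARD('a) ^ (k div 2))"
  proof (rule sum_mono)
    fix i assume i: "i \<in> {2..k}"
    let ?B = "{x \<in> ?A. snd x = i}" and ?f = "\<lambda>x :: 'a poly \<times> nat. (fst x, 1 :: nat)"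
    have inj: "inj_on ?f ?B" by (auto simp: inj_on_def)
    have "?f ` ?B \<subseteq> prime_powers (k div i)" using i by (auto simp: prime_powers_def)
    hence "(\<Sum>x\<in>?f ` ?B. Polynomial.degree (fst x)) \<le>
        (\<Sum>x\<in>(prime_powers (k div i) :: ('a poly \<times> nat) set). Polynomial.degree (fst x))"
      by (intro sum_mono2 finite_prime_powers) auto
    also have "(\<Sum>x\<in>?f ` ?B. Polynomial.degree (fst x)) = (\<Sum>x\<in>?B. Polynomial.degree (fst x))"
      using inj by (simp add: sum.reindex)
    also have "(\<Sum>x\<in>(prime_powers (k div i) :: ('a poly \<times> nat) set). Polynomial.degree (fst x)) \<le> CARD('a) ^ (k div i)"
      by (simp add: sum_degree_prime_powers)
    also have "\<dots> \<le> CARD('a) ^ (k div 2)"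
      using i by (intro power_increasing div_le_mono2) auto
    finally show "(\<Sum>x\<in>?B. Polynomial.degree (fst x)) \<le> CARD('a) ^ (k div 2)" .
  qed
  also have "\<dots> \<le> k * CARD('a) ^ (k div 2)" by simp
  finally show ?thesis .
qed

text \<open>
  For a character that depends on the degree only, away from \<open>p\<close>, the prime number theorem gives
  \<open>S(u) = \<Sum> (y q u)^k - \<Sum> T\<^sub>k u^k\<close>, where \<open>T\<close> corrects the constant term and the powers of \<open>p\<close>.
  The second series converges in the unit disc, and the geometric one has its pole at \<open>1 / q\<close>
  exactly for \<open>y = 1\<close>.
\<close>
lemma residue_of_unramified_char:
  fixes p :: "'a::finite_field poly" and y :: complex
  defines "q \<equiv> real CARD('a)" and "\<psi> \<equiv> \<lambda>f. if p dvd f then 0 else y ^ Polynomial.degree f"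
  assumes p: "monic_irreducible p" and y: "norm y = 1"
  shows "((\<lambda>u. of_real (1 - q * u) * S_fun \<psi> u) \<longlongrightarrow>
     (if y = 1 then 1 else 0)) (at_left (1 / q))"
proof -
  let ?d = "Polynomial.degree p" and ?q = "complex_of_real q"
  have d: "?d > 0" by (rule monic_irreducible_degree_pos[OF p])
  have q: "q > 1" using card_field_gt_1[where 'a = 'a] by (simp add: q_def)
  \<comment> \<open>The value at \<open>0\<close> compensates the constant term of the geometric series.\<close>
  define T where "T = (\<lambda>k. if k = 0 then 1 else if ?d dvd k then y ^ k * of_nat ?d else 0)"
  have S: "S_coeff \<psi> k = (y * ?q) ^ k - T k" for k
  proof (cases "k = 0")
    case True
    thus ?thesis by (simp add: S_coeff_0 T_def)
  next
    case False
    let ?P = "prime_powers k :: ('a poly \<times> nat) set"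
    have "S_coeff \<psi> k = (\<Sum>x\<in>?P. of_nat (Polynomial.degree (fst x)) * \<psi> (fst x) ^ snd x)"
      by (simp add: S_coeff_def case_prod_unfold)
    also have "\<dots> = (\<Sum>x\<in>?P. y ^ k * of_nat (Polynomial.degree (fst x)) -
        (if fst x = p then y ^ k * of_nat ?d else 0))"
    proof (rule sum.cong)
      fix x assume "x \<in> ?P"
      then obtain P i where x: "x = (P, i)" "monic_irreducible P" "i \<ge> 1" "i * Polynomial.degree P = k"
        by (auto simp: prime_powers_def)
      have "p dvd P \<longleftrightarrow> P = p" using monic_irreducible_dvd_iff[OF p x(2)] by auto
      thus "of_nat (Polynomial.degree (fst x)) * \<psi> (fst x) ^ snd x = y ^ k * of_nat (Polynomial.degree (fst x)) -
        (if fst x = p then y ^ k * of_nat ?d else 0)"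
        using x by (auto simp: \<psi>_def power_mult[symmetric] mult.commute)
    qed simp
    also have "\<dots> = y ^ k * of_nat (\<Sum>x\<in>?P. Polynomial.degree (fst x)) -
        (\<Sum>x\<in>?P. if fst x = p then y ^ k * of_nat ?d else 0)"
      by (simp add: sum_subtractf sum_distrib_left)
    also have "(\<Sum>x\<in>?P. Polynomial.degree (fst x)) = CARD('a) ^ k"
      using False by (simp add: sum_degree_prime_powers)
    also have "(\<Sum>x\<in>?P. if fst x = p then y ^ k * of_nat ?d else 0) = T k"
    proof (cases "?d dvd k")
      case True
      then obtain i where "k = ?d * i" by (elim dvdE)
      hence i: "k = i * ?d" by simp
      have "{x \<in> ?P. fst x = p} = {(p, i)}"
        using False i d p by (auto simp: prime_powers_def)
      thus ?thesis using finite_prime_powers[of k, where 'a='a] True False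
        by (simp add: T_def sum.inter_filter[symmetric])
    next
      case False
      hence "{x \<in> ?P. fst x = p} = {}" by (auto simp: prime_powers_def)
      thus ?thesis using finite_prime_powers[of k, where 'a='a] False \<open>k \<noteq> 0\<close>
        by (simp add: T_def sum.inter_filter[symmetric])
    qed
    finally show ?thesis by (simp add: q_def power_mult_distrib)
  qed
  have "fps_conv_radius (Abs_fps T) \<ge> ereal (1 / 1)"
    by (rule fps_conv_radius_geI[where C = "real (?d)"])
      (use d y in \<open>auto simp: T_def norm_mult norm_power\<close>)
  moreover have "ereal (1 / q) < ereal (1 / 1)" using q by simp
  ultimately have radT: "ereal (1 / q) < fps_conv_radius (Abs_fps T)" by (rule less_le_trans[rotated])
  have ev: "S_fun \<psi> u =
      1 / (1 - y * ?q * of_real u) - eval_fps (Abs_fps T) (of_real u)" if u: "0 < u" "u < 1 / q" for u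
  proof -
    have "norm (y * ?q * of_real u) < 1"
      using u q y by (simp add: norm_mult field_simps)
    hence "(\<lambda>k. (y * ?q * of_real u) ^ k) sums (1 / (1 - y * ?q * of_real u))"
      by (rule geometric_sums)
    moreover have "summable (\<lambda>k. Abs_fps T $ k * of_real u ^ k)"
      by (rule summable_fps) (use u radT in \<open>auto intro: less_trans[OF _ radT]\<close>)
    hence "(\<lambda>k. T k * of_real u ^ k) sums eval_fps (Abs_fps T) (of_real u)"
      unfolding eval_fps_def by (simp add: summable_sums)
    ultimately have "(\<lambda>k. (y * ?q * of_real u) ^ k - T k * of_real u ^ k) sums
       (1 / (1 - y * ?q * of_real u) - eval_fps (Abs_fps T) (of_real u))"
      by (rule sums_diff)
    thus ?thesis unfolding eval_fps_def
      by (simp add: S sums_iff algebra_simps power_mult_distrib)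
  qed
  have limT: "((\<lambda>u. of_real (1 - q * u) * eval_fps (Abs_fps T) (of_real u)) \<longlongrightarrow>
      of_real (1 - q * (1 / q)) * eval_fps (Abs_fps T) (of_real (1 / q))) (at_left (1 / q))"
    using q by (intro tendsto_intros tendsto_eval_fps_at_left radT) auto
  have lim1: "((\<lambda>u. of_real (1 - q * u) * (1 / (1 - y * ?q * of_real u))) \<longlongrightarrow>
      (if y = 1 then 1 else 0)) (at_left (1 / q))"
  proof (cases "y = 1")
    case True
    have "\<forall>\<^sub>F u in at_left (1 / q). 1 = of_real (1 - q * u) * (1 / (1 - y * ?q * of_real u))"
      using eventually_at_left_real[of 0 "1 / q"] q
      by (auto elim!: eventually_mono simp: True field_simps simp flip: of_real_mult)
    thus ?thesis using True by (auto intro: Lim_transform_eventually[OF tendsto_const])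
  next
    case False
    have "((\<lambda>u. of_real (1 - q * u) * (1 / (1 - y * ?q * of_real u))) \<longlongrightarrow>
      of_real (1 - q * (1 / q)) * (1 / (1 - y * ?q * of_real (1 / q)))) (at_left (1 / q))"
      using False q by (intro tendsto_intros) auto
    thus ?thesis using False q by simp
  qed
  have "((\<lambda>u. of_real (1 - q * u) * (1 / (1 - y * ?q * of_real u)) -
       of_real (1 - q * u) * eval_fps (Abs_fps T) (of_real u)) \<longlongrightarrow>
     (if y = 1 then 1 else 0) - of_real (1 - q * (1 / q)) * eval_fps (Abs_fps T) (of_real (1 / q))) (at_left (1 / q))"
    by (rule tendsto_diff[OF lim1 limT])
  hence "((\<lambda>u. of_real (1 - q * u) * (1 / (1 - y * ?q * of_real u)) -
       of_real (1 - q * u) * eval_fps (Abs_fps T) (of_real u)) \<longlongrightarrow> (if y = 1 then 1 else 0)) (at_left (1 / q))"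
    using q by simp
  moreover have "\<forall>\<^sub>F u in at_left (1 / q). of_real (1 - q * u) * (1 / (1 - y * ?q * of_real u)) -
       of_real (1 - q * u) * eval_fps (Abs_fps T) (of_real u) =
       of_real (1 - q * u) * S_fun \<psi> u"
    using eventually_at_left_real[of 0 "1 / q"] q
    by (auto elim!: eventually_mono simp: ev right_diff_distrib)
  ultimately show ?thesis by (rule Lim_transform_eventually)
qed

text \<open>
  With \<open>b = q^(1/4)\<close>: the factor \<open>k\<close> is absorbed by Bernoulli's inequality into \<open>b^k\<close>, and
  \<open>a = q^(3/4)\<close> is still below \<open>q\<close>.
\<close>
lemma summable_root_bound:
  fixes q :: real
  assumes "q > 1"
  obtains a C where "0 < a" "a < q" "C \<ge> 0"
    "\<And>k m. m \<le> k * q ^ (k div 2) \<Longrightarrow> (m :: real) \<le> C * a ^ k" "\<And>k. 1 \<le> a ^ k"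
proof -
  define s b where "s = sqrt q" and "b = sqrt s"
  have s: "s > 1" "s * s = q" using assms by (auto simp: s_def)
  have b: "b > 1" "b * b = s" using s by (auto simp: b_def)
  have "b * 1 < b * b" using b(1) by (intro mult_strict_left_mono) auto
  hence "b < s" using b by simp
  define C where "C = 1 / (b - 1)"
  show ?thesis
  proof (rule that[of "s * b" C])
    show "0 < s * b" using s b by simp
    have "s * b < s * s" using s \<open>b < s\<close> by (intro mult_strict_left_mono) auto
    thus "s * b < q" using s by simp
    show "C \<ge> 0" using b by (simp add: C_def)
    show "1 \<le> (s * b) ^ k" for k
      using s b by (intro one_le_power) (simp add: less_1_mult less_imp_le)
    fix k and m :: real assume m: "m \<le> k * q ^ (k div 2)"
    have "q ^ (k div 2) = s ^ (2 * (k div 2))" by (simp add: s power_mult power2_eq_square)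
    also have "\<dots> \<le> s ^ k" using s by (intro power_increasing) auto
    finally have 1: "q ^ (k div 2) \<le> s ^ k" .
    have "1 + real k * (b - 1) \<le> b ^ k"
      using Bernoulli_inequality[of "b - 1" k] b by simp
    hence "real k * (b - 1) \<le> b ^ k" by simp
    hence 2: "real k \<le> C * b ^ k" using b by (simp add: C_def field_simps)
    have "m \<le> (C * b ^ k) * s ^ k"
      using m mult_mono[OF 2 1] s b assms by (simp add: C_def)
    thus "m \<le> C * (s * b) ^ k" by (simp add: power_mult_distrib mult_ac)
  qed
qed

text \<open>
  Dirichlet's theorem with a condition on the degree. If there were finitely many such primes,
  the series \<open>W\<close> over the prime powers in the class would converge beyond \<open>1 / q\<close>, as only
  proper powers and powers of finitely many primes occur in it. But \<open>W\<close> is a combination of the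
  series \<open>S\<close> of all characters, and exactly one of these, the trivial one, has a pole at
  \<open>1 / q\<close>.
\<close>
theorem infinite_irreducibles_in_class:
  fixes p c :: "'a::finite_field poly" and n e :: nat
  assumes p: "monic_irreducible p" and c: "\<not> p dvd c" and n: "n \<ge> 1"
  shows "infinite {P. monic_irreducible P \<and> p dvd P - c \<and> [Polynomial.degree P = e] (mod n)}" (is "infinite ?Q")
proof
  assume fin: "finite ?Q"
  define q where "q = real CARD('a)"
  define N where "N = CARD('a) ^ Polynomial.degree p - 1"
  have q: "q > 1" using card_field_gt_1[where 'a = 'a] by (simp add: q_def)
  have irr: "Factorial_Ring.irreducible p" using p by (simp add: monic_irreducible_def)
  obtain \<theta> :: "'a poly \<Rightarrow> complex" where N: "N \<ge> 1" and mult: "\<And>f g. \<theta> (f * g) = \<theta> f * \<theta> g" and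
    zero: "\<And>f. p dvd f \<Longrightarrow> \<theta> f = 0" and root: "\<And>f. \<not> p dvd f \<Longrightarrow> \<theta> f ^ N = 1" and
    norm: "\<And>f. \<not> p dvd f \<Longrightarrow> norm (\<theta> f) = 1" and
    eq: "\<And>f g. \<not> p dvd f \<Longrightarrow> \<not> p dvd g \<Longrightarrow> \<theta> f = \<theta> g \<longleftrightarrow> p dvd f - g" and
    nontriv: "\<And>j. 0 < j \<Longrightarrow> j < N \<Longrightarrow> \<exists>b. \<not> p dvd b \<and> \<theta> b ^ j \<noteq> 1"
    using exists_faithful_character[OF irr] unfolding N_def by blast
  have not_unit: "\<not> p dvd 1" using irreducible_not_unit[OF irr] .
  have \<theta>1: "\<theta> 1 = 1"
  proof -
    have "\<theta> 1 * \<theta> 1 = \<theta> 1 * 1" using mult[of 1 1] by simp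
    moreover have "\<theta> 1 \<noteq> 0" using norm[OF not_unit] by auto
    ultimately show ?thesis by (metis mult_cancel_left)
  qed
  have \<theta>pow: "\<theta> (f ^ i) = \<theta> f ^ i" for f i by (induction i) (simp_all add: \<theta>1 mult)
  have dvd_pow: "p dvd f ^ i \<longleftrightarrow> p dvd f" if "i \<ge> 1" for f i
    using that irr by (induction i rule: dec_induct) (auto simp: irreducible_dvd_mult_iff)
  define z where "z = cis (2 * pi / real n)"
  have z: "z ^ a = z ^ b \<longleftrightarrow> [a = b] (mod n)" for a b
    unfolding z_def by (rule cis_root_of_unity_eq_iff[OF n])
  have z_norm: "norm (z ^ a) = 1" for a by (simp add: z_def norm_power)
  have z_root: "(z ^ a) ^ n = 1" for a using z[of "a * n" 0] by (simp add: power_mult cong_def)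
  define \<psi> where "\<psi> = (\<lambda>j l f. if p dvd f then 0 else \<theta> f ^ j * (z ^ l) ^ Polynomial.degree f)"
  have \<psi>: "multiplicative_char (\<psi> j l)" for j l
    unfolding multiplicative_char_def
  proof (intro conjI allI)
    show "\<psi> j l 1 = 1" using not_unit by (simp add: \<psi>_def \<theta>1)
    show "\<psi> j l (f * g) = \<psi> j l f * \<psi> j l g" for f g
    proof (cases "p dvd f \<or> p dvd g")
      case True
      thus ?thesis by (auto simp: \<psi>_def)
    next
      case False
      hence "f \<noteq> 0" "g \<noteq> 0" by auto
      thus ?thesis using False irr
        by (simp add: \<psi>_def irreducible_dvd_mult_iff degree_mult_eq mult power_mult_distrib power_add)
    qed
    show "norm (\<psi> j l f) \<le> 1" for f
      using norm[of f] z_norm[of l] by (simp add: \<psi>_def norm_mult norm_power)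
  qed
  \<comment> \<open>The conjugate of \<open>\<psi> j l\<close> at the wanted class and degree; \<open>\<delta>\<close> is the residue of \<open>S (\<psi> j l)\<close>.\<close>
  define w where "w = (\<lambda>j l. cnj (\<theta> c) ^ j * cnj (z ^ e) ^ l)"
  define \<delta> where "\<delta> = (\<lambda>(j :: nat) (l :: nat). if j = 0 \<and> l = 0 then 1 else 0 :: complex)"
  have lim: "((\<lambda>u. of_real (1 - q * u) * S_fun (\<psi> j l) u) \<longlongrightarrow> \<delta> j l) (at_left (1 / q))"
    if jl: "j < N" "l < n" for j l
  proof (cases "j = 0")
    case True
    have "z ^ l = 1 \<longleftrightarrow> l = 0" using z[of l 0] jl by (simp add: cong_def)
    moreover have "\<psi> j l = (\<lambda>f. if p dvd f then 0 else (z ^ l) ^ Polynomial.degree f)"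
      using True by (auto simp: \<psi>_def fun_eq_iff)
    ultimately show ?thesis
      using residue_of_unramified_char[OF p z_norm[of l]] True by (simp add: \<delta>_def q_def)
  next
    case False
    obtain b where b: "\<not> p dvd b" "\<theta> b ^ j \<noteq> 1" using nontriv jl False by blast
    have per: "\<theta> f ^ j = \<theta> g ^ j" if "p dvd f - g" for f g
    proof (cases "p dvd f")
      case True
      hence "p dvd g" using that dvd_diff[of p f "f - g"] by simp
      thus ?thesis using True by (simp add: zero)
    next
      case False
      hence "\<not> p dvd g" using that dvd_add[of p "f - g" g] by auto
      thus ?thesis using eq[OF False, of g] that by simp
    qed
    have "L_coeff (\<psi> j l) k = 0" if k: "k \<ge> Polynomial.degree p" for k
    proof -
      have "L_coeff (\<psi> j l) k = (\<Sum>f\<in>monics k. (z ^ l) ^ k * \<theta> f ^ j)"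
        unfolding L_coeff_def
        by (rule sum.cong) (use False in \<open>auto simp: \<psi>_def zero monics_def\<close>)
      also have "\<dots> = (z ^ l) ^ k * (\<Sum>f\<in>monics k. \<theta> f ^ j)" by (simp add: sum_distrib_left)
      also have "(\<Sum>f\<in>monics k. \<theta> f ^ j) = 0"
        by (rule sum_character_monics_eq_0[where \<theta> = "\<lambda>f. \<theta> f ^ j", OF p _ per b k]) (simp_all add: mult power_mult_distrib)
      finally show ?thesis by simp
    qed
    moreover have "\<psi> j l p = 0" by (simp add: \<psi>_def)
    ultimately show ?thesis
      using residue_zero_if_L_polynomial[OF \<psi> p, of j l "Polynomial.degree p"] False
      by (simp add: \<delta>_def q_def)
  qed
  \<comment> \<open>The weighted number of prime powers \<open>P^i\<close> of degree \<open>k\<close> in the wanted class.\<close>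
  define W where "W = (\<lambda>k. \<Sum>x\<in>prime_powers k. if \<not> p dvd fst x \<and> p dvd fst x ^ snd x - c \<and>
     [snd x * Polynomial.degree (fst x) = e] (mod n) then of_nat (Polynomial.degree (fst x)) else 0 :: complex)"
  have orth: "(\<Sum>j<N. \<Sum>l<n. w j l * S_coeff (\<psi> j l) k) = of_nat (N * n) * W k" for k
  proof -
    have "(\<Sum>j<N. \<Sum>l<n. w j l * S_coeff (\<psi> j l) k) =
      (\<Sum>j<N. \<Sum>l<n. \<Sum>x\<in>prime_powers k. w j l * (of_nat (Polynomial.degree (fst x)) * \<psi> j l (fst x) ^ snd x))"
      by (simp add: S_coeff_def sum_distrib_left case_prod_unfold)
    also have "\<dots> = (\<Sum>j<N. \<Sum>x\<in>prime_powers k. \<Sum>l<n. w j l * (of_nat (Polynomial.degree (fst x)) * \<psi> j l (fst x) ^ snd x))"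
      by (intro sum.cong refl sum.swap)
    also have "\<dots> = (\<Sum>x\<in>prime_powers k. \<Sum>j<N. \<Sum>l<n. w j l * (of_nat (Polynomial.degree (fst x)) * \<psi> j l (fst x) ^ snd x))"
      by (rule sum.swap)
    also have "\<dots> = (\<Sum>x\<in>prime_powers k. of_nat (N * n) * (if \<not> p dvd fst x \<and> p dvd fst x ^ snd x - c \<and>
     [snd x * Polynomial.degree (fst x) = e] (mod n) then of_nat (Polynomial.degree (fst x)) else 0))"
    proof (rule sum.cong)
      fix x :: "'a poly \<times> nat" assume "x \<in> prime_powers k"
      then obtain P i where x: "x = (P, i)" "i \<ge> 1" by (auto simp: prime_powers_def)
      show "(\<Sum>j<N. \<Sum>l<n. w j l * (of_nat (Polynomial.degree (fst x)) * \<psi> j l (fst x) ^ snd x)) =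
        of_nat (N * n) * (if \<not> p dvd fst x \<and> p dvd fst x ^ snd x - c \<and>
        [snd x * Polynomial.degree (fst x) = e] (mod n) then of_nat (Polynomial.degree (fst x)) else 0)"
      proof (cases "p dvd P")
        case True
        thus ?thesis using x by (auto simp: \<psi>_def power_0_left)
      next
        case False
        let ?d = "Polynomial.degree P" and ?a = "\<theta> (P ^ i) * cnj (\<theta> c)" and
          ?b = "z ^ (i * Polynomial.degree P) * cnj (z ^ e)"
        have nd: "\<not> p dvd P ^ i" using False dvd_pow x by simp
        have "w j l * \<psi> j l P ^ i = ?a ^ j * ?b ^ l" for j l
          using False by (simp add: w_def \<psi>_def \<theta>pow power_mult_distrib mult_ac flip: power_mult)
        hence "(\<Sum>j<N. \<Sum>l<n. w j l * (of_nat ?d * \<psi> j l P ^ i)) = (\<Sum>j<N. \<Sum>l<n. of_nat ?d * (?a ^ j * ?b ^ l))"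
          by (simp add: mult.left_commute)
        also have "\<dots> = of_nat ?d * ((\<Sum>j<N. ?a ^ j) * (\<Sum>l<n. ?b ^ l))"
          by (simp only: sum_product) (simp only: sum_distrib_left)
        also have "(\<Sum>j<N. ?a ^ j) = (if \<theta> (P ^ i) = \<theta> c then of_nat N else 0)"
          using nd c norm root by (intro sum_powers_root_of_unity) auto
        also have "(\<Sum>l<n. ?b ^ l) = (if z ^ (i * ?d) = z ^ e then of_nat n else 0)"
          by (intro sum_powers_root_of_unity z_norm z_root)
        finally show ?thesis using False eq[OF nd c] by (simp add: x z)
      qed
    qed simp
    finally show ?thesis by (simp add: W_def sum_distrib_left)
  qed
  \<comment> \<open>A bound, the same for every \<open>k\<close>, for what the wanted primes themselves contribute to \<open>W k\<close>; the other terms come from proper powers.\<close>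
  define K where "K = (\<Sum>P\<in>?Q. Polynomial.degree P)"
  have W_bound: "norm (W k) \<le> real (K + k * CARD('a) ^ (k div 2))" for k
  proof -
    let ?P = "prime_powers k :: ('a poly \<times> nat) set"
    let ?c = "\<lambda>x :: 'a poly \<times> nat. \<not> p dvd fst x \<and> p dvd fst x ^ snd x - c \<and> [snd x * Polynomial.degree (fst x) = e] (mod n)"
    have "norm (W k) \<le> (\<Sum>x\<in>?P. if ?c x then real (Polynomial.degree (fst x)) else 0)"
      unfolding W_def by (rule sum_norm_le) auto
    also have "\<dots> = real (\<Sum>x\<in>?P. if ?c x then Polynomial.degree (fst x) else 0)"
      by (simp add: if_distrib cong: if_cong)
    also have "(\<Sum>x\<in>?P. if ?c x then Polynomial.degree (fst x) else 0) =
        (\<Sum>x\<in>{x \<in> ?P. ?c x}. Polynomial.degree (fst x))"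
      by (rule sum.inter_filter[symmetric]) (rule finite_prime_powers)
    also have "\<dots> \<le> (\<Sum>x\<in>(\<lambda>P. (P, 1 :: nat)) ` ?Q \<union> {x \<in> ?P. snd x \<ge> 2}. Polynomial.degree (fst x))"
    proof (rule sum_mono2)
      show "finite ((\<lambda>P. (P, 1 :: nat)) ` ?Q \<union> {x \<in> ?P. snd x \<ge> 2})"
        using fin finite_subset[OF _ finite_prime_powers[of k, where 'a='a]] by auto
      show "{x \<in> ?P. ?c x} \<subseteq> (\<lambda>P. (P, 1 :: nat)) ` ?Q \<union> {x \<in> ?P. snd x \<ge> 2}"
      proof
        fix x assume x: "x \<in> {x \<in> ?P. ?c x}"
        then obtain P i where Pi: "x = (P, i)" "i \<ge> 1" "monic_irreducible P" by (auto simp: prime_powers_def)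
        show "x \<in> (\<lambda>P. (P, 1 :: nat)) ` ?Q \<union> {x \<in> ?P. snd x \<ge> 2}"
        proof (cases "i = 1")
          case True
          hence "P \<in> ?Q" using x Pi by auto
          thus ?thesis using Pi True by blast
        next
          case False
          thus ?thesis using x Pi by auto
        qed
      qed
    qed simp
    also have "\<dots> \<le> (\<Sum>x\<in>(\<lambda>P. (P, 1 :: nat)) ` ?Q. Polynomial.degree (fst x)) +
        (\<Sum>x\<in>{x \<in> ?P. snd x \<ge> 2}. Polynomial.degree (fst x))"
      using fin finite_subset[OF _ finite_prime_powers[of k, where 'a='a]] by (subst sum_Un_nat) auto
    also have "(\<Sum>x\<in>(\<lambda>P. (P, 1 :: nat)) ` ?Q. Polynomial.degree (fst x)) = K"
      unfolding K_def by (subst sum.reindex) (auto simp: inj_on_def)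
    finally show ?thesis
      using sum_degree_higher_prime_powers_le[of k, where 'a='a] by linarith
  qed
  obtain a C where aC: "0 < a" "a < q" "C \<ge> 0"
    "\<And>k m. m \<le> k * q ^ (k div 2) \<Longrightarrow> (m :: real) \<le> C * a ^ k" "\<And>k. 1 \<le> a ^ k"
    by (rule summable_root_bound[OF q]) blast
  have "norm (Abs_fps W $ k) \<le> (real K + C) * a ^ k" for k
  proof -
    have "norm (W k) \<le> real K + real k * q ^ (k div 2)" using W_bound[of k] by (simp add: q_def)
    also have "real K \<le> real K * a ^ k" using aC(5)[of k] by (simp add: mult_left_le_one_le mult_le_cancel_left1)
    also have "real k * q ^ (k div 2) \<le> C * a ^ k" by (rule aC(4)) simp
    finally show ?thesis by (simp add: distrib_right)
  qed
  hence "fps_conv_radius (Abs_fps W) \<ge> ereal (1 / a)" by (rule fps_conv_radius_geI) (rule aC)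
  moreover have "ereal (1 / q) < ereal (1 / a)" using aC q by (simp add: field_simps)
  ultimately have radW: "ereal (1 / q) < fps_conv_radius (Abs_fps W)" by (rule less_le_trans[rotated])
  have ev: "(\<Sum>j<N. \<Sum>l<n. w j l * S_fun (\<psi> j l) u) =
      of_nat (N * n) * eval_fps (Abs_fps W) (of_real u)" if u: "0 < u" "u < 1 / q" for u
  proof -
    have rad: "fps_conv_radius (Abs_fps (S_coeff (\<psi> j l))) \<ge> ereal (1 / q)" for j l
      using norm_S_coeff_le[OF \<psi>] q by (intro fps_conv_radius_geI[of _ 1]) (auto simp: q_def)
    have "(\<lambda>k. S_coeff (\<psi> j l) k * of_real u ^ k) sums S_fun (\<psi> j l) u" for j l
    proof -
      have "summable (\<lambda>k. Abs_fps (S_coeff (\<psi> j l)) $ k * of_real u ^ k)"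
        by (rule summable_fps) (use u in \<open>auto intro!: less_le_trans[OF _ rad]\<close>)
      thus ?thesis unfolding eval_fps_def by (simp add: summable_sums)
    qed
    hence "(\<lambda>k. \<Sum>j<N. \<Sum>l<n. w j l * (S_coeff (\<psi> j l) k * of_real u ^ k)) sums
       (\<Sum>j<N. \<Sum>l<n. w j l * S_fun (\<psi> j l) u)"
      by (intro sums_sum sums_mult)
    moreover have "(\<Sum>j<N. \<Sum>l<n. w j l * (S_coeff (\<psi> j l) k * of_real u ^ k)) =
        of_nat (N * n) * (W k * of_real u ^ k)" for k
    proof -
      have "(\<Sum>j<N. \<Sum>l<n. w j l * (S_coeff (\<psi> j l) k * of_real u ^ k)) =
          (\<Sum>j<N. \<Sum>l<n. w j l * S_coeff (\<psi> j l) k) * of_real u ^ k"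
        by (simp add: sum_distrib_right mult.assoc)
      thus ?thesis by (simp only: orth mult.assoc)
    qed
    ultimately have 1: "(\<lambda>k. of_nat (N * n) * (W k * of_real u ^ k)) sums
       (\<Sum>j<N. \<Sum>l<n. w j l * S_fun (\<psi> j l) u)"
      by simp
    have "summable (\<lambda>k. Abs_fps W $ k * of_real u ^ k)"
      by (rule summable_fps) (use u radW in \<open>auto intro: less_trans[OF _ radW]\<close>)
    hence "(\<lambda>k. W k * of_real u ^ k) sums eval_fps (Abs_fps W) (of_real u)"
      unfolding eval_fps_def by (simp add: summable_sums)
    hence "(\<lambda>k. of_nat (N * n) * (W k * of_real u ^ k)) sums (of_nat (N * n) * eval_fps (Abs_fps W) (of_real u))"
      by (rule sums_mult)
    with 1 show ?thesis by (rule sums_unique2)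
  qed
  have "((\<lambda>u. \<Sum>j<N. \<Sum>l<n. w j l * (of_real (1 - q * u) * S_fun (\<psi> j l) u))
     \<longlongrightarrow> (\<Sum>j<N. \<Sum>l<n. w j l * \<delta> j l)) (at_left (1 / q))"
    by (intro tendsto_sum tendsto_mult tendsto_const lim) auto
  \<comment> \<open>Only the trivial character contributes to the limit, whereas the convergence of \<open>W\<close> beyond \<open>1 / q\<close> would make the limit \<open>0\<close>.\<close>
  moreover have "(\<Sum>j<N. \<Sum>l<n. w j l * \<delta> j l) = 1"
  proof -
    have w\<delta>: "w j l * \<delta> j l = (if l = 0 then if j = 0 then 1 else 0 else 0)" for j l
      by (auto simp: \<delta>_def w_def)
    have "(\<Sum>j<N. \<Sum>l<n. w j l * \<delta> j l) = (\<Sum>j<N. if j = 0 then 1 else 0)"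
      unfolding w\<delta> using n by (intro sum.cong refl) (simp add: sum.delta)
    also have "\<dots> = 1" using N by (simp add: sum.delta)
    finally show ?thesis .
  qed
  moreover have "\<forall>\<^sub>F u in at_left (1 / q).
     (\<Sum>j<N. \<Sum>l<n. w j l * (of_real (1 - q * u) * S_fun (\<psi> j l) u)) =
     of_real (1 - q * u) * (of_nat (N * n) * eval_fps (Abs_fps W) (of_real u))"
  proof -
    have "\<forall>\<^sub>F u in at_left (1 / q). u \<in> {0<..<1 / q}" using q by (intro eventually_at_left_real) auto
    thus ?thesis
    proof eventually_elim
      case (elim u)
      have "(\<Sum>j<N. \<Sum>l<n. w j l * (of_real (1 - q * u) * S_fun (\<psi> j l) u)) =
        of_real (1 - q * u) * (\<Sum>j<N. \<Sum>l<n. w j l * S_fun (\<psi> j l) u)"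
        by (simp only: sum_distrib_left mult.left_commute)
      thus ?case using ev elim by simp
    qed
  qed
  ultimately have lim1: "((\<lambda>u. of_real (1 - q * u) * (of_nat (N * n) * eval_fps (Abs_fps W) (of_real u))) \<longlongrightarrow> 1) (at_left (1 / q))"
    using Lim_transform_eventually by fastforce
  have "((\<lambda>u. of_real (1 - q * u) * (of_nat (N * n) * eval_fps (Abs_fps W) (of_real u))) \<longlongrightarrow>
     of_real (1 - q * (1 / q)) * (of_nat (N * n) * eval_fps (Abs_fps W) (of_real (1 / q)))) (at_left (1 / q))"
    using q by (intro tendsto_intros tendsto_eval_fps_at_left radW) auto
  hence "((\<lambda>u. of_real (1 - q * u) * (of_nat (N * n) * eval_fps (Abs_fps W) (of_real u))) \<longlongrightarrow> 0) (at_left (1 / q))"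
    using q by simp
  from tendsto_unique[OF _ lim1 this] show False by simp
qed

text \<open>
  Let \<open>e1\<close> be the remainder of \<open>e0\<close> modulo \<open>m\<close>. Adding to \<open>e1\<close> the product of \<open>m\<close> and of all
  primes that divide \<open>m s\<close> but not \<open>e1\<close> makes every prime divisor of \<open>m s\<close> divide exactly one of
  the two summands.
\<close>
lemma exists_coprime_in_class:
  fixes m s :: nat and e0 :: int
  assumes "m \<ge> 1" "s \<ge> 1" "gcd e0 (int m) = 1"
  obtains e :: nat where "[int e = e0] (mod int m)" "coprime e (m * s)"
proof -
  define e1 where "e1 = nat (e0 mod int m)"
  have e1: "int e1 = e0 mod int m" using assms by (simp add: e1_def)
  have "gcd (int e1) (int m) = gcd e0 (int m)"
    unfolding e1 by (metis gcd.commute gcd_red_int)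
  hence cop: "coprime e1 m" using assms(3) by (simp add: coprime_iff_gcd_eq_1)
  define T where "T = {l. Factorial_Ring.prime l \<and> l dvd m * s \<and> \<not> l dvd e1}"
  have "finite T"
    unfolding T_def using assms by (intro finite_subset[OF _ finite_divisors_nat[of "m * s"]]) auto
  define e where "e = e1 + m * \<Prod>T"
  have "coprime e (m * s)"
  proof (rule ccontr)
    assume "\<not> coprime e (m * s)"
    then obtain l where l: "Factorial_Ring.prime l" "l dvd e" "l dvd m * s"
      using prime_factor_nat[of "gcd e (m * s)"]
      by (metis coprime_iff_gcd_eq_1 dvd_trans gcd_dvd1 gcd_dvd2)
    show False
    proof (cases "l dvd e1")
      case False
      hence "l dvd \<Prod>T" using l \<open>finite T\<close> by (intro dvd_prodI) (auto simp: T_def)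
      hence "l dvd e1" using l(2) by (simp add: e_def dvd_add_left_iff)
      thus False using False by simp
    next
      case True
      hence "l dvd m * \<Prod>T" using l(2) by (simp add: e_def dvd_add_right_iff)
      moreover have "\<not> l dvd m" using True cop l(1) by (meson coprime_common_divisor not_prime_unit)
      ultimately have "l dvd \<Prod>T" using l(1) prime_dvd_mult_iff by blast
      then obtain l' where "l' \<in> T" "l dvd l'" using l(1) \<open>finite T\<close> by (auto simp: prime_dvd_prod_iff)
      hence "l = l'" using l(1) by (auto simp: T_def primes_dvd_imp_eq)
      thus False using \<open>l' \<in> T\<close> True by (simp add: T_def)
    qed
  qed
  moreover have "[int e = e0] (mod int m)"
    unfolding cong_def e_def by (simp add: e1)
  ultimately show ?thesis using that by blast
qed

lemma unit_residue_class:
  fixes p :: "'a::finite_field poly"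
  assumes "Factorial_Ring.irreducible p" "c \<in> Units (residue_ring_poly p)"
  obtains a where "c = residue_class p a" "\<not> p dvd a"
proof -
  interpret field "residue_ring_poly p" by (rule residue_ring_poly_field[OF assms(1)])
  have "c \<in> carrier (residue_ring_poly p)" "c \<noteq> \<zero>\<^bsub>residue_ring_poly p\<^esub>"
    using assms(2) by (auto simp: field_Units)
  then obtain a where a: "c = residue_class p a" by (auto simp: carrier_residue_ring_poly)
  have "\<not> p dvd a"
  proof
    assume "p dvd a"
    hence "residue_class p a = residue_class p 0" by (simp add: residue_class_eq_iff)
    thus False using a \<open>c \<noteq> _\<close> by (simp add: residue_class_zero)
  qed
  thus ?thesis using that a by blast
qed

lemma infinite_admissible_primes:
  fixes p :: "'a::finite_field poly"
  assumes "m \<ge> 1" and "s \<ge> 1" and "n = m * s"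
    and "Polynomial.lead_coeff p = 1" and "Factorial_Ring.irreducible p"
    and "c \<in> Units (residue_ring_poly p)" and "gcd e0 (int m) = 1"
  shows "infinite (admissible_primes p c n m e0)"
proof -
  obtain e :: nat where e: "[int e = e0] (mod int m)" "coprime e n"
    using exists_coprime_in_class[OF assms(1,2,7)] assms(3) by blast
  obtain a where a: "c = residue_class p a" "\<not> p dvd a"
    using unit_residue_class[OF assms(5,6)] by blast
  have "infinite {P. monic_irreducible P \<and> p dvd P - a \<and> [Polynomial.degree P = e] (mod n)}"
    using assms a by (intro infinite_irreducibles_in_class) (auto simp: monic_irreducible_def)
  moreover have "{P. monic_irreducible P \<and> p dvd P - a \<and> [Polynomial.degree P = e] (mod n)}
      \<subseteq> admissible_primes p c n m e0"
  proof clarify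
    fix P :: "'a poly"
    assume P: "monic_irreducible P" "p dvd P - a" "[Polynomial.degree P = e] (mod n)"
    have "[int (Polynomial.degree P) = int e] (mod int m)"
      using P(3) assms(3) by (simp add: cong_int_iff cong_modulus_mult_nat)
    moreover have "gcd (Polynomial.degree P) n = 1"
      using cong_gcd_eq[OF P(3)] e(2) by (simp add: coprime_iff_gcd_eq_1)
    ultimately show "P \<in> admissible_primes p c n m e0"
      using P e(1) by (auto simp: admissible_primes_def monic_irreducible_def a residue_class_eq_iff
        intro: cong_trans simp del: cong_int_iff)
  qed
  ultimately show ?thesis using infinite_super by blast
qed

section \<open>Frobenius powers and the action of a polynomial\<close>

text \<open>
  The polynomial \<open>(X + 1)^q - X^q - 1\<close> has degree below \<open>q\<close> but vanishes on all \<open>q\<close> elements of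
  the field, as \<open>x^q = x\<close> there. This yields additivity of the Frobenius without mention of the
  characteristic, which is not visible in the type.
\<close>
lemma of_nat_binomial_card_eq_0:
  assumes "0 < i" "i < CARD('a::finite_field)"
  shows "of_nat (CARD('a) choose i) = (0 :: 'a alg_closure)"
proof -
  let ?q = "CARD('a)"
  define P where "P = [:1, 1 :: 'a:] ^ ?q - Polynomial.monom 1 ?q - 1"
  have co: "poly.coeff P j = (if 0 < j \<and> j < ?q then of_nat (?q choose j) else 0)" if "j \<le> ?q" for j
    using that card_field_gt_1[where 'a='a]
    by (auto simp: P_def coeff_linear_poly_power coeff_1)
  have "Polynomial.degree P < ?q"
  proof (rule le_less_trans[OF degree_le[of "?q - 1"]])
    show "\<forall>i>?q - 1. poly.coeff P i = 0"
    proof (intro allI impI)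
      fix j assume j: "?q - 1 < j"
      show "poly.coeff P j = 0"
      proof (cases "j = ?q")
        case False
        hence "j > ?q" using j by simp
        thus ?thesis using card_field_gt_1[where 'a='a]
          by (simp add: P_def coeff_eq_0 degree_linear_power coeff_1)
      qed (simp add: co)
    qed
  qed (use card_field_gt_1[where 'a='a] in simp)
  moreover have "{x. poly P x = 0} = UNIV"
    using finite_field_power_card_eq_same[where 'a='a] by (auto simp: P_def poly_monom)
  ultimately have "P = 0" using card_poly_roots_bound[of P] by fastforce
  hence "of_nat (?q choose i) = (0 :: 'a)" using co[of i] assms by simp
  thus ?thesis by (metis to_ac_0 to_ac_of_nat)
qed

lemma of_nat_card_eq_0: "of_nat CARD('a::finite_field) = (0 :: 'a alg_closure)"
  using of_nat_binomial_card_eq_0[of 1, where 'a='a] card_field_gt_1[where 'a='a] by simp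

text \<open>
  The map \<open>x \<mapsto> x^[k]\<close>, that is the action of \<open>\<tau>^k\<close>.
\<close>
definition frob :: "nat \<Rightarrow> 'a::finite_field alg_closure \<Rightarrow> 'a alg_closure"
  where "frob k x = x ^ (CARD('a) ^ k)"

lemma frob_0 [simp]: "frob 0 x = x"
  by (simp add: frob_def)

lemma frob_frob: "frob i (frob j x) = frob (i + j) x"
  by (simp add: frob_def power_add mult.commute flip: power_mult)

lemma frob_zero [simp]: "frob k 0 = 0"
  and frob_one [simp]: "frob k 1 = 1"
  and frob_mult: "frob k (x * y) = frob k x * frob k y"
  and frob_to_ac [simp]: "frob k (to_ac c) = to_ac c"
  by (simp_all add: frob_def power_mult_distrib finite_field_power_card_power_eq_same flip: to_ac_power)

lemma frob_add: "frob k (x + y) = frob k x + frob k (y :: 'a::finite_field alg_closure)"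
proof (induction k arbitrary: x y)
  case (Suc k)
  let ?q = "CARD('a)"
  have q: "?q > 1" by (rule card_field_gt_1)
  have "(x + y) ^ ?q = (\<Sum>i\<le>?q. of_nat (?q choose i) * x ^ i * y ^ (?q - i))" by (rule binomial_ring)
  also have "\<dots> = (\<Sum>i\<in>{0, ?q}. of_nat (?q choose i) * x ^ i * y ^ (?q - i))"
    by (rule sum.mono_neutral_right) (use of_nat_binomial_card_eq_0[where 'a='a] in \<open>auto simp: order_le_less\<close>)
  also have "\<dots> = x ^ ?q + y ^ ?q" using q by simp
  finally have 1: "frob (Suc 0) (x + y) = frob (Suc 0) x + frob (Suc 0) y" by (simp add: frob_def)
  have 2: "frob (Suc k) z = frob k (frob (Suc 0) z)" for z :: "'a alg_closure" by (simp add: frob_frob)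
  show ?case unfolding 2 1 Suc.IH ..
qed simp

lemma frob_minus: "frob k (- x) = - frob k x"
  using frob_add[of k x "- x"] by (simp add: eq_neg_iff_add_eq_0 add.commute)

lemma frob_diff: "frob k (x - y) = frob k x - frob k y"
  using frob_add[of k x "- y"] by (simp add: frob_minus)

lemma frob_sum: "frob k (\<Sum>i\<in>A. f i) = (\<Sum>i\<in>A. frob k (f i))"
  by (induction A rule: infinite_finite_induct) (simp_all add: frob_add)

lemma frob_eq_iff [simp]: "frob k x = frob k y \<longleftrightarrow> x = y"
proof
  assume "frob k x = frob k y"
  hence "frob k (x - y) = 0" by (simp add: frob_diff)
  thus "x = y" by (simp add: frob_def)
qed simp

lemma frob_power: "frob k (x ^ i) = frob k x ^ i"
  by (simp add: frob_def mult.commute flip: power_mult)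

lemma GF_ac_altdef: "GF_ac k = {x. frob k x = x}"
  by (simp add: GF_ac_def frob_def)

lemma frob_mult_index: "frob k x = x \<Longrightarrow> frob (k * i) x = x"
  by (induction i) (simp_all flip: frob_frob)

lemma frob_gcd:
  assumes "frob a x = x" "frob b x = x"
  shows "frob (gcd a b) x = x"
proof (cases "a = 0")
  case False
  then obtain i j where ij: "a * i = b * j + gcd a b" using bezout_nat by blast
  have "frob (gcd a b) x = frob (gcd a b) (frob (b * j) x)" using frob_mult_index[OF assms(2)] by simp
  also have "\<dots> = frob (a * i) x" by (simp add: frob_frob ij add.commute)
  also have "\<dots> = x" using frob_mult_index[OF assms(1)] by simp
  finally show ?thesis .
qed (use assms in simp)

lemma finite_GF_ac:
  assumes "k > 0"
  shows "finite (GF_ac k :: 'a::finite_field alg_closure set)" "card (GF_ac k :: 'a alg_closure set) \<le> CARD('a) ^ k"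
proof -
  define P where "P = Polynomial.monom (1 :: 'a alg_closure) (CARD('a) ^ k) - [:0, 1:]"
  have q: "CARD('a) ^ k > 1" by (rule one_less_power[OF card_field_gt_1 assms])
  have "poly.coeff [:0, 1 :: 'a alg_closure:] (CARD('a) ^ k) = 0" using q by (intro coeff_eq_0) simp
  hence "poly.coeff P (CARD('a) ^ k) = 1" by (simp add: P_def)
  hence P: "P \<noteq> 0" by auto
  have "Polynomial.degree P \<le> CARD('a) ^ k"
    unfolding P_def using q by (intro degree_diff_le) (auto simp: Polynomial.degree_monom_eq)
  moreover have roots: "GF_ac k = {x. poly P x = 0}"
    by (simp add: P_def GF_ac_def poly_monom)
  ultimately show "finite (GF_ac k :: 'a alg_closure set)" "card (GF_ac k :: 'a alg_closure set) \<le> CARD('a) ^ k"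
    using card_poly_roots_bound[OF P] poly_roots_finite[OF P] by auto
qed

lemma poly_map_to_ac_frob:
  "poly (map_poly to_ac f) (frob k x) = frob k (poly (map_poly to_ac f) x)"
  by (induction f) (simp_all add: map_poly_pCons frob_add frob_mult)

lemma map_poly_to_ac_simps:
  "map_poly to_ac (f + g) = map_poly to_ac f + map_poly to_ac g"
  "map_poly to_ac (f - g) = map_poly to_ac f - map_poly to_ac g"
  "map_poly to_ac (f * g) = map_poly to_ac f * map_poly to_ac g"
  "map_poly to_ac 1 = 1" "map_poly to_ac 0 = 0"
  "Polynomial.degree (map_poly to_ac f) = Polynomial.degree f"
  "poly.coeff (map_poly to_ac f) i = to_ac (poly.coeff f i)"
proof -
  show 1: "poly.coeff (map_poly to_ac f) i = to_ac (poly.coeff f i)" for f :: "'a poly" and i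
    by (simp add: coeff_map_poly)
  show "map_poly to_ac (f + g) = map_poly to_ac f + map_poly to_ac g"
    "map_poly to_ac (f - g) = map_poly to_ac f - map_poly to_ac g"
    by (rule poly_eqI; simp add: coeff_map_poly)+
  show "map_poly to_ac (f * g) = map_poly to_ac f * map_poly to_ac g"
    by (rule poly_eqI) (simp add: coeff_map_poly coeff_mult to_ac_sum)
  show "Polynomial.degree (map_poly to_ac f) = Polynomial.degree f"
    by (rule degree_map_poly) simp
qed simp_all

lemma irreducible_not_dvd_imp_nonroot:
  fixes P f :: "'a::finite_field poly"
  assumes "Factorial_Ring.irreducible P" "poly (map_poly to_ac P) t = 0" "\<not> P dvd f"
  shows "poly (map_poly to_ac f) t \<noteq> 0"
proof -
  obtain g where "P dvd f * g - 1" using exists_inverse_mod_irreducible[OF assms(1,3)] by blast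
  then obtain h where h: "f * g - 1 = P * h" by (elim dvdE)
  have "poly (map_poly to_ac (f * g - 1)) t = 0" unfolding h by (simp add: map_poly_to_ac_simps assms(2))
  thus ?thesis by (auto simp: map_poly_to_ac_simps)
qed

text \<open>
  The polynomials of degree below \<open>deg P\<close> take distinct values at a root \<open>t\<close> of \<open>P\<close>, and all
  values lie in \<open>GF(q^g)\<close> if \<open>t\<close> does.
\<close>
lemma degree_le_of_frob_fixed_root:
  fixes P :: "'a::finite_field poly"
  assumes "Factorial_Ring.irreducible P" "poly (map_poly to_ac P) t = 0" "frob g t = t" "g > 0"
  shows "Polynomial.degree P \<le> g"
proof -
  let ?S = "{f :: 'a poly. Polynomial.degree f < Polynomial.degree P}" and ?h = "\<lambda>f. poly (map_poly to_ac f) t"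
  have pos: "Polynomial.degree P > 0" by (rule irreducible_degree_pos[OF assms(1)])
  have "inj_on ?h ?S"
  proof (rule inj_onI, rule ccontr)
    fix a b assume ab: "a \<in> ?S" "b \<in> ?S" "?h a = ?h b" "a \<noteq> b"
    have "poly (map_poly to_ac (a - b)) t = 0" using ab(3) by (simp add: map_poly_to_ac_simps)
    hence "P dvd a - b" using irreducible_not_dvd_imp_nonroot[OF assms(1,2)] by blast
    moreover have "Polynomial.degree (a - b) < Polynomial.degree P"
      using ab by (auto intro: degree_diff_less)
    ultimately show False using ab(4) dvd_imp_degree_le[of P "a - b"] by simp
  qed
  moreover have "?h ` ?S \<subseteq> GF_ac g"
    using assms(3) by (auto simp: GF_ac_altdef simp flip: poly_map_to_ac_frob)
  ultimately have "card ?S \<le> card (GF_ac g :: 'a alg_closure set)"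
    using finite_GF_ac(1)[OF assms(4)] by (rule card_inj_on_le)
  hence "CARD('a) ^ Polynomial.degree P \<le> CARD('a) ^ g"
    using card_poly_degree_less(2)[OF pos, where 'a='a] finite_GF_ac(2)[OF assms(4), where 'a='a] by simp
  thus ?thesis by (rule power_le_imp_le_exp[OF card_field_gt_1])
qed

text \<open>
  The conjugates \<open>t^[ni]\<close>, \<open>i < r\<close>, are roots of \<open>P\<close>. They are distinct: otherwise \<open>t\<close> would be
  fixed by the powers \<open>n (j - i)\<close> and \<open>r\<close> of the Frobenius, hence by the power
  \<open>gcd(n (j - i), r)\<close>, which is smaller than \<open>r\<close> because \<open>n\<close> is coprime to \<open>r\<close>; but \<open>t\<close> lies in
  no field with fewer than \<open>q^r\<close> elements.
\<close>
lemma irreducible_eq_prod_frob_conjugates: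
  fixes P :: "'a::finite_field poly"
  assumes irr: "Factorial_Ring.irreducible P" and lc: "Polynomial.lead_coeff P = 1"
    and root: "poly (map_poly to_ac P) t = 0" and r: "r = Polynomial.degree P"
    and t: "frob r t = t" and cop: "coprime n r"
  shows "map_poly to_ac P = (\<Prod>i<r. [:- frob (n * i) t, 1:])"
proof -
  have pos: "r > 0" using irreducible_degree_pos[OF irr] r by simp
  have neq: "frob (n * i) t \<noteq> frob (n * j) t" if "i < j" "j < r" for i j
  proof
    assume *: "frob (n * i) t = frob (n * j) t"
    have "n * j = n * i + n * (j - i)" using that by (simp flip: distrib_left)
    hence "frob (n * i) t = frob (n * i) (frob (n * (j - i)) t)" using * by (simp add: frob_frob)
    hence "frob (n * (j - i)) t = t" by simp
    hence "frob (gcd (n * (j - i)) r) t = t" using t by (rule frob_gcd)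
    hence "r \<le> gcd (n * (j - i)) r" using degree_le_of_frob_fixed_root[OF irr root] pos r by simp
    hence "gcd (n * (j - i)) r = r" using pos by (simp add: le_antisym)
    hence "r dvd n * (j - i)" by (metis gcd_dvd1)
    hence "r dvd j - i" using cop by (simp add: coprime_commute coprime_dvd_mult_right_iff)
    thus False using that by (auto dest: dvd_imp_le)
  qed
  have inj: "inj_on (\<lambda>i. frob (n * i) t) {..<r}"
    using neq by (intro linorder_inj_onI') auto
  define Q where "Q = (\<Prod>i<r. [:- frob (n * i) t, 1:])"
  have Q: "Polynomial.degree Q = r" "Polynomial.lead_coeff Q = 1"
  proof -
    show "Polynomial.degree Q = r" unfolding Q_def by (subst degree_prod_eq_sum_degree) auto
    show "Polynomial.lead_coeff Q = 1" unfolding Q_def lead_coeff_prod by simp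
  qed
  have P: "Polynomial.degree (map_poly to_ac P) = r" "poly.coeff (map_poly to_ac P) r = 1"
    using lc by (simp_all add: map_poly_to_ac_simps r)
  have "map_poly to_ac P - Q = 0"
  proof (rule ccontr)
    assume nz: "map_poly to_ac P - Q \<noteq> 0"
    have "Polynomial.degree (map_poly to_ac P - Q) \<le> r" using P Q by (intro degree_diff_le) auto
    moreover have "poly.coeff (map_poly to_ac P - Q) r = 0" using P Q by simp
    ultimately have "Polynomial.degree (map_poly to_ac P - Q) < r"
      using nz by (metis leading_coeff_0_iff order_le_less)
    moreover have "(\<lambda>i. frob (n * i) t) ` {..<r} \<subseteq> {x. poly (map_poly to_ac P - Q) x = 0}"
      by (auto simp: poly_map_to_ac_frob root Q_def poly_prod)
    hence "card ((\<lambda>i. frob (n * i) t) ` {..<r}) \<le> card {x. poly (map_poly to_ac P - Q) x = 0}"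
      by (intro card_mono poly_roots_finite nz)
    hence "r \<le> Polynomial.degree (map_poly to_ac P - Q)"
      using card_poly_roots_bound[OF nz] inj by (simp add: card_image)
    ultimately show False by simp
  qed
  thus ?thesis by (simp add: Q_def)
qed

text \<open>
  The action of \<open>\<phi>\<^sub>T = t + \<tau>^n\<close>.
\<close>
definition Phi :: "nat \<Rightarrow> 'a::finite_field alg_closure \<Rightarrow> 'a alg_closure \<Rightarrow> 'a alg_closure"
  where "Phi n t v = t * v + frob n v"

text \<open>
  The action \<open>\<Sum> P\<^sub>i \<phi>\<^sub>T^i\<close> of a polynomial whose coefficients lie in the algebraic closure and
  stand to the left of the powers of \<open>\<phi>\<^sub>T\<close>. It is multiplicative only under conditions on the
  coefficients, but it permits evaluation along a factorization over the algebraic closure.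
\<close>
definition star :: "nat \<Rightarrow> 'a::finite_field alg_closure \<Rightarrow> 'a alg_closure poly \<Rightarrow> 'a alg_closure \<Rightarrow> 'a alg_closure"
  where "star n t P v = (\<Sum>i\<le>Polynomial.degree P. poly.coeff P i * (Phi n t ^^ i) v)"

definition phi :: "nat \<Rightarrow> 'a::finite_field alg_closure \<Rightarrow> 'a poly \<Rightarrow> 'a alg_closure \<Rightarrow> 'a alg_closure"
  where "phi n t a = star n t (map_poly to_ac a)"

lemma star_eq_sum:
  "Polynomial.degree P \<le> N \<Longrightarrow> star n t P v = (\<Sum>i\<le>N. poly.coeff P i * (Phi n t ^^ i) v)"
  unfolding star_def by (rule sum.mono_neutral_left) (auto simp: coeff_eq_0)

lemma star_add: "star n t (P + Q) v = star n t P v + star n t Q v"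
proof -
  define N where "N = max (Polynomial.degree P) (Polynomial.degree Q)"
  have "Polynomial.degree (P + Q) \<le> N" by (simp add: N_def degree_add_le_max)
  moreover have "Polynomial.degree P \<le> N" "Polynomial.degree Q \<le> N" by (auto simp: N_def)
  ultimately show ?thesis by (simp add: star_eq_sum[of _ N] sum.distrib algebra_simps)
qed

lemma star_smult: "star n t (Polynomial.smult c P) v = c * star n t P v"
  by (simp add: star_eq_sum[OF degree_smult_le] star_def sum_distrib_left mult.assoc)

lemma star_pCons: "star n t (pCons c P) v = c * v + star n t P (Phi n t v)"
proof -
  have "star n t (pCons c P) v = (\<Sum>i\<le>Suc (Polynomial.degree P). poly.coeff (pCons c P) i * (Phi n t ^^ i) v)"
    by (rule star_eq_sum) (rule degree_pCons_le)
  also have "\<dots> = c * v + star n t P (Phi n t v)"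
    unfolding sum.atMost_Suc_shift by (simp add: star_def funpow_swap1)
  finally show ?thesis .
qed

lemma star_0 [simp]: "star n t 0 v = 0"
  by (simp add: star_def)

lemma star_one [simp]: "star n t 1 v = v"
  by (simp add: star_def)

lemma star_mult_linear: "star n t (P * [:- a, 1:]) v = star n t P (Phi n t v) - a * star n t P v"
proof -
  have "P * [:- a, 1:] = pCons 0 P + Polynomial.smult (- a) P" by simp
  thus ?thesis by (simp only: star_add star_smult star_pCons) simp
qed

text \<open>
  The telescoping: in \<open>\<tau>^(nk) (t + \<tau>^n) - t^[nk] \<tau>^(nk)\<close> the constant \<open>t\<close> is twisted to \<open>t^[nk]\<close>
  on being moved across \<open>\<tau>^(nk)\<close> and cancels.
\<close>
lemma star_prod_frob_conjugates:
  "star n t (\<Prod>i<k. [:- frob (n * i) t, 1:]) v = frob (n * k) v"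
proof (induction k arbitrary: v)
  case (Suc k)
  have "star n t (\<Prod>i<Suc k. [:- frob (n * i) t, 1:]) v =
      star n t ((\<Prod>i<k. [:- frob (n * i) t, 1:]) * [:- frob (n * k) t, 1:]) v" by (simp only: prod.lessThan_Suc)
  also have "\<dots> = frob (n * k) (Phi n t v) - frob (n * k) t * frob (n * k) v"
    by (simp only: star_mult_linear Suc.IH)
  also have "\<dots> = frob (n * Suc k) v"
    by (simp add: Phi_def frob_add frob_mult frob_frob add.commute)
  finally show ?case .
qed simp

lemma phi_characteristic:
  fixes P :: "'a::finite_field poly"
  assumes "Factorial_Ring.irreducible P" and "Polynomial.lead_coeff P = 1"
    and "poly (map_poly to_ac P) t = 0" and "r = Polynomial.degree P"
    and "frob r t = t" and "coprime n r"
  shows "phi n t P v = frob (n * r) v"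
  unfolding phi_def irreducible_eq_prod_frob_conjugates[OF assms] by (rule star_prod_frob_conjugates)

lemma Phi_add: "Phi n t (v + w) = Phi n t v + Phi n t w"
  by (simp add: Phi_def frob_add algebra_simps)

lemma Phi_zero [simp]: "Phi n t 0 = 0"
  by (simp add: Phi_def)

lemma Phi_scale: "frob n l = l \<Longrightarrow> Phi n t (l * v) = l * Phi n t v"
  by (simp add: Phi_def frob_mult algebra_simps)

lemma Phi_frob: "frob r t = t \<Longrightarrow> Phi n t (frob r v) = frob r (Phi n t v)"
  by (simp add: Phi_def frob_mult frob_add frob_frob add.commute)

lemma phi_pCons: "phi n t (pCons c a) v = to_ac c * v + phi n t a (Phi n t v)"
  by (simp add: phi_def map_poly_pCons star_pCons)

lemma phi_0 [simp]: "phi n t 0 v = 0"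
  by (simp add: phi_def map_poly_to_ac_simps)

lemma phi_1 [simp]: "phi n t 1 v = v"
  by (simp add: phi_def map_poly_to_ac_simps)

lemma phi_add_left: "phi n t (a + b) v = phi n t a v + phi n t b v"
  by (simp add: phi_def map_poly_to_ac_simps star_add)

lemma phi_smult: "phi n t (Polynomial.smult c a) v = to_ac c * phi n t a v"
  by (induction a arbitrary: v) (simp_all add: phi_pCons algebra_simps)

lemma phi_minus_left: "phi n t (- a) v = - phi n t a v"
  using phi_add_left[of n t a "- a" v] by (simp add: eq_neg_iff_add_eq_0 add.commute)

lemma phi_diff_left: "phi n t (a - b) v = phi n t a v - phi n t b v"
  using phi_add_left[of n t a "- b" v] by (simp add: phi_minus_left)

lemma phi_add: "phi n t a (v + w) = phi n t a v + phi n t a w"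
  by (induction a arbitrary: v w) (simp_all add: phi_pCons Phi_add algebra_simps)

lemma phi_zero [simp]: "phi n t a 0 = 0"
  using phi_add[of n t a 0 0] by (metis add.right_neutral add_left_cancel)

lemma phi_minus: "phi n t a (- v) = - phi n t a v"
  using phi_add[of n t a v "- v"] by (simp add: eq_neg_iff_add_eq_0 add.commute)

lemma phi_sum: "phi n t a (\<Sum>i\<in>A. f i) = (\<Sum>i\<in>A. phi n t a (f i))"
  by (induction A rule: infinite_finite_induct) (simp_all add: phi_add)

lemma phi_frob: "frob r t = t \<Longrightarrow> phi n t a (frob r v) = frob r (phi n t a v)"
  by (induction a arbitrary: v) (simp_all add: phi_pCons Phi_frob frob_add frob_mult)

lemma phi_Phi: "phi n t a (Phi n t v) = Phi n t (phi n t a v)"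
  by (induction a arbitrary: v) (simp_all add: phi_pCons Phi_add Phi_scale)

lemma phi_mult: "phi n t (a * b) v = phi n t a (phi n t b v)"
proof (induction a arbitrary: v)
  case (pCons c a)
  have "phi n t (pCons c a * b) v = to_ac c * phi n t b v + phi n t (a * b) (Phi n t v)"
    by (simp add: phi_add_left phi_smult phi_pCons)
  thus ?case by (simp add: pCons.IH phi_pCons phi_Phi)
qed simp

lemma phi_T: "phi n t [:0, 1:] v = Phi n t v"
  by (simp add: phi_pCons)

section \<open>Size of the torsion and faithfulness\<close>

text \<open>
  As a polynomial in \<open>v\<close>, \<open>\<phi>\<^sub>a(v)\<close> has derivative the constant term of \<open>\<phi>\<^sub>a\<close>, which is \<open>a(t)\<close>,
  since all other terms have exponents divisible by \<open>q\<close>. Hence it is separable as soon as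
  \<open>a(t) \<noteq> 0\<close>.
\<close>
lemma exists_poly_of_phi:
  fixes a :: "'a::finite_field poly"
  assumes "n \<ge> 1" "a \<noteq> 0"
  shows "\<exists>F. (\<forall>v. phi n t a v = poly F v) \<and> Polynomial.degree F = CARD('a) ^ (n * Polynomial.degree a) \<and>
    pderiv F = [:poly (map_poly to_ac a) t:]"
  using assms(2)
proof (induction a)
  case (pCons c a)
  let ?q = "CARD('a)"
  have q: "?q ^ n > 1" using card_field_gt_1[where 'a='a] assms(1) by (intro one_less_power) auto
  show ?case
  proof (cases "a = 0")
    case True
    hence "c \<noteq> 0" using pCons by simp
    thus ?thesis using True
      by (intro exI[of _ "[:0, to_ac c:]"]) (simp add: phi_pCons pderiv_pCons map_poly_pCons)
  next
    case False
    then obtain F where F: "\<And>v. phi n t a v = poly F v"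
      "Polynomial.degree F = ?q ^ (n * Polynomial.degree a)" "pderiv F = [:poly (map_poly to_ac a) t:]"
      using pCons by blast
    have dF: "Polynomial.degree F \<ge> 1" unfolding F using card_field_gt_1[where 'a='a]
      by (intro one_le_power) simp
    define G where "G = [:0, to_ac c:] + Polynomial.smult t F + F ^ (?q ^ n)"
    have "phi n t (pCons c a) v = to_ac c * v + Phi n t (phi n t a v)" for v
      by (simp add: phi_pCons phi_Phi)
    hence "phi n t (pCons c a) v = poly G v" for v
      by (simp add: G_def F(1)[symmetric] Phi_def frob_def poly_power mult.commute)
    moreover have "Polynomial.degree G = ?q ^ (n * Polynomial.degree (pCons c a))"
    proof -
      have dG: "Polynomial.degree (F ^ (?q ^ n)) = ?q ^ n * Polynomial.degree F"
        by (simp add: degree_power_monic)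
      have "Polynomial.degree [:0, to_ac c:] \<le> Polynomial.degree F" using dF by (simp add: degree_pCons_eq_if)
      hence "Polynomial.degree ([:0, to_ac c:] + Polynomial.smult t F) \<le> Polynomial.degree F"
        by (intro degree_add_le degree_smult_le)
      also have "Polynomial.degree F < ?q ^ n * Polynomial.degree F" using q dF by simp
      finally have "Polynomial.degree ([:0, to_ac c:] + Polynomial.smult t F) < Polynomial.degree (F ^ (?q ^ n))"
        by (simp add: dG)
      hence "Polynomial.degree G = ?q ^ n * Polynomial.degree F"
        unfolding G_def by (subst degree_add_eq_right) (simp_all add: dG)
      thus ?thesis using False by (simp add: F power_add)
    qed
    moreover have "pderiv G = [:poly (map_poly to_ac (pCons c a)) t:]"
    proof -
      have "of_nat (?q ^ n) = (0 :: 'a alg_closure)"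
        using assms(1) of_nat_card_eq_0[where 'a='a] by simp
      hence "pderiv (F ^ (?q ^ n)) = 0"
        unfolding pderiv_power by simp
      thus ?thesis
        by (simp add: G_def pderiv_add pderiv_smult pderiv_pCons F(3) map_poly_pCons)
    qed
    ultimately show ?thesis by blast
  qed
qed simp

lemma card_roots_separable:
  fixes F :: "'b::alg_closed_field poly"
  assumes "pderiv F = [:c:]" "c \<noteq> 0"
  shows "card {x. poly F x = 0} = Polynomial.degree F"
proof -
  have "F \<noteq> 0" using assms by auto
  then obtain A where A: "size A = Polynomial.degree F"
      "F = Polynomial.smult (Polynomial.lead_coeff F) (\<Prod>x\<in>#A. [:- x, 1:])"
    using alg_closed_imp_factorization by blast
  have "Multiset.count A x \<le> 1" for x
  proof (rule ccontr)
    assume "\<not> Multiset.count A x \<le> 1"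
    hence "replicate_mset 2 x \<subseteq># A" by (simp add: count_le_replicate_mset_subset_eq[symmetric])
    then obtain B where B: "A = replicate_mset 2 x + B" by (auto simp: subset_mset.le_iff_add)
    define H where "H = Polynomial.smult (Polynomial.lead_coeff F) (\<Prod>x\<in>#B. [:- x, 1:])"
    have "F = [:- x, 1:] * ([:- x, 1:] * H)"
      by (subst A(2)) (simp add: B H_def numeral_2_eq_2 del: mult_pCons_left)
    hence "poly (pderiv F) x = 0" by (simp add: pderiv_mult del: mult_pCons_left)
    thus False using assms by simp
  qed
  hence "A = mset_set (set_mset A)"
    by (intro multiset_eqI) (metis count_eq_zero_iff count_mset_set(1,3) finite_set_mset le_antisym
        less_one not_le)
  hence "size A = card (set_mset A)" by (metis size_mset_set)
  moreover have "{x. poly F x = 0} = set_mset A"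
    using \<open>F \<noteq> 0\<close> by (subst A(2)) (auto simp: poly_prod_mset prod_mset_zero_iff)
  ultimately show ?thesis using A(1) by simp
qed

lemma fun_sum_apply: "(\<Sum>x\<in>A. f x) v = (\<Sum>x\<in>A. f x v)"
  by (induction A rule: infinite_finite_induct) simp_all

lemma exists_repeated_value:
  fixes f :: "nat \<Rightarrow> 'b"
  assumes "finite A" "range f \<subseteq> A"
  obtains i j where "i < j" "f i = f j"
proof -
  have "\<not> inj f" using finite_subset[OF assms(2,1)] finite_imageD[of f UNIV] by auto
  thus ?thesis using that linorder_inj_onI'[of UNIV f] by blast
qed

locale drinfeld_torsion =
  fixes p p0 :: "'a::finite_field poly" and n r :: nat and t :: "'a alg_closure"
  assumes n_pos: "n \<ge> 1"
    and p: "monic_irreducible p" and p0: "monic_irreducible p0" and neq: "p \<noteq> p0"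
    and r: "r = Polynomial.degree p0" and t: "frob r t = t"
    and root: "poly (map_poly to_ac p0) t = 0" and cop: "coprime n r"
begin

abbreviation d :: nat where "d \<equiv> Polynomial.degree p"

abbreviation ph :: "'a poly \<Rightarrow> 'a alg_closure \<Rightarrow> 'a alg_closure"
  where "ph \<equiv> phi n t"

definition tors :: "'a alg_closure set"
  where "tors = {v. ph p v = 0}"

lemma irr_p: "Factorial_Ring.irreducible p" and irr_p0: "Factorial_Ring.irreducible p0"
  using p p0 by (auto simp: monic_irreducible_def)

lemma d_pos: "d > 0" and r_pos: "r > 0"
  using monic_irreducible_degree_pos[OF p] monic_irreducible_degree_pos[OF p0] r by auto

lemma ph_p0: "ph p0 v = frob (n * r) v"
  using phi_characteristic[OF irr_p0 _ root r t cop] p0 by (simp add: monic_irreducible_def)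

lemma finite_tors: "finite tors" and card_tors: "card tors = CARD('a) ^ (n * d)"
proof -
  have "\<not> p0 dvd p" using monic_irreducible_dvd_iff[OF p0 p] neq by auto
  hence nz: "poly (map_poly to_ac p) t \<noteq> 0" by (rule irreducible_not_dvd_imp_nonroot[OF irr_p0 root])
  have "p \<noteq> 0" using p by (auto simp: monic_irreducible_def)
  then obtain F where F: "\<And>v. ph p v = poly F v"
      "Polynomial.degree F = CARD('a) ^ (n * d)" "pderiv F = [:poly (map_poly to_ac p) t:]"
    using exists_poly_of_phi[OF n_pos] by blast
  have "tors = {v. poly F v = 0}" by (simp add: tors_def F)
  moreover have "F \<noteq> 0" using F(3) nz by auto
  ultimately show "finite tors" "card tors = CARD('a) ^ (n * d)"
    using card_roots_separable[OF F(3) nz] poly_roots_finite[of F] F(2) by simp_all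
qed

lemma tors_zero [simp]: "0 \<in> tors"
  and tors_add: "v \<in> tors \<Longrightarrow> w \<in> tors \<Longrightarrow> v + w \<in> tors"
  and tors_minus: "v \<in> tors \<Longrightarrow> - v \<in> tors"
  and tors_frob: "v \<in> tors \<Longrightarrow> frob r v \<in> tors"
  by (simp_all add: tors_def phi_add phi_minus phi_frob[OF t])

lemma tors_phi: "v \<in> tors \<Longrightarrow> ph a v \<in> tors"
  using phi_mult[of n t p a v] phi_mult[of n t a p v] by (simp add: tors_def mult.commute)

lemma tors_Phi: "v \<in> tors \<Longrightarrow> Phi n t v \<in> tors"
  using tors_phi[of v "[:0, 1:]"] by (simp add: phi_T)

lemma tors_frob_mult: "v \<in> tors \<Longrightarrow> frob (r * i) v \<in> tors"
  by (induction i) (use tors_frob in \<open>simp_all add: frob_frob[symmetric]\<close>)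

lemma tors_sum: "(\<And>i. i \<in> A \<Longrightarrow> f i \<in> tors) \<Longrightarrow> (\<Sum>i\<in>A. f i) \<in> tors"
  by (induction A rule: infinite_finite_induct) (auto intro: tors_add)

lemma phi_eq_on_tors: "v \<in> tors \<Longrightarrow> p dvd a - b \<Longrightarrow> ph a v = ph b v"
proof -
  assume *: "v \<in> tors" "p dvd a - b"
  then obtain e where "a - b = p * e" by (elim dvdE)
  hence "a - b = e * p" by simp
  hence "ph (a - b) v = ph e (ph p v)" by (simp add: phi_mult)
  thus "ph a v = ph b v" using * by (simp add: phi_diff_left tors_def)
qed

lemma exists_frob_period_on_tors:
  obtains k where "k \<ge> 1" "\<And>v. v \<in> tors \<Longrightarrow> frob (r * k) v = v"
proof -
  let ?f = "\<lambda>k. \<lambda>v\<in>tors. frob (r * k) v"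
  have "range ?f \<subseteq> tors \<rightarrow>\<^sub>E tors" using tors_frob_mult by auto
  moreover have "finite (tors \<rightarrow>\<^sub>E tors)" using finite_tors by (intro finite_PiE) auto
  ultimately obtain i j where "i < j" and eq: "?f i = ?f j" using exists_repeated_value by metis
  have "frob (r * (j - i)) v = v" if "v \<in> tors" for v
  proof -
    have "frob (r * i) v = frob (r * i) (frob (r * (j - i)) v)"
      using fun_cong[OF eq, of v] that \<open>i < j\<close> by (simp add: frob_frob diff_mult_distrib2)
    thus ?thesis by simp
  qed
  thus ?thesis using that[of "j - i"] \<open>i < j\<close> by simp
qed

text \<open>
  The elements of \<open>\<kappa>[\<pi>]\<close>; by \<open>\<pi>^n = c\<close> the powers below \<open>n\<close> suffice.
\<close>
definition pi_comb :: "(nat \<Rightarrow> 'a poly) \<Rightarrow> 'a alg_closure \<Rightarrow> 'a alg_closure"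
  where "pi_comb A v = (\<Sum>i<n. ph (A i) (frob (r * i) v))"

text \<open>
  Operators matter on the torsion only. Truncation by \<open>0\<close> makes them elements of a vector space
  of functions, in which equality on the torsion is equality.
\<close>
definition res :: "('a alg_closure \<Rightarrow> 'a alg_closure) \<Rightarrow> 'a alg_closure \<Rightarrow> 'a alg_closure"
  where "res f v = (if v \<in> tors then f v else 0)"

definition pi_combs :: "('a alg_closure \<Rightarrow> 'a alg_closure) set"
  where "pi_combs = range (\<lambda>A. res (pi_comb A))"

lemma pi_comb_add: "pi_comb (\<lambda>i. A i + B i) v = pi_comb A v + pi_comb B v"
  by (simp add: pi_comb_def phi_add_left sum.distrib)

lemma pi_comb_smult: "pi_comb (\<lambda>i. Polynomial.smult c (A i)) v = to_ac c * pi_comb A v"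
  by (simp add: pi_comb_def phi_smult sum_distrib_left)

lemma pi_comb_diff: "pi_comb (\<lambda>i. A i - B i) v = pi_comb A v - pi_comb B v"
  by (simp add: pi_comb_def phi_diff_left sum_subtractf)

lemma pi_comb_Phi: "pi_comb A (Phi n t v) = pi_comb (\<lambda>i. A i * [:0, 1:]) v"
proof -
  have "frob (r * i) (Phi n t v) = Phi n t (frob (r * i) v)" for i
    using frob_mult_index[OF t] by (simp add: Phi_frob)
  thus ?thesis by (simp add: pi_comb_def phi_mult phi_T del: mult_pCons_right)
qed

text \<open>
  Composition with \<open>\<pi>\<close> shifts the coefficients, and \<open>\<pi>^n = \<phi>\<^sub>p\<^sub>0\<close> carries the last one back to
  the front.
\<close>
lemma pi_comb_frob: "pi_comb A (frob r v) = pi_comb (\<lambda>i. if i = 0 then A (n - 1) * p0 else A (i - 1)) v"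
proof -
  obtain n' where n': "n = Suc n'" using n_pos by (cases n) auto
  have split: "(\<Sum>i<n. f i) = (\<Sum>i<n'. f i) + f n'" "(\<Sum>i<n. f i) = f 0 + (\<Sum>i<n'. f (Suc i))"
    for f :: "nat \<Rightarrow> 'a alg_closure"
    unfolding n' by (simp, simp only: sum.lessThan_Suc_shift)
  have "frob (r * n') (frob r v) = ph p0 v"
    unfolding ph_p0 frob_frob using n' by (simp add: mult.commute add.commute)
  hence "pi_comb A (frob r v) = (\<Sum>i<n'. ph (A i) (frob (r * Suc i) v)) + ph (A n' * p0) v"
    unfolding pi_comb_def split(1) by (simp add: frob_frob add.commute phi_mult)
  also have "\<dots> = pi_comb (\<lambda>i. if i = 0 then A (n - 1) * p0 else A (i - 1)) v"
    unfolding pi_comb_def split(2) using n' by simp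
  finally show ?thesis .
qed

lemma pi_comb_one: "pi_comb (\<lambda>i. if i = 0 then 1 else 0) v = v"
proof -
  have "pi_comb (\<lambda>i. if i = 0 then 1 else 0) v = (\<Sum>i<n. if i = 0 then v else 0)"
    unfolding pi_comb_def by (intro sum.cong refl) auto
  thus ?thesis using n_pos by (simp add: sum.delta)
qed

lemma pi_comb_cong: "(\<And>i. i < n \<Longrightarrow> p dvd A i - B i) \<Longrightarrow> res (pi_comb A) = res (pi_comb B)"
  by (rule ext) (auto simp: res_def pi_comb_def intro!: sum.cong phi_eq_on_tors tors_frob_mult)

lemma pi_combs_eq_image: "pi_combs = (\<lambda>A. res (pi_comb A)) ` ({..<n} \<rightarrow>\<^sub>E {a. Polynomial.degree a < d})"
proof (intro equalityI subsetI)
  fix f assume "f \<in> pi_combs"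
  then obtain A where f: "f = res (pi_comb A)" by (auto simp: pi_combs_def)
  have "res (pi_comb A) = res (pi_comb (\<lambda>i\<in>{..<n}. A i mod p))"
    by (rule pi_comb_cong) (simp add: minus_mod_eq_mult_div)
  moreover have "(\<lambda>i\<in>{..<n}. A i mod p) \<in> {..<n} \<rightarrow>\<^sub>E {a. Polynomial.degree a < d}"
    using degree_mod_less_pos[OF d_pos] by auto
  ultimately show "f \<in> (\<lambda>A. res (pi_comb A)) ` ({..<n} \<rightarrow>\<^sub>E {a. Polynomial.degree a < d})"
    unfolding f by blast
qed (auto simp: pi_combs_def)

lemma finite_pi_combs: "finite pi_combs"
  unfolding pi_combs_eq_image using card_poly_degree_less(1)[OF d_pos, where 'a='a]
  by (intro finite_imageI finite_PiE) auto

sublocale Fq: vector_space "\<lambda>(c :: 'a) (f :: 'a alg_closure \<Rightarrow> 'a alg_closure). (\<lambda>v. to_ac c * f v)"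
  by unfold_locales (simp_all add: fun_eq_iff plus_fun_def algebra_simps)

sublocale Om: vector_space "\<lambda>(c :: 'a alg_closure) (f :: 'a alg_closure \<Rightarrow> 'a alg_closure). (\<lambda>v. c * f v)"
  by unfold_locales (simp_all add: fun_eq_iff plus_fun_def algebra_simps)

lemma subspace_pi_combs: "Fq.subspace pi_combs"
proof (rule Fq.subspaceI)
  have "pi_comb (\<lambda>_. 0) v = 0" for v by (simp add: pi_comb_def)
  hence "res (pi_comb (\<lambda>_. 0)) = 0" by (simp add: res_def fun_eq_iff zero_fun_def)
  thus "0 \<in> pi_combs" by (metis pi_combs_def rangeI)
next
  fix f g assume "f \<in> pi_combs" "g \<in> pi_combs"
  then obtain A B where "f = res (pi_comb A)" "g = res (pi_comb B)" by (auto simp: pi_combs_def)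
  hence "f + g = res (pi_comb (\<lambda>i. A i + B i))" by (simp add: res_def fun_eq_iff plus_fun_def pi_comb_add)
  thus "f + g \<in> pi_combs" by (simp add: pi_combs_def)
next
  fix c f assume "f \<in> pi_combs"
  then obtain A where "f = res (pi_comb A)" by (auto simp: pi_combs_def)
  hence "(\<lambda>v. to_ac c * f v) = res (pi_comb (\<lambda>i. Polynomial.smult c (A i)))"
    by (simp add: res_def fun_eq_iff pi_comb_smult)
  thus "(\<lambda>v. to_ac c * f v) \<in> pi_combs" by (simp add: pi_combs_def)
qed

text \<open>
  Scalars from the algebraic closure do not commute with the operators, but they pass through
  precomposition.
\<close>
lemma span_pi_combs_precompose:
  assumes g: "\<And>v. v \<in> tors \<Longrightarrow> g v \<in> tors" and pi_combs: "\<And>f. f \<in> pi_combs \<Longrightarrow> res (f \<circ> g) \<in> pi_combs"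
    and f: "f \<in> Om.span pi_combs"
  shows "res (f \<circ> g) \<in> Om.span pi_combs"
  using f
proof (rule Om.span_induct)
  show "Om.subspace {f. res (f \<circ> g) \<in> Om.span pi_combs}"
  proof (rule Om.subspaceI; clarsimp)
    have "res (0 \<circ> g) = 0" by (simp add: res_def fun_eq_iff zero_fun_def)
    thus "res (0 \<circ> g) \<in> Om.span pi_combs" by (simp add: Om.span_zero)
    fix f h assume "res (f \<circ> g) \<in> Om.span pi_combs" "res (h \<circ> g) \<in> Om.span pi_combs"
    hence "res (f \<circ> g) + res (h \<circ> g) \<in> Om.span pi_combs" by (rule Om.span_add)
    moreover have "res (f \<circ> g) + res (h \<circ> g) = res ((f + h) \<circ> g)"
      by (simp add: res_def fun_eq_iff plus_fun_def)
    ultimately show "res ((f + h) \<circ> g) \<in> Om.span pi_combs" by simp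
  next
    fix c f assume "res (f \<circ> g) \<in> Om.span pi_combs"
    hence "(\<lambda>v. c * res (f \<circ> g) v) \<in> Om.span pi_combs" by (rule Om.span_scale)
    moreover have "(\<lambda>v. c * res (f \<circ> g) v) = res ((\<lambda>v. c * f v) \<circ> g)"
      by (simp add: res_def fun_eq_iff)
    ultimately show "res ((\<lambda>v. c * f v) \<circ> g) \<in> Om.span pi_combs" by simp
  qed
next
  show "res (f \<circ> g) \<in> Om.span pi_combs" if "f \<in> pi_combs" for f
    using pi_combs[OF that] by (rule Om.span_base)
qed

text \<open>
  The span is closed under precomposition with \<open>\<pi> = \<tau>^r\<close> and with \<open>\<phi>\<^sub>T = t + \<tau>^n\<close>, hence, after
  subtracting a scalar multiple, under passing from \<open>\<tau>^j\<close> to \<open>\<tau>^(j+n)\<close>. So it contains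
  \<open>\<tau>^(in+kr)\<close>. As \<open>n\<close> is invertible modulo \<open>r\<close> and \<open>\<tau>^r\<close> has finite order on the torsion, this
  covers all powers.
\<close>
lemma frob_in_span_pi_combs: "res (frob j) \<in> Om.span pi_combs"
proof -
  have step: "res (f \<circ> Phi n t) \<in> pi_combs" "res (f \<circ> frob r) \<in> pi_combs" if "f \<in> pi_combs" for f
  proof -
    obtain A where f: "f = res (pi_comb A)" using \<open>f \<in> pi_combs\<close> by (auto simp: pi_combs_def)
    have "res (f \<circ> Phi n t) = res (pi_comb (\<lambda>i. A i * [:0, 1:]))"
      unfolding f by (simp add: res_def fun_eq_iff pi_comb_Phi tors_Phi del: mult_pCons_right)
    thus "res (f \<circ> Phi n t) \<in> pi_combs" by (simp add: pi_combs_def)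
    have "res (f \<circ> frob r) = res (pi_comb (\<lambda>i. if i = 0 then A (n - 1) * p0 else A (i - 1)))"
      unfolding f by (simp add: res_def fun_eq_iff pi_comb_frob tors_frob)
    thus "res (f \<circ> frob r) \<in> pi_combs" by (simp add: pi_combs_def)
  qed
  have step_r: "res (frob (j + r)) \<in> Om.span pi_combs" if "res (frob j) \<in> Om.span pi_combs" for j
  proof -
    have "res (res (frob j) \<circ> frob r) \<in> Om.span pi_combs"
      using tors_frob step(2) that by (rule span_pi_combs_precompose)
    moreover have "res (res (frob j) \<circ> frob r) = res (frob (j + r))"
      using tors_frob by (simp add: res_def fun_eq_iff frob_frob)
    ultimately show ?thesis by simp
  qed
  have step_n: "res (frob (j + n)) \<in> Om.span pi_combs" if *: "res (frob j) \<in> Om.span pi_combs" for j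
  proof -
    have "res (res (frob j) \<circ> Phi n t) \<in> Om.span pi_combs"
      using tors_Phi step(1) * by (rule span_pi_combs_precompose)
    hence "res (res (frob j) \<circ> Phi n t) - (\<lambda>v. frob j t * res (frob j) v) \<in> Om.span pi_combs"
      by (rule Om.span_diff) (rule Om.span_scale[OF *])
    moreover have "res (res (frob j) \<circ> Phi n t) - (\<lambda>v. frob j t * res (frob j) v) = res (frob (j + n))"
      using tors_Phi by (simp add: res_def fun_eq_iff fun_diff_def Phi_def frob_add frob_mult frob_frob)
    ultimately show ?thesis by simp
  qed
  have "res (pi_comb (\<lambda>i. if i = 0 then 1 else 0)) \<in> pi_combs" by (simp add: pi_combs_def)
  moreover have "res (pi_comb (\<lambda>i. if i = 0 then 1 else 0)) = res (frob 0)"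
    by (simp add: res_def fun_eq_iff pi_comb_one)
  ultimately have base: "res (frob 0) \<in> Om.span pi_combs" using Om.span_base by metis
  have step_n': "res (frob (i * n)) \<in> Om.span pi_combs" for i
  proof (induction i)
    case 0
    show ?case unfolding mult_0 by (rule base)
  next
    case (Suc i)
    show ?case unfolding mult_Suc add.commute[of n] by (rule step_n[OF Suc])
  qed
  have all: "res (frob (i * n + k * r)) \<in> Om.span pi_combs" for i k
  proof (induction k)
    case (Suc k)
    thus ?case using step_r[OF Suc] by (simp add: ac_simps)
  qed (use step_n' in simp)
  obtain k0 where k0: "k0 \<ge> 1" "\<And>v. v \<in> tors \<Longrightarrow> frob (r * k0) v = v"
    by (rule exists_frob_period_on_tors) blast
  obtain x where "[n * x = 1] (mod r)" using cong_solve_coprime_nat[OF cop] by auto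
  hence "[n * x * j = 1 * j] (mod r)" by (rule cong_mult) simp
  define i where "i = x * j"
  have i: "[i * n = j] (mod r)" using \<open>[n * x * j = 1 * j] (mod r)\<close> by (simp add: i_def ac_simps)
  \<comment> \<open>With \<open>i n \<equiv> j (mod r)\<close>, add to \<open>j\<close> a multiple of the period \<open>r k0\<close> of the Frobenius so large that \<open>i n\<close> can be subtracted; the difference is a multiple of \<open>r\<close>.\<close>
  define J where "J = j + r * k0 * (i * n)"
  have "1 * (i * n) \<le> r * k0 * (i * n)" by (rule mult_le_mono1) (use r_pos k0(1) in simp)
  hence le: "i * n \<le> J" unfolding J_def by linarith
  have "[J = i * n] (mod r)"
    using cong_sym[OF i] unfolding J_def by (simp add: cong_def mult.assoc)
  hence "r dvd J - i * n" using cong_altdef_nat[OF le] by simp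
  then obtain k where "J - i * n = r * k" by (elim dvdE)
  hence J: "J = i * n + k * r" using le by (simp add: mult.commute)
  have "frob J v = frob j v" if "v \<in> tors" for v
    unfolding J_def using frob_mult_index[OF k0(2)[OF that]] by (simp flip: frob_frob)
  hence "res (frob J) = res (frob j)" by (simp add: res_def fun_eq_iff)
  thus ?thesis using all[of i k] by (simp add: J)
qed

text \<open>
  A basis \<open>B\<close> of the operators over \<open>GF(q)\<close> spans \<open>1, \<tau>, \<dots>, \<tau>^(nd-1)\<close> over the algebraic
  closure. These are independent on the torsion: a relation is a polynomial of degree below
  \<open>q^(nd)\<close> with \<open>q^(nd)\<close> zeros. So \<open>B\<close> has at least \<open>nd\<close> elements, and its \<open>GF(q)\<close>-span at least
  \<open>q^(nd)\<close>.
\<close>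
lemma card_pi_combs_ge: "card pi_combs \<ge> CARD('a) ^ (n * d)"
proof -
  obtain B where B: "B \<subseteq> pi_combs" "Fq.independent B" "pi_combs \<subseteq> Fq.span B"
    using Fq.basis_exists[of pi_combs] by metis
  have finB: "finite B" using B(1) finite_pi_combs by (rule finite_subset)
  have "pi_combs \<subseteq> Om.span B"
  proof
    fix f assume "f \<in> pi_combs"
    then obtain u where f: "f = (\<Sum>b\<in>B. (\<lambda>v. to_ac (u b) * b v))"
      using B(3) Fq.span_finite[OF finB] by auto
    show "f \<in> Om.span B" unfolding f by (intro Om.span_sum Om.span_scale Om.span_base)
  qed
  hence span: "res (frob j) \<in> Om.span B" for j
    using frob_in_span_pi_combs[of j] Om.span_mono Om.span_span by blast
  let ?D = "n * d" and ?T = "(\<lambda>j. res (frob j)) ` {..<n * d}"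
  have ind: "u j = 0" if "\<And>v. v \<in> tors \<Longrightarrow> (\<Sum>j<?D. u j * frob j v) = 0" "j < ?D" for u j
  proof -
    \<comment> \<open>The relation read as a polynomial, of degree at most \<open>q^(nd-1)\<close>.\<close>
    define P where "P = (\<Sum>j<?D. Polynomial.monom (u j) (CARD('a) ^ j))"
    have co: "poly.coeff P (CARD('a) ^ i) = (if i < ?D then u i else 0)" for i
      using card_field_gt_1[where 'a='a] by (simp add: P_def coeff_sum power_inject_exp)
    have "Polynomial.degree P < CARD('a) ^ ?D"
    proof -
      have "Polynomial.degree P \<le> CARD('a) ^ (?D - 1)"
        unfolding P_def using card_field_gt_1[where 'a='a]
        by (intro degree_sum_le) (auto intro!: order.trans[OF degree_monom_le] power_increasing)
      also have "\<dots> < CARD('a) ^ ?D"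
        using card_field_gt_1[where 'a='a] that(2) by (intro power_strict_increasing) auto
      finally show ?thesis .
    qed
    moreover have "tors \<subseteq> {x. poly P x = 0}"
      using that(1) by (auto simp: P_def poly_sum poly_monom frob_def)
    hence "P \<noteq> 0 \<Longrightarrow> card tors \<le> Polynomial.degree P"
      using card_mono[OF poly_roots_finite[of P]] card_poly_roots_bound[of P] le_trans by blast
    ultimately have "P = 0" using card_tors by auto
    thus ?thesis using co[of j] that(2) by simp
  qed
  have inj: "inj_on (\<lambda>j. res (frob j)) {..<?D}"
  proof (rule linorder_inj_onI')
    fix i j assume ij: "i \<in> {..<?D}" "j \<in> {..<?D}" "i < j"
    show "res (frob i) \<noteq> res (frob j)"
    proof
      assume eq: "res (frob i) = res (frob j)"
      define u :: "nat \<Rightarrow> 'a alg_closure" where "u = (\<lambda>k. if k = i then 1 else if k = j then - 1 else 0)"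
      have sum0: "(\<Sum>k<?D. u k * frob k v) = 0" if "v \<in> tors" for v
      proof -
        have "(\<Sum>k<?D. u k * frob k v) = (\<Sum>k\<in>{i, j}. u k * frob k v)"
          using ij by (intro sum.mono_neutral_right) (auto simp: u_def)
        also have "\<dots> = frob i v - frob j v" using ij by (simp add: u_def)
        also have "\<dots> = 0" using fun_cong[OF eq, of v] that by (simp add: res_def)
        finally show ?thesis .
      qed
      have "u i = 0" by (rule ind[OF sum0]) (use ij in auto)
      thus False by (simp add: u_def)
    qed
  qed
  have "Om.independent ?T"
  proof (rule Om.independent_if_scalars_zero)
    fix g x assume sum0: "(\<Sum>x\<in>?T. (\<lambda>v. g x * x v)) = 0" and "x \<in> ?T"
    then obtain j where j: "x = res (frob j)" "j < ?D" by auto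
    have "(\<Sum>j<?D. g (res (frob j)) * frob j v) = 0" if "v \<in> tors" for v
    proof -
      have "(\<Sum>x\<in>?T. g x * x v) = 0" using fun_cong[OF sum0, of v] by (simp add: fun_sum_apply)
      thus ?thesis using that by (simp add: sum.reindex[OF inj] res_def)
    qed
    thus "g x = 0" unfolding j(1) using j(2) by (rule ind)
  qed simp
  hence "card ?T \<le> card B" using Om.independent_span_bound[OF finB] span by blast
  hence "?D \<le> card B" using inj by (simp add: card_image)
  hence "CARD('a) ^ ?D \<le> CARD('a) ^ card B"
    using card_field_gt_1[where 'a='a] by (intro power_increasing) auto
  also have "\<dots> = card (B \<rightarrow>\<^sub>E (UNIV :: 'a set))" using finB by (simp add: card_PiE)
  also have "\<dots> \<le> card pi_combs"
  proof (rule card_inj_on_le[where f = "\<lambda>u. \<Sum>b\<in>B. (\<lambda>v. to_ac (u b) * b v)"])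
    show "inj_on (\<lambda>u. \<Sum>b\<in>B. (\<lambda>v. to_ac (u b) * b v)) (B \<rightarrow>\<^sub>E UNIV)"
    proof (rule inj_onI)
      fix u w assume uw: "u \<in> B \<rightarrow>\<^sub>E (UNIV :: 'a set)" "w \<in> B \<rightarrow>\<^sub>E (UNIV :: 'a set)"
        "(\<Sum>b\<in>B. (\<lambda>v. to_ac (u b) * b v)) = (\<Sum>b\<in>B. (\<lambda>v. to_ac (w b) * b v))"
      have "(\<Sum>b\<in>B. (\<lambda>v. to_ac (u b - w b) * b v)) =
          (\<Sum>b\<in>B. (\<lambda>v. to_ac (u b) * b v)) - (\<Sum>b\<in>B. (\<lambda>v. to_ac (w b) * b v))"
        by (simp add: fun_eq_iff fun_sum_apply fun_diff_def left_diff_distrib sum_subtractf)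
      hence "(\<Sum>b\<in>B. (\<lambda>v. to_ac (u b - w b) * b v)) = 0" using uw(3) by simp
      hence "u b - w b = 0" if "b \<in> B" for b
        using Fq.independentD[OF B(2) finB subset_refl, of "\<lambda>b. u b - w b"] that by blast
      thus "u = w" using uw(1,2) by (intro PiE_ext) auto
    qed
    show "(\<lambda>u. \<Sum>b\<in>B. (\<lambda>v. to_ac (u b) * b v)) ` (B \<rightarrow>\<^sub>E UNIV) \<subseteq> pi_combs"
      using B(1) by (auto intro!: Fq.subspace_sum[OF subspace_pi_combs] Fq.subspace_scale[OF subspace_pi_combs])
  qed (rule finite_pi_combs)
  finally show ?thesis .
qed

text \<open>
  The \<open>q^(nd)\<close> choices of coefficients reduced modulo \<open>p\<close> yield, by the previous bound, as many
  operators; so distinct choices give distinct operators.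
\<close>
lemma pi_comb_eq_0_imp:
  assumes "\<And>v. v \<in> tors \<Longrightarrow> pi_comb A v = 0" and "i < n"
  shows "p dvd A i"
proof -
  let ?S = "{..<n} \<rightarrow>\<^sub>E {a :: 'a poly. Polynomial.degree a < d}"
  have finS: "finite ?S" using card_poly_degree_less(1)[OF d_pos, where 'a='a] by (intro finite_PiE) auto
  have "card ?S = CARD('a) ^ (n * d)"
    using card_poly_degree_less(2)[OF d_pos, where 'a='a] by (simp add: card_PiE mult.commute flip: power_mult)
  hence "card ?S \<le> card ((\<lambda>A. res (pi_comb A)) ` ?S)" using card_pi_combs_ge by (simp add: pi_combs_eq_image)
  hence inj: "inj_on (\<lambda>A. res (pi_comb A)) ?S"
    using card_image_le[OF finS, of "\<lambda>A. res (pi_comb A)"] by (intro eq_card_imp_inj_on finS) simp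
  \<comment> \<open>The reduced coefficients of \<open>A\<close> and the zero coefficients give the same operator.\<close>
  let ?A = "\<lambda>i\<in>{..<n}. A i mod p" and ?Z = "\<lambda>i\<in>{..<n}. 0 :: 'a poly"
  have "res (pi_comb ?A) = res (pi_comb A)" by (rule pi_comb_cong) (simp add: mod_eq_dvd_iff[symmetric])
  also have "\<dots> = res (pi_comb ?Z)" using assms(1) by (auto simp: res_def fun_eq_iff pi_comb_def)
  finally have "?A = ?Z"
    using degree_mod_less_pos[OF d_pos] d_pos by (intro inj_onD[OF inj]) auto
  hence "A i mod p = 0" using assms(2) by (metis (no_types, lifting) lessThan_iff restrict_apply')
  thus ?thesis by auto
qed

end

section \<open>Endomorphisms of the torsion, and supersingularity\<close>

lemma twisted_act_eq_sum:
  "Polynomial.degree f \<le> N \<Longrightarrow> twisted_act f v = (\<Sum>i\<le>N. poly.coeff f i * frob i v)"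
  unfolding twisted_act_def frob_def by (rule sum.mono_neutral_left) (auto simp: coeff_eq_0)

lemma twisted_act_add: "twisted_act (f + g) v = twisted_act f v + twisted_act g v"
proof -
  define N where "N = max (Polynomial.degree f) (Polynomial.degree g)"
  have "Polynomial.degree (f + g) \<le> N" by (simp add: N_def degree_add_le_max)
  moreover have "Polynomial.degree f \<le> N" "Polynomial.degree g \<le> N" by (auto simp: N_def)
  ultimately show ?thesis by (simp add: twisted_act_eq_sum[of _ N] sum.distrib algebra_simps)
qed

lemma twisted_act_0 [simp]: "twisted_act 0 v = 0"
  by (simp add: twisted_act_def)

lemma twisted_act_sum: "twisted_act (\<Sum>i\<in>A. f i) v = (\<Sum>i\<in>A. twisted_act (f i) v)"
  by (induction A rule: infinite_finite_induct) (simp_all add: twisted_act_add)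

lemma twisted_act_monom: "twisted_act (Polynomial.monom c k) v = c * frob k v"
proof -
  have "twisted_act (Polynomial.monom c k) v = (\<Sum>i\<le>k. poly.coeff (Polynomial.monom c k) i * frob i v)"
    by (rule twisted_act_eq_sum) (rule degree_monom_le)
  also have "\<dots> = (\<Sum>i\<le>k. if i = k then c * frob k v else 0)" by (intro sum.cong) auto
  finally show ?thesis by simp
qed

lemma twisted_act_twisted_mult: "twisted_act (twisted_mult f g) v = twisted_act f (twisted_act g v)"
proof -
  have "twisted_act (twisted_mult f g) v =
    (\<Sum>i\<le>Polynomial.degree f. \<Sum>j\<le>Polynomial.degree g. poly.coeff f i * frob i (poly.coeff g j) * frob (i + j) v)"
    by (simp add: twisted_mult_def twisted_act_sum twisted_act_monom flip: frob_def)
  also have "\<dots> = twisted_act f (twisted_act g v)"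
    by (simp add: twisted_act_eq_sum[OF order_refl] frob_sum frob_mult frob_frob sum_distrib_left mult.assoc)
  finally show ?thesis .
qed

lemma twisted_ring_simps [simp]:
  "x \<otimes>\<^bsub>twisted_ring r\<^esub> y = twisted_mult x y" "\<one>\<^bsub>twisted_ring r\<^esub> = 1"
  "\<zero>\<^bsub>twisted_ring r\<^esub> = 0" "x \<oplus>\<^bsub>twisted_ring r\<^esub> y = x + y"
  by (simp_all add: twisted_ring_def)

lemma carrier_twisted_ring: "carrier (twisted_ring r) = {f. \<forall>i. frob r (poly.coeff f i) = poly.coeff f i}"
  by (simp add: twisted_ring_def GF_ac_altdef)

lemma twisted_mult_closed:
  assumes "f \<in> carrier (twisted_ring r)" "g \<in> carrier (twisted_ring r)"
  shows "twisted_mult f g \<in> carrier (twisted_ring r)"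
proof -
  have "frob r (poly.coeff (twisted_mult f g) k) = poly.coeff (twisted_mult f g) k" for k
    unfolding twisted_mult_def coeff_sum frob_sum coeff_monom using assms
    by (intro sum.cong refl) (simp add: carrier_twisted_ring frob_mult frob_power)
  thus ?thesis by (simp add: carrier_twisted_ring)
qed

lemma twisted_ring_abelian_monoid: "abelian_monoid (twisted_ring r)"
  by (rule abelian_monoidI) (simp_all add: carrier_twisted_ring frob_add algebra_simps)

lemma twisted_act_finsum:
  fixes h :: "nat \<Rightarrow> 'a::finite_field alg_closure poly"
  assumes "\<And>i. h i \<in> carrier (twisted_ring r)"
  shows "twisted_act (\<Oplus>\<^bsub>twisted_ring r\<^esub>i\<in>{..k}. h i) v = (\<Sum>i\<le>k. twisted_act (h i) v)"
proof (induction k)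
  case 0
  show ?case using abelian_monoid.finsum_0[OF twisted_ring_abelian_monoid, of h r] assms by simp
next
  case (Suc k)
  have "(\<Oplus>\<^bsub>twisted_ring r\<^esub>i\<in>{..Suc k}. h i) = h (Suc k) + (\<Oplus>\<^bsub>twisted_ring r\<^esub>i\<in>{..k}. h i)"
    using abelian_monoid.finsum_Suc[OF twisted_ring_abelian_monoid, of h k r] assms by simp
  thus ?case using Suc by (simp add: twisted_act_add)
qed

text \<open>
  The module defined inside the ring of twisted polynomials acts as the iterates of \<open>\<phi>\<^sub>T\<close>; from
  here on only the action is used.
\<close>
lemma twisted_act_drinfeld:
  fixes t :: "'a::finite_field alg_closure"
  assumes "frob r t = t" "n \<ge> 1"
  shows "twisted_act (drinfeld r n t a) v = phi n t a v"
proof -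
  let ?T = "[:t:] + Polynomial.monom 1 n" and ?R = "twisted_ring r"
  have T: "?T \<in> carrier ?R"
    using assms by (simp add: carrier_twisted_ring coeff_pCons split: nat.split)
  have Tact: "twisted_act ?T v = Phi n t v" for v
  proof -
    have "[:t:] = Polynomial.monom t 0" by (simp add: monom_0)
    thus ?thesis by (simp add: twisted_act_add twisted_act_monom Phi_def del: monom_0 flip: monom_0)
  qed
  have pow: "?T [^]\<^bsub>?R\<^esub> i \<in> carrier ?R \<and> (\<forall>v. twisted_act (?T [^]\<^bsub>?R\<^esub> i) v = (Phi n t ^^ i) v)" for i :: nat
  proof (induction i)
    case 0
    have "twisted_act 1 v = v" for v :: "'a alg_closure"
      using twisted_act_monom[of 1 0 v] by (simp add: monom_0 one_pCons)
    moreover have "1 \<in> carrier ?R" by (simp add: carrier_twisted_ring coeff_1)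
    ultimately show ?case by (simp add: nat_pow_def)
  next
    case (Suc i)
    have "?T [^]\<^bsub>?R\<^esub> Suc i = twisted_mult (?T [^]\<^bsub>?R\<^esub> i) ?T" by (simp add: nat_pow_def)
    thus ?case using Suc T Tact
      by (simp add: twisted_mult_closed twisted_act_twisted_mult funpow_swap1)
  qed
  have co: "[:to_ac c:] \<in> carrier ?R" for c :: 'a
    by (simp add: carrier_twisted_ring coeff_pCons split: nat.split)
  have coact: "twisted_act [:c:] v = c * v" for c v :: "'a alg_closure"
    using twisted_act_monom[of c 0 v] by (simp add: monom_0)
  have "twisted_act (drinfeld r n t a) v =
      (\<Sum>i\<le>Polynomial.degree a. twisted_act (twisted_mult [:to_ac (poly.coeff a i):] (?T [^]\<^bsub>?R\<^esub> i)) v)"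
    unfolding drinfeld_def twisted_ring_simps
    by (rule twisted_act_finsum) (use co pow twisted_mult_closed in blast)
  also have "\<dots> = (\<Sum>i\<le>Polynomial.degree a. to_ac (poly.coeff a i) * (Phi n t ^^ i) v)"
    using pow by (simp add: twisted_act_twisted_mult coact)
  also have "\<dots> = phi n t a v"
    by (simp add: phi_def star_def map_poly_to_ac_simps)
  finally show ?thesis .
qed

lemma the_elem_image_constant: "x \<in> C \<Longrightarrow> (\<And>y. y \<in> C \<Longrightarrow> f y = f x) \<Longrightarrow> the_elem (f ` C) = f x"
  by (metis image_constant_conv empty_iff image_cong the_elem_eq)

context drinfeld_torsion
begin

abbreviation "K \<equiv> residue_ring_poly p"
abbreviation "V \<equiv> torsion r n t p"
abbreviation "E \<equiv> E_ring r n t p"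

lemma carrier_V [simp]: "carrier V = tors"
  by (simp add: torsion_def tors_def twisted_act_drinfeld[OF t n_pos])

lemma V_simps [simp]: "v \<oplus>\<^bsub>V\<^esub> w = v + w" "\<zero>\<^bsub>V\<^esub> = 0"
  by (simp_all add: torsion_def)

lemma V_smult [simp]: "v \<in> tors \<Longrightarrow> residue_class p a \<odot>\<^bsub>V\<^esub> v = ph a v"
  unfolding torsion_def by (simp add: twisted_act_drinfeld[OF t n_pos])
    (rule the_elem_image_constant[OF residue_class_self],
     auto simp: residue_class_altdef intro: phi_eq_on_tors)

lemma E_carrier_iff: "f \<in> carrier E \<longleftrightarrow> f \<in> tors \<rightarrow>\<^sub>E tors \<and>
    (\<forall>v\<in>tors. \<forall>w\<in>tors. f (v + w) = f v + f w) \<and> (\<forall>a. \<forall>v\<in>tors. f (ph a v) = ph a (f v))"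
proof -
  have "(\<forall>C\<in>carrier K. \<forall>v\<in>tors. f (C \<odot>\<^bsub>V\<^esub> v) = C \<odot>\<^bsub>V\<^esub> f v) \<longleftrightarrow>
      (\<forall>a. \<forall>v\<in>tors. f (ph a v) = ph a (f v))" if f: "f \<in> tors \<rightarrow>\<^sub>E tors"
  proof -
    have "f v \<in> tors" if "v \<in> tors" for v using f that by (rule PiE_mem)
    thus ?thesis by (simp add: carrier_residue_ring_poly)
  qed
  thus ?thesis unfolding E_ring_def End_ring_def Defs.module_hom_def by auto
qed

lemma E_simps [simp]: "f \<otimes>\<^bsub>E\<^esub> g = compose tors f g" "\<one>\<^bsub>E\<^esub> = (\<lambda>v\<in>tors. v)"
  "\<zero>\<^bsub>E\<^esub> = (\<lambda>v\<in>tors. 0)" "f \<oplus>\<^bsub>E\<^esub> g = (\<lambda>v\<in>tors. f v + g v)"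
  by (simp_all add: E_ring_def End_ring_def)

lemma E_closed: "f \<in> carrier E \<Longrightarrow> v \<in> tors \<Longrightarrow> f v \<in> tors"
  and E_add: "f \<in> carrier E \<Longrightarrow> v \<in> tors \<Longrightarrow> w \<in> tors \<Longrightarrow> f (v + w) = f v + f w"
  and E_phi: "f \<in> carrier E \<Longrightarrow> v \<in> tors \<Longrightarrow> f (ph a v) = ph a (f v)"
  and E_ext: "f \<in> carrier E \<Longrightarrow> f \<in> extensional tors"
  by (auto simp: E_carrier_iff PiE_def)

lemma E_zero: "f \<in> carrier E \<Longrightarrow> f 0 = 0"
  using E_phi[of f 0 0] by simp

lemma E_sum: "f \<in> carrier E \<Longrightarrow> (\<And>i. i \<in> A \<Longrightarrow> g i \<in> tors) \<Longrightarrow> f (\<Sum>i\<in>A. g i) = (\<Sum>i\<in>A. f (g i))"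
  by (induction A rule: infinite_finite_induct) (simp_all add: E_zero E_add tors_sum)

lemma E_eqI: "f \<in> carrier E \<Longrightarrow> g \<in> carrier E \<Longrightarrow> (\<And>v. v \<in> tors \<Longrightarrow> f v = g v) \<Longrightarrow> f = g"
  using E_ext extensionalityI by blast

lemma E_memI:
  assumes "\<And>v. v \<in> tors \<Longrightarrow> f v \<in> tors" "\<And>v w. v \<in> tors \<Longrightarrow> w \<in> tors \<Longrightarrow> f (v + w) = f v + f w"
    "\<And>a v. v \<in> tors \<Longrightarrow> f (ph a v) = ph a (f v)"
  shows "restrict f tors \<in> carrier E"
  using assms by (auto simp: E_carrier_iff tors_add tors_phi)

lemma E_ring: "ring E"
proof (rule ringI)
  have add: "f \<oplus>\<^bsub>E\<^esub> g \<in> carrier E" if "f \<in> carrier E" "g \<in> carrier E" for f g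
    unfolding E_simps by (rule E_memI) (use that in \<open>simp_all add: E_closed tors_add E_add E_phi phi_add\<close>)
  have zero: "\<zero>\<^bsub>E\<^esub> \<in> carrier E" unfolding E_simps by (rule E_memI) simp_all
  show "abelian_group E"
  proof (rule abelian_groupI)
    fix x assume x: "x \<in> carrier E"
    have "(\<lambda>v\<in>tors. - x v) \<in> carrier E"
      by (rule E_memI) (use x in \<open>simp_all add: E_closed tors_minus E_add E_phi phi_minus\<close>)
    moreover have "(\<lambda>v\<in>tors. - x v) \<oplus>\<^bsub>E\<^esub> x = \<zero>\<^bsub>E\<^esub>" by (auto simp: fun_eq_iff restrict_def)
    ultimately show "\<exists>y\<in>carrier E. y \<oplus>\<^bsub>E\<^esub> x = \<zero>\<^bsub>E\<^esub>" by blast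
  next
    fix x assume x: "x \<in> carrier E"
    show "\<zero>\<^bsub>E\<^esub> \<oplus>\<^bsub>E\<^esub> x = x" by (rule E_eqI[OF add[OF zero x] x]) simp
  qed (use add zero in \<open>auto simp: fun_eq_iff restrict_def algebra_simps\<close>)
  have mult: "f \<otimes>\<^bsub>E\<^esub> g \<in> carrier E" if "f \<in> carrier E" "g \<in> carrier E" for f g
    unfolding E_simps compose_def
    by (rule E_memI) (use that in \<open>simp_all add: E_closed E_add E_phi\<close>)
  have one: "\<one>\<^bsub>E\<^esub> \<in> carrier E" unfolding E_simps by (rule E_memI) simp_all
  show "Group.monoid E"
  proof (rule monoidI)
    fix x assume x: "x \<in> carrier E"
    show "\<one>\<^bsub>E\<^esub> \<otimes>\<^bsub>E\<^esub> x = x" by (rule E_eqI[OF mult[OF one x] x]) (simp add: compose_def E_closed x)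
    show "x \<otimes>\<^bsub>E\<^esub> \<one>\<^bsub>E\<^esub> = x" by (rule E_eqI[OF mult[OF x one] x]) (simp add: compose_def)
  next
    fix x y z assume "x \<in> carrier E" "y \<in> carrier E" "z \<in> carrier E"
    thus "x \<otimes>\<^bsub>E\<^esub> y \<otimes>\<^bsub>E\<^esub> z = x \<otimes>\<^bsub>E\<^esub> (y \<otimes>\<^bsub>E\<^esub> z)"
      by (auto simp: compose_def fun_eq_iff restrict_def E_closed)
  qed (use mult one in auto)
qed (auto simp: compose_def fun_eq_iff restrict_def E_closed E_add)

sublocale E: ring E by (rule E_ring)

definition scal :: "'a poly \<Rightarrow> 'a alg_closure \<Rightarrow> 'a alg_closure"
  where "scal a = (\<lambda>v\<in>tors. ph a v)"

lemma kappa_scalar_residue_class: "kappa_scalar r n t p (residue_class p a) = scal a"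
  unfolding kappa_scalar_def scal_def by (auto simp: restrict_def fun_eq_iff)

abbreviation "\<pi> \<equiv> pi_op r n t p"

lemma pi_eq: "\<pi> = (\<lambda>v\<in>tors. frob r v)"
  by (simp add: pi_op_def frob_def)

lemma frob_closed: "(\<lambda>v\<in>tors. frob (r * k) v) \<in> carrier E"
  by (rule E_memI) (simp_all add: tors_frob_mult frob_add phi_frob[OF frob_mult_index[OF t]])

lemma pi_closed: "\<pi> \<in> carrier E"
  using frob_closed[of 1] by (simp add: pi_eq)

lemma pi_pow: "\<pi> [^]\<^bsub>E\<^esub> (k :: nat) = (\<lambda>v\<in>tors. frob (r * k) v)"
proof (induction k)
  case 0
  show ?case by (simp add: restrict_def)
next
  case (Suc k)
  thus ?case by (auto simp: pi_eq compose_def restrict_def fun_eq_iff frob_frob tors_frob add.commute)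
qed

end

text \<open>
  \<open>\<phi>[p0]\<close> is the zero set of \<open>\<tau>^(nr)\<close>, so it is trivial, and the free modules \<open>(A/p0)^(n-h)\<close> are
  told apart by their size.
\<close>
lemma supersingular_characteristic:
  fixes p0 :: "'a::finite_field poly"
  assumes n_pos: "n \<ge> 1" and p0: "monic_irreducible p0" and r: "r = Polynomial.degree p0"
    and t: "frob r t = t" and root: "poly (map_poly to_ac p0) t = 0" and cop: "coprime n r"
  shows "supersingular r n t p0"
proof -
  let ?K = "residue_ring_poly p0" and ?V = "torsion r n t p0"
  have irr: "Factorial_Ring.irreducible p0" using p0 by (simp add: monic_irreducible_def)
  have pos: "Polynomial.degree p0 > 0" by (rule irreducible_degree_pos[OF irr])
  have phi0: "phi n t p0 v = frob (n * r) v" for v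
    using phi_characteristic[OF irr _ root r t cop] p0 by (simp add: monic_irreducible_def)
  have V: "carrier ?V = {0}"
    by (auto simp: torsion_def twisted_act_drinfeld[OF t n_pos] phi0 frob_def)
  have smult: "C \<odot>\<^bsub>?V\<^esub> 0 = 0" if "C \<in> carrier ?K" for C
  proof -
    obtain a where a: "C = residue_class p0 a" using \<open>C \<in> _\<close> by (auto simp: carrier_residue_ring_poly)
    have "the_elem ((\<lambda>a. twisted_act (drinfeld r n t a) 0) ` C) = twisted_act (drinfeld r n t a) 0"
      by (rule the_elem_image_constant)
        (auto simp: a residue_class_self twisted_act_drinfeld[OF t n_pos])
    thus ?thesis by (simp add: torsion_def twisted_act_drinfeld[OF t n_pos])
  qed
  have iso: "module_isomorphic ?K ?V (free_module ?K (n - h)) \<longleftrightarrow> h = n" if h: "h \<in> {1..n}" for h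
  proof
    assume "h = n"
    have "(\<lambda>v\<in>{0}. \<lambda>_. undefined) \<in> module_hom ?K ?V (free_module ?K (n - h))"
      unfolding module_hom_def V using smult \<open>h = n\<close>
      by (auto simp: free_module_def torsion_def restrict_def)
    moreover have "bij_betw (\<lambda>v\<in>{0}. \<lambda>_. undefined) (carrier ?V) (carrier (free_module ?K (n - h)))"
      unfolding V using \<open>h = n\<close> by (auto simp: free_module_def bij_betw_def)
    ultimately show "module_isomorphic ?K ?V (free_module ?K (n - h))"
      unfolding module_isomorphic_def by blast
  next
    assume "module_isomorphic ?K ?V (free_module ?K (n - h))"
    then obtain f where "bij_betw f {0 :: 'a alg_closure} (carrier (free_module ?K (n - h)))"
      unfolding module_isomorphic_def V by (rule bexE) (rule that)
    hence "card (carrier (free_module ?K (n - h))) = 1"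
      using bij_betw_same_card by fastforce
    hence "(CARD('a) ^ Polynomial.degree p0) ^ (n - h) = 1"
      using card_residue_ring_poly[OF pos] by (simp add: free_module_def card_PiE)
    hence "n - h = 0"
      using card_field_gt_1[where 'a='a] pos by (auto simp: power_eq_1_iff simp flip: power_mult)
    thus "h = n" using h by simp
  qed
  have "height r n t p0 = n"
    unfolding height_def
  proof (rule the_equality)
    show "n \<in> {1..n} \<and> module_isomorphic ?K ?V (free_module ?K (n - n))"
      using iso[THEN iffD2, of n] n_pos by (simp only: atLeastAtMost_iff order_refl simp_thms)
  next
    fix h assume "h \<in> {1..n} \<and> module_isomorphic ?K ?V (free_module ?K (n - h))"
    thus "h = n" using iso[of h] by blast
  qed
  thus ?thesis by (simp add: supersingular_def)
qed

section \<open>A cyclic vector\<close>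

text \<open>
  A finite module \<open>M\<close> over a commutative ring, in which every ideal that contains the
  annihilator \<open>N\<close> of \<open>M\<close> is principal modulo \<open>N\<close>. Working modulo \<open>N\<close> avoids forming the quotient
  ring, which here would be \<open>\<kappa>[x]/(x^n - c)\<close>.
\<close>
locale finite_comm_module =
  fixes act :: "'r::comm_ring_1 \<Rightarrow> 'm::ab_group_add \<Rightarrow> 'm" and M :: "'m set" and N :: "'r set"
  defines "N \<equiv> {x. \<forall>v\<in>M. act x v = 0}"
  assumes fin: "finite M" and closed: "\<And>x v. v \<in> M \<Longrightarrow> act x v \<in> M"
    and zero: "0 \<in> M" and add_closed: "\<And>v w. v \<in> M \<Longrightarrow> w \<in> M \<Longrightarrow> v + w \<in> M"
    and act_add: "\<And>x v w. act x (v + w) = act x v + act x w"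
    and act_add_left: "\<And>x y v. act (x + y) v = act x v + act y v"
    and act_mult: "\<And>x y v. act (x * y) v = act x (act y v)"
    and principal: "\<And>I. N \<subseteq> I \<Longrightarrow> (\<And>x y. x \<in> I \<Longrightarrow> y \<in> I \<Longrightarrow> x + y \<in> I) \<Longrightarrow>
      (\<And>x y. y \<in> I \<Longrightarrow> x * y \<in> I) \<Longrightarrow> \<exists>f\<in>I. \<forall>x\<in>I. \<exists>y. x - y * f \<in> N"
begin

lemma act_zero [simp]: "act x 0 = 0"
  using act_add[of x 0 0] by (metis add.right_neutral add_left_cancel)

lemma act_zero_left [simp]: "act 0 v = 0"
  using act_add_left[of 0 0 v] by (metis add.right_neutral add_left_cancel)

lemma act_minus_left: "act (- x) v = - act x v"
  using act_add_left[of x "- x" v] by (simp add: eq_neg_iff_add_eq_0 add.commute)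

lemma act_diff_left: "act (x - y) v = act x v - act y v"
  using act_add_left[of x "- y" v] by (simp add: act_minus_left)

definition ann :: "'m \<Rightarrow> 'r set"
  where "ann v = {x. act x v = 0}"

lemma ann_add: "x \<in> ann v \<Longrightarrow> y \<in> ann v \<Longrightarrow> x + y \<in> ann v"
  and ann_mult: "y \<in> ann v \<Longrightarrow> x * y \<in> ann v"
  by (simp_all add: ann_def act_add_left act_mult)

lemma N_subset_ann: "v \<in> M \<Longrightarrow> N \<subseteq> ann v"
  by (auto simp: N_def ann_def)

lemma ann_cong: "v \<in> M \<Longrightarrow> x - y \<in> N \<Longrightarrow> x \<in> ann v \<longleftrightarrow> y \<in> ann v"
  by (auto simp: N_def ann_def act_diff_left)

lemma N_mult: "x \<in> N \<Longrightarrow> y * x \<in> N"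
  and N_add: "x \<in> N \<Longrightarrow> y \<in> N \<Longrightarrow> x + y \<in> N"
  by (auto simp: N_def act_mult act_add_left)

text \<open>
  The powers of \<open>a\<close> repeat on the finite module; a power that is a multiple of the period,
  beyond the preperiod, is idempotent modulo \<open>N\<close>.
\<close>
lemma exists_idempotent_power:
  obtains k where "k \<ge> 1" "a ^ k * a ^ k - a ^ k \<in> N"
proof -
  let ?f = "\<lambda>k. \<lambda>v\<in>M. act (a ^ k) v"
  have "range ?f \<subseteq> M \<rightarrow>\<^sub>E M" using closed by auto
  moreover have "finite (M \<rightarrow>\<^sub>E M)" using fin by (intro finite_PiE) auto
  ultimately obtain i j where "i < j" and eq: "?f i = ?f j" using exists_repeated_value by metis
  define s where "s = j - i"
  have s: "s \<ge> 1" "j = i + s" using \<open>i < j\<close> by (auto simp: s_def)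
  have base: "a ^ (i + s) - a ^ i \<in> N"
    using fun_cong[OF eq] by (auto simp: N_def act_diff_left s(2) restrict_def) metis
  have per: "a ^ (i + l + m * s) - a ^ (i + l) \<in> N" for l m
  proof (induction m)
    case 0
    show ?case by (simp add: N_def)
  next
    case (Suc m)
    have "a ^ (i + l + Suc m * s) - a ^ (i + l + m * s) = a ^ (l + m * s) * (a ^ (i + s) - a ^ i)"
      by (simp add: algebra_simps power_add)
    hence "a ^ (i + l + Suc m * s) - a ^ (i + l + m * s) \<in> N" using base N_mult by simp
    from N_add[OF this Suc] show ?case by simp
  qed
  \<comment> \<open>A multiple of the period \<open>s\<close> that is at least the preperiod \<open>i\<close>.\<close>
  define k where "k = s * (i + 1)"
  have "i \<le> k" using s(1) by (simp add: k_def trans_le_add2)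
  then obtain l where l: "k = i + l" using le_Suc_ex by blast
  have "k + k = i + l + (i + 1) * s" unfolding l[symmetric] by (simp add: k_def)
  hence "a ^ (k + k) - a ^ k \<in> N" using per[of l "i + 1"] l by simp
  moreover have "k \<ge> 1" using s(1) by (simp add: k_def)
  ultimately show ?thesis using that by (simp add: power_add)
qed

text \<open>
  In a finite principal ring the sum \<open>I\<close> of the annihilators of \<open>v\<close> and \<open>w\<close> is generated by some
  \<open>z = z1 + z2\<close>, with \<open>z1 = a z\<close> and \<open>z2 = b z\<close> annihilating \<open>v\<close> and \<open>w\<close>. An idempotent power
  \<open>e\<close> of \<open>a\<close> splits the ring so that on the part of \<open>e\<close> the annihilator of \<open>w\<close> is contained in
  that of \<open>v\<close>, and on the part of \<open>1 - e\<close> conversely: locally two ideals of a finite principal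
  ring are comparable. Then \<open>u = (1 - e) v + e w\<close> takes on each part the vector with the smaller
  annihilator.
\<close>
lemma exists_common_annihilator:
  assumes v: "v \<in> M" and w: "w \<in> M"
  shows "\<exists>u\<in>M. ann u \<subseteq> ann v \<inter> ann w"
proof -
  define I where "I = {x + y | x y. x \<in> ann v \<and> y \<in> ann w}"
  have sub: "ann v \<subseteq> I" "ann w \<subseteq> I"
  proof -
    have "x = x + 0" "x = 0 + x" "0 \<in> ann v" "0 \<in> ann w" for x :: 'r by (simp_all add: ann_def)
    thus "ann v \<subseteq> I" "ann w \<subseteq> I" unfolding I_def by blast+
  qed
  have "\<exists>f\<in>I. \<forall>x\<in>I. \<exists>y. x - y * f \<in> N"
  proof (rule principal)
    show "N \<subseteq> I" using N_subset_ann[OF v] sub by blast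
    fix x y assume "x \<in> I" "y \<in> I"
    then obtain x1 x2 y1 y2 where "x = x1 + x2" "y = y1 + y2" "x1 \<in> ann v" "y1 \<in> ann v"
      "x2 \<in> ann w" "y2 \<in> ann w" unfolding I_def by blast
    hence "x + y = (x1 + y1) + (x2 + y2)" "x1 + y1 \<in> ann v" "x2 + y2 \<in> ann w"
      by (simp_all add: ann_add algebra_simps)
    thus "x + y \<in> I" unfolding I_def by blast
  next
    fix x y assume "y \<in> I"
    then obtain y1 y2 where "y = y1 + y2" "y1 \<in> ann v" "y2 \<in> ann w" unfolding I_def by blast
    hence "x * y = x * y1 + x * y2" "x * y1 \<in> ann v" "x * y2 \<in> ann w"
      by (simp_all add: ann_mult distrib_left)
    thus "x * y \<in> I" unfolding I_def by blast
  qed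
  then obtain z where z: "z \<in> I" "\<And>x. x \<in> I \<Longrightarrow> \<exists>y. x - y * z \<in> N" by blast
  obtain z1 z2 where z12: "z = z1 + z2" "z1 \<in> ann v" "z2 \<in> ann w" using z(1) unfolding I_def by blast
  obtain a where a: "z1 - a * z \<in> N" using z(2) z12(2) sub by blast
  obtain b where b: "z2 - b * z \<in> N" using z(2) z12(3) sub by blast
  have az: "a * z \<in> ann v" using ann_cong[OF v a] z12 by simp
  have bz: "b * z \<in> ann w" using ann_cong[OF w b] z12 by simp
  obtain k where k: "k \<ge> 1" "a ^ k * a ^ k - a ^ k \<in> N" by (rule exists_idempotent_power)
  define e where "e = a ^ k"
  have idem: "(1 - e) * e * x \<in> N" for x
  proof -
    have "- x * (e * e - e) \<in> N" using N_mult[of "e * e - e" "- x"] k(2) by (simp add: e_def)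
    thus ?thesis by (simp add: algebra_simps)
  qed
  have ez: "e * z \<in> ann v"
  proof -
    obtain k' where "k = Suc k'" using k(1) by (cases k) auto
    hence "e * z = a ^ k' * (a * z)" by (simp add: e_def ac_simps)
    thus ?thesis using ann_mult[OF az] by simp
  qed
  have ez': "(1 - e) * z \<in> ann w"
  proof -
    \<comment> \<open>Modulo \<open>N\<close>, \<open>(a + b)^k = e + b h\<close> acts as the identity on \<open>z\<close>, so \<open>(1 - e) z\<close> is a multiple of \<open>b z\<close>.\<close>
    have pow: "z - (a + b) ^ i * z \<in> N" for i
    proof (induction i)
      case 0
      show ?case by (simp add: N_def)
    next
      case (Suc i)
      have "z - (a + b) * z = (z1 - a * z) + (z2 - b * z)" by (simp add: z12(1) algebra_simps)
      hence "z - (a + b) * z \<in> N" using N_add[OF a b] by simp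
      from N_add[OF this N_mult[OF Suc, of "a + b"]] show ?case by (simp add: algebra_simps)
    qed
    have "(a + b) - a dvd (a + b) ^ k - a ^ k"
      unfolding power_diff_sumr2 by (rule dvd_triv_left)
    then obtain h where "(a + b) ^ k - a ^ k = ((a + b) - a) * h" by (elim dvdE)
    hence h: "(a + b) ^ k = e + b * h" by (simp add: e_def diff_eq_eq add.commute)
    have "(1 - e) * z - (1 - e) * h * (b * z) = (1 - e) * (z - (a + b) ^ k * z) + (1 - e) * e * z"
      unfolding h by (simp add: algebra_simps)
    hence "(1 - e) * z - (1 - e) * h * (b * z) \<in> N"
      using N_add[OF N_mult[OF pow] idem] by simp
    from ann_cong[OF w this] show ?thesis using ann_mult[OF bz] by blast
  qed
  have e_w: "e * x \<in> ann v" if "x \<in> ann w" for x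
  proof -
    obtain y where "x - y * z \<in> N" using z(2) sub \<open>x \<in> ann w\<close> by blast
    hence "e * x - y * (e * z) \<in> N" using N_mult[of "x - y * z" e] by (simp add: algebra_simps)
    from ann_cong[OF v this] show ?thesis using ann_mult[OF ez] by blast
  qed
  have e_v: "(1 - e) * x \<in> ann w" if "x \<in> ann v" for x
  proof -
    obtain y where "x - y * z \<in> N" using z(2) sub \<open>x \<in> ann v\<close> by blast
    hence "(1 - e) * x - y * ((1 - e) * z) \<in> N" using N_mult[of "x - y * z" "1 - e"] by (simp add: algebra_simps)
    from ann_cong[OF w this] show ?thesis using ann_mult[OF ez'] by blast
  qed
  define u where "u = act (1 - e) v + act e w"
  have "c \<in> ann v \<inter> ann w" if c: "c \<in> ann u" for c
  proof -
    have cu: "act (x * c * (1 - e)) v + act (x * c * e) w = 0" for x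
    proof -
      have "act (x * c * (1 - e)) v + act (x * c * e) w = act x (act c u)"
        by (simp only: u_def act_add act_mult)
      thus ?thesis using c by (simp add: ann_def)
    qed
    have Nv: "act y x = 0" if "x \<in> M" "y \<in> N" for x y using that by (simp add: N_def)
    have 1: "c * (1 - e) \<in> ann v"
    proof -
      have "act ((1 - e) * c * e) w = 0"
        using Nv[OF w idem[of c]] by (simp add: ac_simps)
      hence "act ((1 - e) * c * (1 - e)) v = 0" using cu[of "1 - e"] by simp
      moreover have "c * (1 - e) - (1 - e) * c * (1 - e) \<in> N"
        using idem[of c] by (simp add: algebra_simps)
      ultimately show ?thesis using ann_cong[OF v] by (simp add: ann_def)
    qed
    have 2: "c * e \<in> ann w"
    proof -
      have "act (e * c * (1 - e)) v = 0"
        using Nv[OF v idem[of c]] by (simp add: ac_simps)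
      hence "act (e * c * e) w = 0" using cu[of e] by simp
      moreover have "c * e - e * c * e \<in> N" using idem[of c] by (simp add: algebra_simps)
      ultimately show ?thesis using ann_cong[OF w] by (simp add: ann_def)
    qed
    have "e * (c * e) \<in> ann v" by (rule e_w[OF 2])
    moreover have "c * e - e * (c * e) \<in> N" using idem[of c] by (simp add: algebra_simps)
    ultimately have "c * e \<in> ann v" using ann_cong[OF v] by blast
    hence "c * (1 - e) + c * e \<in> ann v" using 1 by (rule ann_add[rotated])
    moreover have "(1 - e) * (c * (1 - e)) \<in> ann w" by (rule e_v[OF 1])
    moreover have "c * (1 - e) - (1 - e) * (c * (1 - e)) \<in> N" using idem[of c] by (simp add: algebra_simps)
    ultimately have "c * (1 - e) + c * e \<in> ann v" "c * (1 - e) \<in> ann w" using ann_cong[OF w] by blast+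
    moreover have "c * (1 - e) + c * e = c" by (simp add: algebra_simps)
    ultimately show ?thesis using ann_add[OF _ 2, of "c * (1 - e)"] by auto
  qed
  moreover have "u \<in> M" unfolding u_def using v w closed add_closed by blast
  ultimately show ?thesis by blast
qed

lemma exists_vector_with_minimal_annihilator: "\<exists>u\<in>M. ann u = N"
proof -
  have "\<exists>u\<in>M. \<forall>w\<in>S. ann u \<subseteq> ann w" if "finite S" "S \<subseteq> M" for S
    using that
  proof (induction S rule: finite_induct)
    case empty
    show ?case using zero by blast
  next
    case (insert w S)
    then obtain u where u: "u \<in> M" "\<forall>w\<in>S. ann u \<subseteq> ann w" by auto
    obtain u' where "u' \<in> M" "ann u' \<subseteq> ann u \<inter> ann w"
      using exists_common_annihilator[OF u(1), of w] insert by blast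
    thus ?case using u(2) by blast
  qed
  then obtain u where u: "u \<in> M" "\<forall>w\<in>M. ann u \<subseteq> ann w" using fin by blast
  hence "ann u \<subseteq> N" by (auto simp: ann_def N_def)
  thus ?thesis using N_subset_ann[OF u(1)] u(1) by blast
qed

end

text \<open>
  \<open>\<kappa>[x]\<close> is a principal ideal domain, expressed on polynomials over \<open>A\<close>: among the elements of
  \<open>I\<close> that are nonzero modulo \<open>p\<close> take one of least degree, make its leading coefficient \<open>1\<close>,
  and divide by it.
\<close>
lemma ideal_principal_mod_irreducible:
  fixes p :: "'a::finite_field poly" and I :: "'a poly poly set"
  assumes irr: "Factorial_Ring.irreducible p" and pI: "[:p:] \<in> I"
    and add: "\<And>x y. x \<in> I \<Longrightarrow> y \<in> I \<Longrightarrow> x + y \<in> I" and mult: "\<And>x y. y \<in> I \<Longrightarrow> x * y \<in> I"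
  shows "\<exists>f\<in>I. \<forall>x\<in>I. \<exists>y. [:p:] dvd x - y * f"
proof -
  have pmult: "[:p:] * x \<in> I" for x using mult[OF pI, of x] by (simp only: mult.commute)
  have diff: "x - y \<in> I" if "x \<in> I" "y \<in> I" for x y using add[OF that(1) mult[OF that(2), of "- 1"]] by simp
  have dvd_iff: "[:p:] dvd x \<longleftrightarrow> (\<forall>i. p dvd poly.coeff x i)" for x by (rule const_poly_dvd_iff)
  define good where "good = {x \<in> I. \<not> [:p:] dvd x}"
  show ?thesis
  proof (cases "good = {}")
    case True
    have "0 \<in> I" using mult[OF pI, of 0] by simp
    thus ?thesis using True by (intro bexI[of _ 0]) (auto simp: good_def)
  next
    case False
    define D where "D = (LEAST k. \<exists>x\<in>good. Polynomial.degree x = k)"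
    have "\<exists>x\<in>good. Polynomial.degree x = D"
      unfolding D_def by (rule LeastI_ex) (use False in blast)
    then obtain x where x: "x \<in> good" "Polynomial.degree x = D" by blast
    have min: "D \<le> Polynomial.degree y" if "y \<in> good" for y
      unfolding D_def by (rule Least_le) (use that in blast)
    define c where "c = Polynomial.lead_coeff x"
    have "\<not> p dvd c"
    proof
      assume "p dvd c"
      \<comment> \<open>Otherwise the leading term could be dropped without changing \<open>x\<close> modulo \<open>p\<close>.\<close>
      define y where "y = x - Polynomial.monom c D"
      have pm: "[:p:] dvd Polynomial.monom c D" using \<open>p dvd c\<close> by (simp add: dvd_iff)
      hence "Polynomial.monom c D \<in> I" using pmult by (auto elim!: dvdE simp del: mult_pCons_left)
      hence "y \<in> I" using x diff by (auto simp: y_def good_def)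
      moreover have "\<not> [:p:] dvd y"
        using x(1) pm dvd_add[of "[:p:]" y "Polynomial.monom c D"] by (auto simp: y_def good_def)
      ultimately have "y \<in> good" by (simp add: good_def)
      hence D: "D \<le> Polynomial.degree y" by (rule min)
      have "Polynomial.degree y \<le> D" unfolding y_def using x(2) by (intro degree_diff_le degree_monom_le) auto
      hence "Polynomial.lead_coeff y = poly.coeff y D" using D by simp
      also have "\<dots> = 0" using x(2) by (simp add: y_def c_def)
      finally have "y = 0" by simp
      thus False using \<open>\<not> [:p:] dvd y\<close> by simp
    qed
    then obtain b where b: "p dvd c * b - 1" using exists_inverse_mod_irreducible[OF irr] by blast
    \<comment> \<open>\<open>b x\<close> with its leading coefficient replaced by \<open>1\<close>, to which it is congruent modulo \<open>p\<close>.\<close>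
    define f where "f = Polynomial.smult b x - Polynomial.monom (c * b - 1) D"
    have fI: "f \<in> I"
    proof -
      have "[:p:] dvd Polynomial.monom (c * b - 1) D" using b by (simp add: dvd_iff)
      hence "Polynomial.monom (c * b - 1) D \<in> I" using pmult by (auto elim!: dvdE simp del: mult_pCons_left)
      moreover have "[:b:] * x \<in> I" using x mult by (simp add: good_def del: mult_pCons_left)
      ultimately show ?thesis unfolding f_def using diff by simp
    qed
    have co: "poly.coeff f D = 1" using x(2) by (simp add: f_def c_def mult.commute)
    have "Polynomial.degree f \<le> D"
      unfolding f_def using x(2) by (intro degree_diff_le degree_monom_le) (metis degree_smult_le)
    moreover have "Polynomial.degree f \<ge> D" using co by (intro le_degree) simp
    ultimately have deg: "Polynomial.degree f = D" by simp
    have "\<exists>z. [:p:] dvd y - z * f" if y: "y \<in> I" for y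
    proof -
      obtain z w where zw: "pseudo_divmod y f = (z, w)" by (cases "pseudo_divmod y f")
      have "f \<noteq> 0" using co by auto
      from pseudo_divmod[OF this zw] have yz: "y = f * z + w" and w: "w = 0 \<or> Polynomial.degree w < Polynomial.degree f"
        by (simp_all add: deg co)
      have "w = y - z * f" using yz by (simp add: mult.commute)
      hence "w \<in> I" using diff[OF y mult[OF fI]] by simp
      have "[:p:] dvd w"
      proof (rule ccontr)
        assume "\<not> [:p:] dvd w"
        hence "D \<le> Polynomial.degree w" using \<open>w \<in> I\<close> min by (simp add: good_def)
        thus False using w deg \<open>\<not> [:p:] dvd w\<close> by auto
      qed
      thus ?thesis using \<open>w = y - z * f\<close> by auto
    qed
    thus ?thesis using fI by blast
  qed
qed

context drinfeld_torsion
begin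

text \<open>
  The action of \<open>A[x]\<close> with \<open>x\<close> acting as \<open>\<tau>^k\<close>.
\<close>
definition pact :: "nat \<Rightarrow> 'a poly poly \<Rightarrow> 'a alg_closure \<Rightarrow> 'a alg_closure"
  where "pact k F v = (\<Sum>i\<le>Polynomial.degree F. ph (poly.coeff F i) (frob (k * i) v))"

lemma pact_eq_sum:
  "Polynomial.degree F \<le> N \<Longrightarrow> pact k F v = (\<Sum>i\<le>N. ph (poly.coeff F i) (frob (k * i) v))"
  unfolding pact_def by (rule sum.mono_neutral_left) (auto simp: coeff_eq_0)

lemma pact_add_left: "pact k (F + G) v = pact k F v + pact k G v"
proof -
  define N where "N = max (Polynomial.degree F) (Polynomial.degree G)"
  have "Polynomial.degree (F + G) \<le> N" by (simp add: N_def degree_add_le_max)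
  moreover have "Polynomial.degree F \<le> N" "Polynomial.degree G \<le> N" by (auto simp: N_def)
  ultimately show ?thesis by (simp add: pact_eq_sum[of _ N] phi_add_left sum.distrib)
qed

lemma pact_0 [simp]: "pact k 0 v = 0"
  by (simp add: pact_def)

lemma pact_sum_left: "pact k (\<Sum>i\<in>A. F i) v = (\<Sum>i\<in>A. pact k (F i) v)"
  by (induction A rule: infinite_finite_induct) (simp_all add: pact_add_left)

lemma pact_pCons: "pact k (pCons a F) v = ph a v + pact k F (frob k v)"
proof -
  have "pact k (pCons a F) v = (\<Sum>i\<le>Suc (Polynomial.degree F). ph (poly.coeff (pCons a F) i) (frob (k * i) v))"
    by (rule pact_eq_sum) (rule degree_pCons_le)
  also have "\<dots> = ph a v + pact k F (frob k v)"
    unfolding sum.atMost_Suc_shift by (simp add: pact_def frob_frob add.commute)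
  finally show ?thesis .
qed

lemma pact_monom: "pact k (Polynomial.monom a i) v = ph a (frob (k * i) v)"
proof -
  have "pact k (Polynomial.monom a i) v = (\<Sum>j\<le>i. if j = i then ph a (frob (k * i) v) else 0)"
    unfolding pact_eq_sum[OF degree_monom_le] by (intro sum.cong) auto
  thus ?thesis by simp
qed

lemma pact_one [simp]: "pact k 1 v = v"
  using pact_pCons[of k 1 0 v] by (simp flip: one_pCons)

lemma pact_smult: "pact k (Polynomial.smult a F) v = ph a (pact k F v)"
  by (simp add: pact_eq_sum[OF degree_smult_le] pact_def phi_sum phi_mult)

lemma pact_add: "pact k F (v + w) = pact k F v + pact k F w"
  by (simp add: pact_def frob_add phi_add sum.distrib)

lemma pact_frob: "frob k t = t \<Longrightarrow> pact k F (frob k v) = frob k (pact k F v)"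
  by (simp add: pact_def frob_sum frob_frob add.commute flip: phi_frob)

lemma pact_phi: "frob k t = t \<Longrightarrow> pact k F (ph a v) = ph a (pact k F v)"
  by (simp add: pact_def phi_sum frob_mult_index mult.commute[of a] flip: phi_frob phi_mult)

lemma pact_mult: "frob k t = t \<Longrightarrow> pact k (F * G) v = pact k F (pact k G v)"
  by (induction F arbitrary: v) (simp_all add: pact_add_left pact_smult pact_pCons pact_frob)

lemma pact_tors: "v \<in> tors \<Longrightarrow> pact (r * j) F v \<in> tors"
  unfolding pact_def by (intro tors_sum tors_phi) (simp add: tors_frob_mult mult.assoc)

lemma pi_comb_eq_pact: "pi_comb A v = pact r (\<Sum>i<n. Polynomial.monom (A i) i) v"
  by (simp add: pi_comb_def pact_sum_left pact_monom)

text \<open>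
  \<open>A[x]\<close> acts on the torsion through \<open>\<kappa>[x]\<close>, whose ideals are principal. A vector \<open>v0\<close> with the
  smallest possible annihilator inherits the independence of \<open>1, \<pi>, \<dots>, \<pi>^(n-1)\<close>; so its orbit
  already has the \<open>q^(nd)\<close> elements of the torsion.
\<close>
lemma exists_cyclic_vector:
  obtains v0 where "v0 \<in> tors" "\<And>w. w \<in> tors \<Longrightarrow> \<exists>A. w = pi_comb A v0"
    "\<And>A i. pi_comb A v0 = 0 \<Longrightarrow> i < n \<Longrightarrow> p dvd A i"
proof -
  interpret finite_comm_module "pact r" tors "{x. \<forall>v\<in>tors. pact r x v = 0}"
  proof (unfold_locales, goal_cases)
    case (8 I)
    have "pact r ([:p:] * x) v = 0" if "v \<in> tors" for x v
      using tors_phi[OF that] pact_tors[of v 1 x] that t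
      by (simp add: pact_smult tors_def)
    hence N: "[:p:] dvd x \<Longrightarrow> x \<in> {x. \<forall>v\<in>tors. pact r x v = 0}" for x
      by (auto elim!: dvdE simp del: mult_pCons_left)
    have "\<exists>f\<in>I. \<forall>x\<in>I. \<exists>y. [:p:] dvd x - y * f"
    proof (rule ideal_principal_mod_irreducible[OF irr_p])
      show "[:p:] \<in> I" using 8(1) N[OF dvd_refl] by (rule subsetD)
    qed (fact 8(2), fact 8(3))
    then obtain f where f: "f \<in> I" "\<And>x. x \<in> I \<Longrightarrow> \<exists>y. [:p:] dvd x - y * f" by blast
    show ?case
    proof (intro bexI[OF _ f(1)] ballI)
      fix x assume "x \<in> I"
      then obtain y where "[:p:] dvd x - y * f" using f(2) by blast
      thus "\<exists>y. x - y * f \<in> {x. \<forall>v\<in>tors. pact r x v = 0}" by (intro exI[of _ y]) (rule N)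
    qed
  qed (use pact_tors[of _ 1] in \<open>auto simp: finite_tors tors_add pact_add pact_add_left pact_mult[OF t]\<close>)
  obtain v0 where v0: "v0 \<in> tors" "ann v0 = {x. \<forall>v\<in>tors. pact r x v = 0}"
    using exists_vector_with_minimal_annihilator by blast
  have dvd: "p dvd A i" if A: "pi_comb A v0 = 0" "i < n" for A i
  proof (rule pi_comb_eq_0_imp)
    fix v assume "v \<in> tors"
    have "(\<Sum>i<n. Polynomial.monom (A i) i) \<in> ann v0" using A(1) by (simp add: ann_def pi_comb_eq_pact)
    thus "pi_comb A v = 0" unfolding v0(2) pi_comb_eq_pact using \<open>v \<in> tors\<close> by blast
  qed (rule A(2))
  let ?S = "{..<n} \<rightarrow>\<^sub>E {a :: 'a poly. Polynomial.degree a < d}"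
  have "inj_on (\<lambda>A. pi_comb A v0) ?S"
  proof (rule inj_onI)
    fix A B assume AB: "A \<in> ?S" "B \<in> ?S" "pi_comb A v0 = pi_comb B v0"
    show "A = B"
    proof (rule PiE_ext[OF AB(1,2)])
      fix i assume i: "i \<in> {..<n}"
      have "pi_comb (\<lambda>i. A i - B i) v0 = 0" using AB(3) by (simp add: pi_comb_diff)
      hence "p dvd A i - B i" using dvd i by blast
      moreover have "Polynomial.degree (A i - B i) < d" using AB(1,2) i by (auto intro!: degree_diff_less)
      ultimately show "A i = B i" using dvd_imp_degree_le[of p "A i - B i"] by fastforce
    qed
  qed
  moreover have "(\<lambda>A. pi_comb A v0) ` ?S \<subseteq> tors"
    using v0(1) by (auto simp: pi_comb_def intro!: tors_sum tors_phi tors_frob_mult)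
  moreover have "card ?S = card tors"
    using card_poly_degree_less(2)[OF d_pos, where 'a='a] card_tors
    by (simp add: card_PiE mult.commute flip: power_mult)
  ultimately have "(\<lambda>A. pi_comb A v0) ` ?S = tors"
    using finite_tors by (simp add: card_image card_subset_eq)
  hence "\<exists>A. w = pi_comb A v0" if "w \<in> tors" for w using that by blast
  thus ?thesis using that[OF v0(1)] dvd by blast
qed

end

section \<open>The ring generated by the scalars and a power of Frobenius\<close>

text \<open>
  The torsion with a generator over \<open>\<kappa>[\<pi>]\<close>, and the factorization of \<open>n\<close> that selects \<open>\<pi>^m\<close>.
\<close>
locale drinfeld_code = drinfeld_torsion +
  fixes m s :: nat and v0 :: "'a alg_closure"
  assumes nms: "n = m * s"
    and v0: "v0 \<in> tors" and cyclic: "\<And>w. w \<in> tors \<Longrightarrow> \<exists>A. w = pi_comb A v0"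
    and v0_free: "\<And>A i. pi_comb A v0 = 0 \<Longrightarrow> i < n \<Longrightarrow> p dvd A i"
begin

lemma m_pos: "m \<ge> 1" and s_pos: "s \<ge> 1"
  using nms n_pos by (auto simp: Suc_le_eq)

abbreviation "R0 \<equiv> R0_ring m r n t p"

definition u where "u = (\<lambda>v\<in>tors. frob (r * m) v)"

text \<open>
  \<open>R\<^sub>0\<close> is the image of \<open>A[x]\<close> with \<open>x\<close> acting as \<open>\<pi>^m\<close>; describing it as an image makes sums
  and products of its elements computable.
\<close>
definition R0_elem :: "'a poly poly \<Rightarrow> 'a alg_closure \<Rightarrow> 'a alg_closure"
  where "R0_elem F = (\<lambda>v\<in>tors. pact (r * m) F v)"

lemma frob_rm_t: "frob (r * m) t = t"
  using frob_mult_index[OF t] .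

lemma R0_elem_closed: "R0_elem F \<in> carrier E"
  unfolding R0_elem_def by (rule E_memI) (simp_all add: pact_tors pact_add pact_phi[OF frob_rm_t])

lemma R0_elem_app [simp]: "v \<in> tors \<Longrightarrow> R0_elem F v = pact (r * m) F v"
  by (simp add: R0_elem_def)

lemma u_app [simp]: "v \<in> tors \<Longrightarrow> u v = frob (r * m) v"
  by (simp add: u_def)

lemma scal_app [simp]: "v \<in> tors \<Longrightarrow> scal a v = ph a v"
  by (simp add: scal_def)

lemma R0_elem_const: "R0_elem [:a:] = scal a"
  by (auto simp: R0_elem_def scal_def restrict_def pact_pCons fun_eq_iff)

lemma R0_elem_X: "R0_elem [:0, 1:] = u"
  by (auto simp: R0_elem_def u_def restrict_def pact_pCons fun_eq_iff)

lemma R0_elem_add: "R0_elem F \<oplus>\<^bsub>E\<^esub> R0_elem G = R0_elem (F + G)"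
  by (auto simp: R0_elem_def restrict_def pact_add_left fun_eq_iff)

lemma R0_elem_mult: "R0_elem F \<otimes>\<^bsub>E\<^esub> R0_elem G = R0_elem (F * G)"
  by (auto simp: R0_elem_def compose_def restrict_def pact_mult[OF frob_rm_t] pact_tors fun_eq_iff)

lemma R0_elem_1: "R0_elem 1 = \<one>\<^bsub>E\<^esub>"
  by (auto simp: R0_elem_def restrict_def fun_eq_iff)

lemma R0_elem_0: "R0_elem 0 = \<zero>\<^bsub>E\<^esub>"
  by (auto simp: R0_elem_def restrict_def fun_eq_iff)

lemma R0_elem_minus: "\<ominus>\<^bsub>E\<^esub> R0_elem F = R0_elem (- F)"
proof (rule E.minus_equality)
  show "R0_elem (- F) \<oplus>\<^bsub>E\<^esub> R0_elem F = \<zero>\<^bsub>E\<^esub>" unfolding R0_elem_add by (simp add: R0_elem_0 del: E_simps)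
qed (rule R0_elem_closed)+

lemma carrier_R0: "carrier R0 = range R0_elem"
proof -
  let ?H = "kappa_scalar r n t p ` carrier K \<union> {\<pi> [^]\<^bsub>E\<^esub> m}"
  have H: "?H = range scal \<union> {u}"
    by (auto simp: carrier_residue_ring_poly kappa_scalar_residue_class pi_pow u_def image_iff)
  have "carrier R0 = generate_ring E ?H" by (simp add: R0_ring_def)
  note gen = this[unfolded H]
  show ?thesis unfolding gen
  proof (intro equalityI subsetI)
    fix x assume "x \<in> generate_ring E (range scal \<union> {u})"
    thus "x \<in> range R0_elem"
    proof (induction rule: generate_ring.induct)
      case one
      show ?case unfolding R0_elem_1[symmetric] by (rule rangeI)
    next
      case (incl h)
      thus ?case by (auto simp: R0_elem_const[symmetric] R0_elem_X[symmetric])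
    next
      case (a_inv h)
      then obtain F where "h = R0_elem F" by blast
      thus ?case using R0_elem_minus[of F] by blast
    next
      case (eng_add h1 h2)
      then obtain F G where "h1 = R0_elem F" "h2 = R0_elem G" by blast
      thus ?case unfolding \<open>h1 = _\<close> \<open>h2 = _\<close> R0_elem_add by blast
    next
      case (eng_mult h1 h2)
      then obtain F G where "h1 = R0_elem F" "h2 = R0_elem G" by blast
      thus ?case unfolding \<open>h1 = _\<close> \<open>h2 = _\<close> R0_elem_mult by blast
    qed
  next
    fix x assume "x \<in> range R0_elem"
    then obtain F where x: "x = R0_elem F" by blast
    have "R0_elem F \<in> generate_ring E (range scal \<union> {u})" for F
    proof (induction F)
      case 0
      have "R0_elem 0 = R0_elem [:0:]" by simp
      thus ?case by (simp only: R0_elem_const) (intro generate_ring.incl, simp)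
    next
      case (pCons a F)
      have "pCons a F = [:a:] + [:0, 1:] * F" by simp
      hence eq: "R0_elem (pCons a F) = scal a \<oplus>\<^bsub>E\<^esub> (u \<otimes>\<^bsub>E\<^esub> R0_elem F)"
        by (simp only: R0_elem_const[symmetric] R0_elem_X[symmetric] R0_elem_add R0_elem_mult)
      have "scal a \<in> generate_ring E (range scal \<union> {u})" "u \<in> generate_ring E (range scal \<union> {u})"
        by (rule generate_ring.incl, simp)+
      thus ?case unfolding eq
        by (intro generate_ring.eng_add generate_ring.eng_mult pCons.IH)
    qed
    thus "x \<in> generate_ring E (range scal \<union> {u})" using x by simp
  qed
qed

lemma R0_simps [simp]: "f \<otimes>\<^bsub>R0\<^esub> g = compose tors f g" "\<one>\<^bsub>R0\<^esub> = (\<lambda>v\<in>tors. v)"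
  "\<zero>\<^bsub>R0\<^esub> = (\<lambda>v\<in>tors. 0)" "f \<oplus>\<^bsub>R0\<^esub> g = (\<lambda>v\<in>tors. f v + g v)"
  by (simp_all add: R0_ring_def)

lemma subring_R0: "subring (carrier R0) E"
proof (rule E.subringI)
  show "carrier R0 \<subseteq> carrier E" using R0_elem_closed by (auto simp: carrier_R0)
  show "\<one>\<^bsub>E\<^esub> \<in> carrier R0" unfolding carrier_R0 R0_elem_1[symmetric] by blast
  show "\<ominus>\<^bsub>E\<^esub> h \<in> carrier R0" if "h \<in> carrier R0" for h using that unfolding carrier_R0 by (auto simp: R0_elem_minus)
  show "h1 \<otimes>\<^bsub>E\<^esub> h2 \<in> carrier R0" "h1 \<oplus>\<^bsub>E\<^esub> h2 \<in> carrier R0" if "h1 \<in> carrier R0" "h2 \<in> carrier R0" for h1 h2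
    using that unfolding carrier_R0 by (auto simp: R0_elem_mult R0_elem_add simp del: E_simps)
qed

lemma R0_eq: "R0 = E\<lparr>carrier := carrier R0\<rparr>"
  by (simp add: R0_ring_def)

lemma R0_cring: "cring R0"
proof (rule cring.intro)
  show "ring R0" using E.subring_is_ring[OF subring_R0] R0_eq by simp
next
  show "comm_monoid R0"
  proof (rule comm_monoid.intro)
    show "Group.monoid R0" using E.subring_is_ring[OF subring_R0] R0_eq ring.is_monoid by metis
    show "comm_monoid_axioms R0"
    proof
      fix x y assume "x \<in> carrier R0" "y \<in> carrier R0"
      then obtain F G where "x = R0_elem F" "y = R0_elem G" by (auto simp: carrier_R0)
      thus "x \<otimes>\<^bsub>R0\<^esub> y = y \<otimes>\<^bsub>R0\<^esub> x"
        using R0_elem_mult[of F G] R0_elem_mult[of G F] by (simp add: mult.commute)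
    qed
  qed
qed

sublocale R0: cring R0 by (rule R0_cring)

lemma R0_in_E: "x \<in> carrier R0 \<Longrightarrow> x \<in> carrier E"
  using R0_elem_closed by (auto simp: carrier_R0)

lemma R0_finsum:
  assumes "finite A" "\<And>i. i \<in> A \<Longrightarrow> f i \<in> carrier R0" "v \<in> tors"
  shows "(\<Oplus>\<^bsub>R0\<^esub>i\<in>A. f i) v = (\<Sum>i\<in>A. f i v)"
  using assms(1,2)
proof (induction A rule: finite_induct)
  case (insert x A)
  have "(\<Oplus>\<^bsub>R0\<^esub>i\<in>insert x A. f i) = f x \<oplus>\<^bsub>R0\<^esub> (\<Oplus>\<^bsub>R0\<^esub>i\<in>A. f i)"
    using insert by (intro R0.finsum_insert) auto
  thus ?case using insert assms(3) by simp
qed (use assms(3) in simp)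

lemma u_in_R0: "u \<in> carrier R0"
  using R0_elem_X by (metis carrier_R0 rangeI)

lemma scal_in_R0: "scal a \<in> carrier R0"
  using R0_elem_const by (metis carrier_R0 rangeI)

lemma u_pow: "u [^]\<^bsub>R0\<^esub> (k :: nat) = (\<lambda>v\<in>tors. frob (r * m * k) v)"
proof (induction k)
  case 0
  show ?case by (simp add: restrict_def)
next
  case (Suc k)
  thus ?case by (auto simp: u_def compose_def restrict_def fun_eq_iff frob_frob tors_frob_mult add.commute)
qed

lemma kappa_hom: "kappa_scalar r n t p \<in> ring_hom K R0"
proof (rule ring_hom_memI)
  fix x assume "x \<in> carrier K"
  then obtain a where x: "x = residue_class p a" by (auto simp: carrier_residue_ring_poly)
  show "kappa_scalar r n t p x \<in> carrier R0" by (simp add: x kappa_scalar_residue_class scal_in_R0)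
  fix y assume "y \<in> carrier K"
  then obtain b where y: "y = residue_class p b" by (auto simp: carrier_residue_ring_poly)
  show "kappa_scalar r n t p (x \<otimes>\<^bsub>K\<^esub> y) = kappa_scalar r n t p x \<otimes>\<^bsub>R0\<^esub> kappa_scalar r n t p y"
    by (auto simp: x y residue_class_simps kappa_scalar_residue_class scal_def compose_def restrict_def
        phi_mult tors_phi fun_eq_iff)
  show "kappa_scalar r n t p (x \<oplus>\<^bsub>K\<^esub> y) = kappa_scalar r n t p x \<oplus>\<^bsub>R0\<^esub> kappa_scalar r n t p y"
    by (auto simp: x y residue_class_simps kappa_scalar_residue_class scal_def restrict_def
        phi_add_left fun_eq_iff)
next
  show "kappa_scalar r n t p \<one>\<^bsub>K\<^esub> = \<one>\<^bsub>R0\<^esub>"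
    by (auto simp: residue_class_simps kappa_scalar_residue_class scal_def restrict_def fun_eq_iff)
qed

text \<open>
  By \<open>(\<pi>^m)^s = \<phi>\<^sub>p\<^sub>0\<close>, powers of \<open>\<pi>^m\<close> below \<open>s\<close> suffice.
\<close>
lemma pact_reduce:
  "\<exists>A. \<forall>v. pact (r * m) F v = (\<Sum>l<s. ph (A l) (frob (r * m * l) v))"
proof (induction F)
  case 0
  show ?case by (intro exI[of _ "\<lambda>_. 0"]) simp
next
  case (pCons a F)
  then obtain A where A: "\<And>v. pact (r * m) F v = (\<Sum>l<s. ph (A l) (frob (r * m * l) v))" by blast
  obtain s' where s': "s = Suc s'" using s_pos by (cases s) auto
  have split: "(\<Sum>l<s. f l) = (\<Sum>l<s'. f l) + f s'" "(\<Sum>l<s. f l) = f 0 + (\<Sum>l<s'. f (Suc l))"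
    for f :: "nat \<Rightarrow> 'a alg_closure"
    unfolding s' by (simp, simp only: sum.lessThan_Suc_shift)
  \<comment> \<open>Multiplication by \<open>\<pi>^m\<close> shifts the coefficients; the last one returns to the front with the factor \<open>p0\<close>.\<close>
  define B where "B = (\<lambda>l. if l = 0 then a + A s' * p0 else A (l - 1))"
  have "pact (r * m) (pCons a F) v = (\<Sum>l<s. ph (B l) (frob (r * m * l) v))" for v
  proof -
    have "frob (r * m * s') (frob (r * m) v) = ph p0 v"
      unfolding ph_p0 frob_frob using nms s' by (simp add: algebra_simps)
    hence "pact (r * m) (pCons a F) v =
        ph a v + ((\<Sum>l<s'. ph (A l) (frob (r * m * Suc l) v)) + ph (A s' * p0) v)"
      unfolding pact_pCons A split(1) by (simp add: frob_frob phi_mult add.commute)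
    also have "\<dots> = (\<Sum>l<s. ph (B l) (frob (r * m * l) v))"
      unfolding split(2) by (simp add: B_def phi_add_left)
    finally show ?thesis .
  qed
  thus ?case by blast
qed

text \<open>
  Write \<open>i = j + m l\<close> with \<open>j < m\<close> and \<open>l < s\<close>: an element of \<open>\<kappa>[\<pi>]\<close> is a combination of \<open>\<pi>^j\<close>,
  \<open>j < m\<close>, over \<open>\<kappa>[\<pi>^m]\<close>.
\<close>
lemma pi_comb_split:
  "pi_comb A v = (\<Sum>j<m. \<Sum>l<s. ph (A (j + m * l)) (frob (r * m * l) (frob (r * j) v)))"
proof -
  have "(\<Sum>j<m. \<Sum>l<s. ph (A (j + m * l)) (frob (r * m * l) (frob (r * j) v))) =
      (\<Sum>(j, l)\<in>{..<m} \<times> {..<s}. ph (A (j + m * l)) (frob (r * (j + m * l)) v))"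
    by (simp add: sum.cartesian_product frob_frob algebra_simps)
  also have "\<dots> = (\<Sum>i<n. ph (A i) (frob (r * i) v))"
  proof (rule sum.reindex_bij_witness[where i = "\<lambda>i. (i mod m, i div m)" and j = "\<lambda>(j, l). j + m * l"])
    fix x assume "x \<in> {..<m} \<times> {..<s}"
    then obtain j l where x: "x = (j, l)" "j < m" "l < s" by auto
    show "(case x of (j, l) \<Rightarrow> j + m * l) \<in> {..<n}"
    proof -
      have "j + m * l < m * Suc l" using x by simp
      also have "m * Suc l \<le> m * s" using x by (intro mult_le_mono2) simp
      finally show ?thesis using x nms by simp
    qed
    show "((case x of (j, l) \<Rightarrow> j + m * l) mod m, (case x of (j, l) \<Rightarrow> j + m * l) div m) = x"
      using x by simp
  next
    fix i assume "i \<in> {..<n}"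
    thus "(i mod m, i div m) \<in> {..<m} \<times> {..<s}"
      using m_pos nms by (simp add: less_mult_imp_div_less mult.commute)
  qed auto
  finally show ?thesis by (simp add: pi_comb_def)
qed

text \<open>
  The basis \<open>v\<^sub>0, \<pi> v\<^sub>0, \<dots>, \<pi>^(m-1) v\<^sub>0\<close> of the torsion over \<open>R\<^sub>0\<close>.
\<close>
definition bvec :: "nat \<Rightarrow> 'a alg_closure" where "bvec j = frob (r * j) v0"

lemma bvec_tors [simp]: "bvec j \<in> tors"
  unfolding bvec_def by (rule tors_frob_mult[OF v0])

lemma exists_coordinates:
  assumes "w \<in> tors"
  shows "\<exists>x. (\<forall>j<m. x j \<in> carrier R0) \<and> w = (\<Sum>j<m. x j (bvec j))"
proof -
  obtain A where A: "w = pi_comb A v0" using cyclic[OF assms] by blast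
  define x where "x = (\<lambda>j. R0_elem (\<Sum>l<s. Polynomial.monom (A (j + m * l)) l))"
  have "w = (\<Sum>j<m. x j (bvec j))"
    unfolding A pi_comb_split by (simp add: x_def pact_sum_left pact_monom flip: bvec_def)
  moreover have "x j \<in> carrier R0" for j by (simp add: x_def carrier_R0)
  hence "\<forall>j<m. x j \<in> carrier R0" by simp
  ultimately show ?thesis by (intro exI[of _ x] conjI)
qed

lemma coordinates_zero:
  assumes x: "\<And>j. j < m \<Longrightarrow> x j \<in> carrier R0" and sum: "(\<Sum>j<m. x j (bvec j)) = 0" and j: "j < m"
  shows "x j = \<zero>\<^bsub>R0\<^esub>"
proof -
  have "\<exists>A. \<forall>v\<in>tors. x j v = (\<Sum>l<s. ph (A l) (frob (r * m * l) v))" if jm: "j < m" for j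
  proof -
    obtain F where "x j = R0_elem F" using x[OF jm] by (auto simp: carrier_R0)
    thus ?thesis using pact_reduce[of F] by auto
  qed
  then obtain A where A: "\<And>j v. j < m \<Longrightarrow> v \<in> tors \<Longrightarrow> x j v = (\<Sum>l<s. ph (A j l) (frob (r * m * l) v))"
    by metis
  define B where "B = (\<lambda>i. A (i mod m) (i div m))"
  have B: "B (j + m * l) = A j l" if "j < m" for j l using that by (simp add: B_def)
  have "pi_comb B v0 = (\<Sum>j<m. x j (bvec j))"
    unfolding pi_comb_split by (intro sum.cong refl) (simp add: A B flip: bvec_def)
  hence zero: "pi_comb B v0 = 0" using sum by simp
  have "x j v = 0" if "v \<in> tors" for v
  proof -
    have "ph (A j l) (frob (r * m * l) v) = 0" if l: "l < s" for l
    proof -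
      have "j + m * l < m * Suc l" using j by simp
      also have "m * Suc l \<le> m * s" using l by (intro mult_le_mono2) simp
      finally have "p dvd B (j + m * l)" using zero by (intro v0_free) (simp_all add: nms)
      hence "p dvd A j l - 0" using B[OF j] by simp
      hence "ph (A j l) (frob (r * m * l) v) = ph 0 (frob (r * m * l) v)"
        by (intro phi_eq_on_tors) (simp add: mult.assoc tors_frob_mult \<open>v \<in> tors\<close>)
      thus ?thesis by simp
    qed
    thus ?thesis using A[OF j that] by simp
  qed
  thus ?thesis using x[OF j] R0_in_E E_eqI[of "x j" "\<zero>\<^bsub>R0\<^esub>"] R0.zero_closed by simp
qed

end

context drinfeld_code
begin

text \<open>
  Evaluation of a polynomial over \<open>\<kappa>\<close> at \<open>u = \<pi>^m\<close> is onto \<open>R\<^sub>0\<close>. Its kernel contains \<open>X^s - c\<close>,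
  and division by this monic polynomial leaves a remainder of degree below \<open>s\<close>, which must be
  zero because \<open>1, \<pi>, \<dots>, \<pi>^(n-1)\<close> are independent over \<open>\<kappa>\<close>.
\<close>
lemma R0_isomorphic_binomial_quot:
  "algebra_isomorphic K (kappa_scalar r n t p) R0
     (binomial_quot_const K s (residue_class p p0)) (binomial_quot K s (residue_class p p0))"
proof -
  let ?c = "residue_class p p0" and ?k = "kappa_scalar r n t p" and ?P = "UP K"
  interpret K: field K by (rule residue_ring_poly_field[OF irr_p])
  have Kcring: "cring K" by (rule K.is_cring)
  interpret U: UP_pre_univ_prop K R0 ?k ?P
    by (rule UP_pre_univ_propI[OF Kcring R0_cring kappa_hom]) simp
  define ev where "ev = eval K R0 ?k u"
  have ev_hom: "ev \<in> ring_hom ?P R0" unfolding ev_def by (rule U.eval_ring_hom[OF u_in_R0])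
  interpret P: cring ?P by (rule U.UP_cring)
  interpret ev: ring_hom_cring ?P R0 ev
    by (rule ring_hom_cringI[OF U.UP_cring R0_cring ev_hom])
  have ev_monom: "ev (up_ring.monom ?P (residue_class p a) k) = scal a \<otimes>\<^bsub>R0\<^esub> u [^]\<^bsub>R0\<^esub> k" for a k
    unfolding ev_def by (subst U.eval_monom[OF _ u_in_R0]) (simp_all add: kappa_scalar_residue_class del: R0_simps)
  define b where "b = binomial_poly K s ?c"
  have b_def': "b = up_ring.monom ?P \<one>\<^bsub>K\<^esub> s \<ominus>\<^bsub>?P\<^esub> up_ring.monom ?P ?c 0"
    by (simp add: b_def binomial_poly_def)
  have b_carr: "b \<in> carrier ?P" unfolding b_def' by simp
  have ev_b: "ev b = \<zero>\<^bsub>R0\<^esub>"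
  proof -
    have "scal 1 \<otimes>\<^bsub>R0\<^esub> u [^]\<^bsub>R0\<^esub> s = scal p0 \<otimes>\<^bsub>R0\<^esub> u [^]\<^bsub>R0\<^esub> (0 :: nat)"
    proof -
      have "frob (r * m * s) v = ph p0 v" for v unfolding ph_p0 using nms by (simp add: algebra_simps)
      thus ?thesis
        unfolding u_pow by (auto simp: scal_def compose_def restrict_def fun_eq_iff tors_phi)
    qed
    hence "ev (up_ring.monom ?P (residue_class p 1) s) = ev (up_ring.monom ?P ?c 0)"
      unfolding ev_monom .
    thus ?thesis unfolding b_def' a_minus_def
      by (simp add: residue_class_simps R0.r_neg del: R0_simps)
  qed
  have surj: "ev ` carrier ?P = carrier R0"
  proof (intro equalityI subsetI)
    fix x assume "x \<in> carrier R0"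
    then obtain F where x: "x = R0_elem F" by (auto simp: carrier_R0)
    have "R0_elem F \<in> ev ` carrier ?P" for F
    proof (induction F)
      case 0
      have "R0_elem 0 = ev \<zero>\<^bsub>?P\<^esub>" unfolding ev.hom_zero R0_elem_0 by simp
      moreover have "\<zero>\<^bsub>?P\<^esub> \<in> carrier ?P" by simp
      ultimately show ?case by (simp only: imageI)
    next
      case (pCons a F)
      then obtain f where f: "f \<in> carrier ?P" "R0_elem F = ev f" by blast
      have "pCons a F = [:a:] + [:0, 1:] * F" by simp
      hence "R0_elem (pCons a F) = scal a \<oplus>\<^bsub>R0\<^esub> (u \<otimes>\<^bsub>R0\<^esub> R0_elem F)"
        using R0_elem_add[of "[:a:]" "[:0, 1:] * F"] R0_elem_mult[of "[:0, 1:]" F]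
        by (simp only: R0_elem_const R0_elem_X R0_simps E_simps)
      also have "scal a = ev (up_ring.monom ?P (residue_class p a) 0)"
        unfolding ev_monom using scal_in_R0 by (simp del: R0_simps)
      also have "u = ev (up_ring.monom ?P (residue_class p 1) 1)"
      proof -
        have "scal 1 = \<one>\<^bsub>R0\<^esub>" by (auto simp: scal_def restrict_def fun_eq_iff)
        thus ?thesis unfolding ev_monom using u_in_R0 by (simp del: R0_simps)
      qed
      finally have "R0_elem (pCons a F) = ev (up_ring.monom ?P (residue_class p a) 0 \<oplus>\<^bsub>?P\<^esub>
          up_ring.monom ?P (residue_class p 1) 1 \<otimes>\<^bsub>?P\<^esub> f)"
        using f by (simp del: R0_simps)
      moreover have "up_ring.monom ?P (residue_class p a) 0 \<oplus>\<^bsub>?P\<^esub>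
          up_ring.monom ?P (residue_class p 1) 1 \<otimes>\<^bsub>?P\<^esub> f \<in> carrier ?P" using f by simp
      ultimately show ?case by (simp only: imageI)
    qed
    thus "x \<in> ev ` carrier ?P" by (simp add: x)
  qed auto
  have inj: "f = \<zero>\<^bsub>?P\<^esub>" if f: "f \<in> carrier ?P" "ev f = \<zero>\<^bsub>R0\<^esub>" "deg K f < s" for f
  proof (rule U.up_eqI)
    fix i
    show "up_ring.coeff ?P f i = up_ring.coeff ?P \<zero>\<^bsub>?P\<^esub> i"
    proof (cases "i < s")
      case False
      thus ?thesis using f by (simp add: U.deg_aboveD)
    next
      case True
      have "\<forall>l. \<exists>a. up_ring.coeff ?P f l = residue_class p a"
        using f(1) U.coeff_closed[of f] by (fastforce simp: carrier_residue_ring_poly)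
      then obtain a where a: "\<And>l. up_ring.coeff ?P f l = residue_class p (a l)" by metis
      \<comment> \<open>The polynomial evaluated at \<open>\<pi>^m\<close> is an element of \<open>\<kappa>[\<pi>]\<close> supported on the multiples of \<open>m\<close>.\<close>
      have "pi_comb (\<lambda>i. if i mod m = 0 then a (i div m) else 0) v = 0" if v: "v \<in> tors" for v
      proof -
        have "ev f v = (\<Sum>l\<le>deg K f. (scal (a l) \<otimes>\<^bsub>R0\<^esub> u [^]\<^bsub>R0\<^esub> l) v)"
          unfolding ev_def eval_def restrict_apply'[OF f(1)] using v
          by (subst R0_finsum) (auto simp: a kappa_scalar_residue_class scal_in_R0 u_in_R0 simp del: R0_simps)
        also have "\<dots> = (\<Sum>l\<le>deg K f. ph (a l) (frob (r * m * l) v))"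
          using v by (simp add: u_pow compose_def mult.assoc tors_frob_mult)
        also have "\<dots> = (\<Sum>l<s. ph (a l) (frob (r * m * l) v))"
        proof (rule sum.mono_neutral_left)
          show "\<forall>l\<in>{..<s} - {..deg K f}. ph (a l) (frob (r * m * l) v) = 0"
          proof
            fix l assume "l \<in> {..<s} - {..deg K f}"
            hence "residue_class p (a l) = \<zero>\<^bsub>K\<^esub>" using f(1) U.deg_aboveD[of f l] by (simp add: a)
            hence "p dvd a l - 0" by (simp only: residue_class_zero residue_class_eq_iff)
            hence "ph (a l) (frob (r * m * l) v) = ph 0 (frob (r * m * l) v)"
              by (intro phi_eq_on_tors) (simp add: mult.assoc tors_frob_mult v)
            thus "ph (a l) (frob (r * m * l) v) = 0" by simp
          qed
        qed (use f(3) in auto)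
        also have "\<dots> = pi_comb (\<lambda>i. if i mod m = 0 then a (i div m) else 0) v"
        proof -
          have "(\<Sum>j<m. \<Sum>l<s. ph (if (j + m * l) mod m = 0 then a ((j + m * l) div m) else 0)
              (frob (r * m * l) (frob (r * j) v))) =
            (\<Sum>j<m. if j = 0 then \<Sum>l<s. ph (a l) (frob (r * m * l) v) else 0)"
            by (intro sum.cong refl) auto
          also have "\<dots> = (\<Sum>l<s. ph (a l) (frob (r * m * l) v))" using m_pos by (simp add: sum.delta)
          finally show ?thesis unfolding pi_comb_split by simp
        qed
        finally show ?thesis using f(2) v by simp
      qed
      hence "p dvd (if (m * i) mod m = 0 then a ((m * i) div m) else 0)"
        using True m_pos nms by (intro pi_comb_eq_0_imp) auto
      hence "p dvd a i" using m_pos by simp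
      hence "residue_class p (a i) = residue_class p 0" by (simp add: residue_class_eq_iff)
      thus ?thesis using a[of i] by (simp add: residue_class_zero)
    qed
  qed (use f in simp_all)
  have coeff_b: "up_ring.coeff ?P b i = (if i = s then \<one>\<^bsub>K\<^esub> else \<zero>\<^bsub>K\<^esub>) \<ominus>\<^bsub>K\<^esub> (if i = 0 then ?c else \<zero>\<^bsub>K\<^esub>)" for i
    unfolding b_def' by (simp add: a_minus_def)
  have deg_b: "deg K b = s"
  proof (rule le_antisym)
    show "deg K b \<le> s" by (rule U.deg_aboveI) (use b_carr s_pos in \<open>auto simp: coeff_b a_minus_def\<close>)
    show "s \<le> deg K b" by (rule U.deg_belowI) (use b_carr s_pos in \<open>auto simp: coeff_b a_minus_def\<close>)
  qed
  have lc_b: "up_ring.coeff ?P b (deg K b) = \<one>\<^bsub>K\<^esub>"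
    using s_pos by (simp add: deg_b coeff_b a_minus_def)
  have b0: "b \<noteq> \<zero>\<^bsub>?P\<^esub>"
  proof
    assume b0: "b = \<zero>\<^bsub>?P\<^esub>"
    have "up_ring.coeff ?P \<zero>\<^bsub>?P\<^esub> (deg K \<zero>\<^bsub>?P\<^esub>) = \<zero>\<^bsub>K\<^esub>" by (rule U.coeff_zero)
    thus False using lc_b unfolding b0 using K.one_not_zero by metis
  qed
  have kernel_iff: "f \<in> a_kernel ?P R0 ev \<longleftrightarrow> f \<in> carrier ?P \<and> ev f = \<zero>\<^bsub>R0\<^esub>" for f
    unfolding a_kernel_def' by (rule mem_Collect_eq)
  have ker: "a_kernel ?P R0 ev = PIdl\<^bsub>?P\<^esub> b"
  proof (intro equalityI subsetI)
    fix f assume "f \<in> a_kernel ?P R0 ev"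
    hence f: "f \<in> carrier ?P" "ev f = \<zero>\<^bsub>R0\<^esub>" unfolding kernel_iff by blast+
    obtain g h and k :: nat where gh: "g \<in> carrier ?P" "h \<in> carrier ?P"
      "up_ring.coeff ?P b (deg K b) [^]\<^bsub>K\<^esub> k \<odot>\<^bsub>?P\<^esub> f = b \<otimes>\<^bsub>?P\<^esub> g \<oplus>\<^bsub>?P\<^esub> h"
      "h = \<zero>\<^bsub>?P\<^esub> \<or> deg K h < deg K b"
      using U.long_div_theorem[OF b_carr f(1) b0] by blast
    have "\<one>\<^bsub>K\<^esub> [^]\<^bsub>K\<^esub> k \<odot>\<^bsub>?P\<^esub> f = f" using f(1) by simp
    hence fgh: "f = b \<otimes>\<^bsub>?P\<^esub> g \<oplus>\<^bsub>?P\<^esub> h" using gh(3) unfolding lc_b by (rule trans[OF sym])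
    have bg: "b \<otimes>\<^bsub>?P\<^esub> g \<in> carrier ?P" by (rule U.P.m_closed[OF b_carr gh(1)])
    have "ev f = ev b \<otimes>\<^bsub>R0\<^esub> ev g \<oplus>\<^bsub>R0\<^esub> ev h"
      unfolding fgh ev.hom_add[OF bg gh(2)] ev.hom_mult[OF b_carr gh(1)] ..
    hence "\<zero>\<^bsub>R0\<^esub> = ev h"
      unfolding f(2) ev_b R0.l_null[OF ev.hom_closed[OF gh(1)]] R0.l_zero[OF ev.hom_closed[OF gh(2)]] .
    hence "ev h = \<zero>\<^bsub>R0\<^esub>" by (rule sym)
    hence "h = \<zero>\<^bsub>?P\<^esub>" using inj[OF gh(2)] gh(4) unfolding deg_b by blast
    hence "f = b \<otimes>\<^bsub>?P\<^esub> g" using fgh U.P.r_zero[OF bg] by (simp only:)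
    hence "f = g \<otimes>\<^bsub>?P\<^esub> b" using U.P.m_comm[OF b_carr gh(1)] by (simp only:)
    thus "f \<in> PIdl\<^bsub>?P\<^esub> b" using gh(1) unfolding cgenideal_def by blast
  next
    fix f assume "f \<in> PIdl\<^bsub>?P\<^esub> b"
    then obtain g where g: "g \<in> carrier ?P" "f = g \<otimes>\<^bsub>?P\<^esub> b" unfolding cgenideal_def by blast
    have "ev f = \<zero>\<^bsub>R0\<^esub>"
      unfolding g(2) ev.hom_mult[OF g(1) b_carr] ev_b by (rule R0.r_null[OF ev.hom_closed[OF g(1)]])
    thus "f \<in> a_kernel ?P R0 ev" unfolding kernel_iff using U.P.m_closed[OF g(1) b_carr] g(2) by blast
  qed
  let ?Q = "?P Quot (PIdl\<^bsub>?P\<^esub> b)" and ?h = "\<lambda>Y. the_elem (ev ` Y)"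
  have iso: "?h \<in> ring_iso ?Q R0"
    using ring_hom_ring.FactRing_iso_set[OF ring_hom_ringI2[OF cring.axioms(1)[OF U.UP_cring]
        cring.axioms(1)[OF R0_cring] ev_hom] surj] unfolding ker .
  interpret I: ideal "PIdl\<^bsub>?P\<^esub> b" ?P by (rule cring.cgenideal_ideal[OF U.UP_cring b_carr])
  have iso': "inv_into (carrier ?Q) ?h \<in> ring_iso R0 ?Q"
    by (rule ring_iso_set_sym[OF I.quotient_is_ring iso])
  have "inv_into (carrier ?Q) ?h (?k x) = binomial_quot_const K s ?c x" if x: "x \<in> carrier K" for x
  proof -
    let ?m = "up_ring.monom ?P x 0"
    have mc: "?m \<in> carrier ?P" using x by simp
    have coset: "(PIdl\<^bsub>?P\<^esub> b) +>\<^bsub>?P\<^esub> ?m \<in> carrier ?Q"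
      unfolding FactRing_def A_RCOSETS_def' using mc by auto
    have "?h ((PIdl\<^bsub>?P\<^esub> b) +>\<^bsub>?P\<^esub> ?m) = ev ?m"
    proof (rule the_elem_image_constant)
      show "?m \<in> (PIdl\<^bsub>?P\<^esub> b) +>\<^bsub>?P\<^esub> ?m" by (rule abelian_subgroup.a_rcos_self[OF _ mc], rule abelian_subgroupI3)
        (rule additive_subgroupI, rule I.a_subgroup, rule ring.is_abelian_group, rule cring.axioms(1)[OF U.UP_cring])
      fix y assume "y \<in> (PIdl\<^bsub>?P\<^esub> b) +>\<^bsub>?P\<^esub> ?m"
      then obtain i where i: "i \<in> PIdl\<^bsub>?P\<^esub> b" "y = i \<oplus>\<^bsub>?P\<^esub> ?m" by (auto simp: a_r_coset_def')
      hence i': "i \<in> carrier ?P" "ev i = \<zero>\<^bsub>R0\<^esub>" unfolding ker[symmetric] kernel_iff by blast+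
      show "ev y = ev ?m"
        unfolding i(2) ev.hom_add[OF i'(1) mc] i'(2) by (rule R0.l_zero[OF ev.hom_closed[OF mc]])
    qed
    also have "ev ?m = ?k x"
      unfolding ev_def by (rule U.eval_const[OF u_in_R0 x])
    finally have "?k x = ?h ((PIdl\<^bsub>?P\<^esub> b) +>\<^bsub>?P\<^esub> ?m)" by simp
    moreover have "inj_on ?h (carrier ?Q)" using iso by (simp add: ring_iso_def bij_betw_def)
    ultimately have "inv_into (carrier ?Q) ?h (?k x) = (PIdl\<^bsub>?P\<^esub> b) +>\<^bsub>?P\<^esub> ?m"
      using inv_into_f_f[OF _ coset, of ?h] by simp
    thus ?thesis by (simp add: binomial_quot_const_def b_def)
  qed
  thus ?thesis unfolding algebra_isomorphic_def binomial_quot_def b_def[symmetric]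
    using iso' by blast
qed

end

section \<open>The centralizer as a matrix ring\<close>

context drinfeld_code
begin

abbreviation "R \<equiv> R_ring m r n t p"

lemma R_simps [simp]: "f \<otimes>\<^bsub>R\<^esub> g = compose tors f g" "\<one>\<^bsub>R\<^esub> = (\<lambda>v\<in>tors. v)"
  "\<zero>\<^bsub>R\<^esub> = (\<lambda>v\<in>tors. 0)" "f \<oplus>\<^bsub>R\<^esub> g = (\<lambda>v\<in>tors. f v + g v)"
  by (simp_all add: R_ring_def)

lemma carrier_R: "f \<in> carrier R \<longleftrightarrow>
    f \<in> carrier E \<and> (\<forall>x\<in>carrier R0. \<forall>v\<in>tors. f (x v) = x (f v))"
proof -
  have "compose tors f x = compose tors x f \<longleftrightarrow> (\<forall>v\<in>tors. f (x v) = x (f v))" for x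
    by (auto simp: compose_def restrict_def fun_eq_iff)
  thus ?thesis by (simp add: R_ring_def centralizer_def)
qed

text \<open>
  The coordinates of a vector with respect to \<open>v\<^sub>0, \<dots>, \<pi>^(m-1) v\<^sub>0\<close> over \<open>R\<^sub>0\<close>.
\<close>
definition coord :: "'a alg_closure \<Rightarrow> nat \<Rightarrow> 'a alg_closure \<Rightarrow> 'a alg_closure"
  where "coord w = (SOME x. (\<forall>j<m. x j \<in> carrier R0) \<and> w = (\<Sum>j<m. x j (bvec j)))"

lemma coord: "w \<in> tors \<Longrightarrow> j < m \<Longrightarrow> coord w j \<in> carrier R0" "w \<in> tors \<Longrightarrow> w = (\<Sum>j<m. coord w j (bvec j))"
  using someI_ex[OF exists_coordinates[of w]] by (auto simp: coord_def)

lemma R0_closed_tors: "x \<in> carrier R0 \<Longrightarrow> v \<in> tors \<Longrightarrow> x v \<in> tors"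
  using E_closed R0_in_E by blast

lemma coord_closed: "w \<in> tors \<Longrightarrow> j < m \<Longrightarrow> v \<in> tors \<Longrightarrow> coord w j v \<in> tors"
  using R0_closed_tors coord(1) by blast

lemma R0_minus_app: "x \<in> carrier R0 \<Longrightarrow> y \<in> carrier R0 \<Longrightarrow> v \<in> tors \<Longrightarrow> (x \<ominus>\<^bsub>R0\<^esub> y) v = x v - y v"
proof -
  assume *: "x \<in> carrier R0" "y \<in> carrier R0" "v \<in> tors"
  have "(x \<ominus>\<^bsub>R0\<^esub> y) \<oplus>\<^bsub>R0\<^esub> y = x" using * by (simp add: a_minus_def R0.a_assoc R0.l_neg del: R0_simps)
  from fun_cong[OF this, of v] show ?thesis using *(3) by (simp add: algebra_simps)
qed

lemma coord_unique:
  assumes "w \<in> tors" "\<And>j. j < m \<Longrightarrow> x j \<in> carrier R0" "w = (\<Sum>j<m. x j (bvec j))" "j < m"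
  shows "coord w j = x j"
proof -
  have "coord w j \<ominus>\<^bsub>R0\<^esub> x j = \<zero>\<^bsub>R0\<^esub>"
  proof (rule coordinates_zero[where x = "\<lambda>j. coord w j \<ominus>\<^bsub>R0\<^esub> x j"])
    have "(\<Sum>j<m. (coord w j \<ominus>\<^bsub>R0\<^esub> x j) (bvec j)) = (\<Sum>j<m. coord w j (bvec j)) - (\<Sum>j<m. x j (bvec j))"
      unfolding sum_subtractf[symmetric] using coord(1)[OF assms(1)] assms(2)
      by (intro sum.cong refl R0_minus_app) auto
    thus "(\<Sum>j<m. (coord w j \<ominus>\<^bsub>R0\<^esub> x j) (bvec j)) = 0"
      using coord(2)[OF assms(1)] assms(3) by simp
  qed (use coord(1)[OF assms(1)] assms(2,4) in \<open>auto simp del: R0_simps\<close>)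
  thus ?thesis using coord(1)[OF assms(1,4)] assms(2)[OF assms(4)]
    by (simp add: R0.r_right_minus_eq del: R0_simps)
qed

lemma R0_app_sum: "x \<in> carrier R0 \<Longrightarrow> (\<And>i. i \<in> A \<Longrightarrow> g i \<in> tors) \<Longrightarrow> x (\<Sum>i\<in>A. g i) = (\<Sum>i\<in>A. x (g i))"
  using E_sum R0_in_E by blast

lemma R0_comm_app: "x \<in> carrier R0 \<Longrightarrow> y \<in> carrier R0 \<Longrightarrow> v \<in> tors \<Longrightarrow> x (y v) = y (x v)"
  using fun_cong[OF R0.m_comm[of x y], of v] by (simp add: compose_def)

lemma coord_add: "v \<in> tors \<Longrightarrow> w \<in> tors \<Longrightarrow> j < m \<Longrightarrow> coord (v + w) j = coord v j \<oplus>\<^bsub>R0\<^esub> coord w j"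
proof (rule coord_unique)
  assume *: "v \<in> tors" "w \<in> tors"
  show "v + w \<in> tors" using * by (rule tors_add)
  have "(\<Sum>j<m. (coord v j \<oplus>\<^bsub>R0\<^esub> coord w j) (bvec j)) = (\<Sum>j<m. coord v j (bvec j)) + (\<Sum>j<m. coord w j (bvec j))"
    by (simp add: sum.distrib)
  thus "v + w = (\<Sum>j<m. (coord v j \<oplus>\<^bsub>R0\<^esub> coord w j) (bvec j))"
    using coord(2)[OF *(1)] coord(2)[OF *(2)] by (simp only:)
qed (use coord(1) in \<open>auto simp del: R0_simps\<close>)

lemma coord_scale: "x \<in> carrier R0 \<Longrightarrow> w \<in> tors \<Longrightarrow> j < m \<Longrightarrow> coord (x w) j = x \<otimes>\<^bsub>R0\<^esub> coord w j"
proof (rule coord_unique)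
  assume *: "x \<in> carrier R0" "w \<in> tors"
  show "x w \<in> tors" using * by (rule R0_closed_tors)
  have "x w = x (\<Sum>j<m. coord w j (bvec j))" by (rule arg_cong[OF coord(2)[OF *(2)]])
  also have "\<dots> = (\<Sum>j<m. x (coord w j (bvec j)))"
    by (rule R0_app_sum[OF *(1)]) (simp add: coord_closed *(2))
  finally show "x w = (\<Sum>j<m. (x \<otimes>\<^bsub>R0\<^esub> coord w j) (bvec j))" by (simp add: compose_def)
qed (use coord(1) in \<open>auto simp del: R0_simps\<close>)

lemma coord_bvec: "i < m \<Longrightarrow> j < m \<Longrightarrow> coord (bvec j) i = (if i = j then \<one>\<^bsub>R0\<^esub> else \<zero>\<^bsub>R0\<^esub>)"
proof (rule coord_unique)
  assume "j < m"
  have "(\<Sum>i<m. (if i = j then \<one>\<^bsub>R0\<^esub> else \<zero>\<^bsub>R0\<^esub>) (bvec i)) = (\<Sum>i<m. if i = j then bvec j else 0)"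
    by (intro sum.cong) auto
  thus "bvec j = (\<Sum>i<m. (if i = j then \<one>\<^bsub>R0\<^esub> else \<zero>\<^bsub>R0\<^esub>) (bvec i))" using \<open>j < m\<close> by simp
qed (auto simp del: R0_simps)

text \<open>
  The matrix of an \<open>R\<^sub>0\<close>-linear map. As \<open>R\<^sub>0\<close> is commutative, composition becomes the matrix
  product without reversal.
\<close>
definition to_mat :: "('a alg_closure \<Rightarrow> 'a alg_closure) \<Rightarrow> nat \<times> nat \<Rightarrow> 'a alg_closure \<Rightarrow> 'a alg_closure"
  where "to_mat f = restrict (\<lambda>(i, j). coord (f (bvec j)) i) ({..<m} \<times> {..<m})"

abbreviation "Mat \<equiv> mat_ring m R0"

lemma to_mat_app: "i < m \<Longrightarrow> j < m \<Longrightarrow> to_mat f (i, j) = coord (f (bvec j)) i"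
  by (simp add: to_mat_def)

lemma R_in_E: "f \<in> carrier R \<Longrightarrow> f \<in> carrier E"
  by (simp add: carrier_R)

lemma R_app_expand:
  assumes "f \<in> carrier R" "w \<in> tors"
  shows "f w = (\<Sum>j<m. coord w j (f (bvec j)))"
proof -
  have "f w = f (\<Sum>j<m. coord w j (bvec j))" by (rule arg_cong[OF coord(2)[OF assms(2)]])
  also have "\<dots> = (\<Sum>j<m. f (coord w j (bvec j)))"
    by (rule E_sum[OF R_in_E[OF assms(1)]]) (simp add: coord_closed assms(2))
  also have "\<dots> = (\<Sum>j<m. coord w j (f (bvec j)))"
    using assms(1) coord(1)[OF assms(2)] by (intro sum.cong refl) (auto simp: carrier_R)
  finally show ?thesis .
qed

lemma to_mat_iso: "to_mat \<in> ring_iso R Mat"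
proof -
  have closed: "to_mat f \<in> carrier Mat" if f: "f \<in> carrier R" for f
    using coord(1)[OF E_closed[OF R_in_E[OF f]]] by (auto simp: to_mat_def mat_ring_def)
  have mult: "to_mat (f \<otimes>\<^bsub>R\<^esub> g) = to_mat f \<otimes>\<^bsub>Mat\<^esub> to_mat g" if f: "f \<in> carrier R" and g: "g \<in> carrier R" for f g
  proof -
    have fv: "f (bvec k) \<in> tors" and gv: "g (bvec k) \<in> tors" for k
      using E_closed[OF R_in_E[OF f]] E_closed[OF R_in_E[OF g]] by auto
    have entry: "coord (compose tors f g (bvec j)) i = (\<Oplus>\<^bsub>R0\<^esub>k\<in>{..<m}. coord (f (bvec k)) i \<otimes>\<^bsub>R0\<^esub> coord (g (bvec j)) k)"
      if ij: "i < m" "j < m" for i j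
    proof (rule coord_unique[OF _ _ _ ij(1)])
      have "compose tors f g (bvec j) = (\<Sum>k<m. coord (g (bvec j)) k (f (bvec k)))"
        using R_app_expand[OF f gv[of j]] by (simp add: compose_def)
      also have "\<dots> = (\<Sum>k<m. \<Sum>i<m. coord (g (bvec j)) k (coord (f (bvec k)) i (bvec i)))"
      proof (rule sum.cong[OF refl])
        fix k assume "k \<in> {..<m}"
        hence "coord (g (bvec j)) k (\<Sum>i<m. coord (f (bvec k)) i (bvec i)) = (\<Sum>i<m. coord (g (bvec j)) k (coord (f (bvec k)) i (bvec i)))"
          by (intro R0_app_sum coord(1)[OF gv]) (simp_all add: coord_closed fv)
        thus "coord (g (bvec j)) k (f (bvec k)) = (\<Sum>i<m. coord (g (bvec j)) k (coord (f (bvec k)) i (bvec i)))"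
          by (rule trans[OF arg_cong[OF coord(2)[OF fv[of k]]]])
      qed
      also have "\<dots> = (\<Sum>i<m. \<Sum>k<m. coord (g (bvec j)) k (coord (f (bvec k)) i (bvec i)))" by (rule sum.swap)
      also have "\<dots> = (\<Sum>i<m. \<Sum>k<m. (coord (f (bvec k)) i \<otimes>\<^bsub>R0\<^esub> coord (g (bvec j)) k) (bvec i))"
        using coord(1)[OF gv] coord(1)[OF fv] by (intro sum.cong refl) (auto simp: compose_def R0_comm_app)
      also have "\<dots> = (\<Sum>i<m. (\<Oplus>\<^bsub>R0\<^esub>k\<in>{..<m}. coord (f (bvec k)) i \<otimes>\<^bsub>R0\<^esub> coord (g (bvec j)) k) (bvec i))"
        using coord(1)[OF gv] coord(1)[OF fv]
        by (intro sum.cong refl, subst R0_finsum) (auto intro!: R0.m_closed simp del: R0_simps)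
      finally show "compose tors f g (bvec j) =
          (\<Sum>i<m. (\<Oplus>\<^bsub>R0\<^esub>k\<in>{..<m}. coord (f (bvec k)) i \<otimes>\<^bsub>R0\<^esub> coord (g (bvec j)) k) (bvec i))" .
      show "compose tors f g (bvec j) \<in> tors"
        using E_closed[OF R_in_E[OF f] gv[of j]] by (simp add: compose_def)
    qed (use coord(1)[OF gv] coord(1)[OF fv] in \<open>auto intro!: R0.finsum_closed R0.m_closed simp del: R0_simps\<close>)
    have "to_mat f \<otimes>\<^bsub>Mat\<^esub> to_mat g =
        restrict (\<lambda>(i, j). \<Oplus>\<^bsub>R0\<^esub>k\<in>{..<m}. to_mat f (i, k) \<otimes>\<^bsub>R0\<^esub> to_mat g (k, j)) ({..<m} \<times> {..<m})"
      by (simp only: mat_ring_def monoid.simps)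
    also have "\<dots> = to_mat (compose tors f g)"
      unfolding to_mat_def[of "compose tors f g"]
    proof (rule restrict_ext)
      fix x assume "x \<in> {..<m} \<times> {..<m}"
      then obtain i j where x: "x = (i, j)" and ij: "i < m" "j < m" by blast
      have "(\<Oplus>\<^bsub>R0\<^esub>k\<in>{..<m}. to_mat f (i, k) \<otimes>\<^bsub>R0\<^esub> to_mat g (k, j)) =
          (\<Oplus>\<^bsub>R0\<^esub>k\<in>{..<m}. coord (f (bvec k)) i \<otimes>\<^bsub>R0\<^esub> coord (g (bvec j)) k)"
        by (rule R0.finsum_cong')
          (use coord(1)[OF gv] coord(1)[OF fv] ij in \<open>auto simp: to_mat_app simp del: R0_simps intro!: R0.m_closed\<close>)
      thus "(case x of (i, j) \<Rightarrow> \<Oplus>\<^bsub>R0\<^esub>k\<in>{..<m}. to_mat f (i, k) \<otimes>\<^bsub>R0\<^esub> to_mat g (k, j)) =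
          (case x of (i, j) \<Rightarrow> coord (compose tors f g (bvec j)) i)"
        unfolding x prod.case entry[OF ij] .
    qed
    finally show ?thesis by (simp only: R_simps(1))
  qed
  have add: "to_mat (f \<oplus>\<^bsub>R\<^esub> g) = to_mat f \<oplus>\<^bsub>Mat\<^esub> to_mat g" if f: "f \<in> carrier R" and g: "g \<in> carrier R" for f g
  proof -
    have "f (bvec k) \<in> tors" "g (bvec k) \<in> tors" for k
      using E_closed[OF R_in_E[OF f]] E_closed[OF R_in_E[OF g]] by auto
    hence "to_mat (f \<oplus>\<^bsub>R\<^esub> g) x = (\<lambda>x\<in>{..<m} \<times> {..<m}. to_mat f x \<oplus>\<^bsub>R0\<^esub> to_mat g x) x" for x
      by (cases x) (simp add: to_mat_def coord_add del: R0_simps)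
    thus ?thesis unfolding mat_ring_def ring_record_simps by (rule ext)
  qed
  have one: "to_mat \<one>\<^bsub>R\<^esub> = \<one>\<^bsub>Mat\<^esub>"
    unfolding mat_ring_def to_mat_def monoid.simps
    by (rule restrict_ext) (auto simp: coord_bvec simp del: R0_simps)
  have inj: "inj_on to_mat (carrier R)"
  proof (rule inj_onI)
    fix f g assume f: "f \<in> carrier R" and g: "g \<in> carrier R" and eq: "to_mat f = to_mat g"
    have "f (bvec j) = g (bvec j)" if j: "j < m" for j
    proof -
      have "f (bvec j) \<in> tors" "g (bvec j) \<in> tors"
        using E_closed[OF R_in_E[OF f]] E_closed[OF R_in_E[OF g]] by auto
      moreover have "coord (f (bvec j)) i = coord (g (bvec j)) i" if "i < m" for i
        using fun_cong[OF eq, of "(i, j)"] that j by (simp add: to_mat_app)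
      hence "(\<Sum>i<m. coord (f (bvec j)) i (bvec i)) = (\<Sum>i<m. coord (g (bvec j)) i (bvec i))" by simp
      ultimately show ?thesis using coord(2) by metis
    qed
    hence "f w = g w" if "w \<in> tors" for w
      unfolding R_app_expand[OF f that] R_app_expand[OF g that] by simp
    thus "f = g" using R_in_E f g by (intro E_eqI) auto
  qed
  have surj: "N \<in> to_mat ` carrier R" if N: "N \<in> carrier Mat" for N
  proof -
    have N': "N (i, j) \<in> carrier R0" if "i < m" "j < m" for i j using N that by (auto simp: mat_ring_def)
    define f where "f = (\<lambda>w\<in>tors. \<Sum>j<m. \<Sum>i<m. coord w j (N (i, j) (bvec i)))"
    have Nt: "N (i, j) (bvec i) \<in> tors" if "i < m" "j < m" for i j
      using N'[OF that] by (rule R0_closed_tors) simp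
    have "f \<in> carrier E" unfolding f_def
    proof (rule E_memI)
      fix w assume w: "w \<in> tors"
      show "(\<Sum>j<m. \<Sum>i<m. coord w j (N (i, j) (bvec i))) \<in> tors"
        by (intro tors_sum coord_closed[OF w] Nt) auto
      fix a
      have sa: "scal a w = ph a w" using w by simp
      have "(\<Sum>j<m. \<Sum>i<m. coord (ph a w) j (N (i, j) (bvec i))) = (\<Sum>j<m. \<Sum>i<m. ph a (coord w j (N (i, j) (bvec i))))"
      proof (intro sum.cong refl)
        fix j i assume "j \<in> {..<m}" "i \<in> {..<m}"
        hence ij: "j < m" "i < m" by auto
        have "coord (ph a w) j = scal a \<otimes>\<^bsub>R0\<^esub> coord w j"
          using coord_scale[OF scal_in_R0 w ij(1), of a] unfolding sa .
        thus "coord (ph a w) j (N (i, j) (bvec i)) = ph a (coord w j (N (i, j) (bvec i)))"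
          using Nt[OF ij(2,1)] R0_closed_tors[OF coord(1)[OF w ij(1)]] by (simp add: compose_def)
      qed
      thus "(\<Sum>j<m. \<Sum>i<m. coord (ph a w) j (N (i, j) (bvec i))) = ph a (\<Sum>j<m. \<Sum>i<m. coord w j (N (i, j) (bvec i)))"
        by (simp add: phi_sum)
    next
      fix v w assume "v \<in> tors" "w \<in> tors"
      thus "(\<Sum>j<m. \<Sum>i<m. coord (v + w) j (N (i, j) (bvec i))) =
          (\<Sum>j<m. \<Sum>i<m. coord v j (N (i, j) (bvec i))) + (\<Sum>j<m. \<Sum>i<m. coord w j (N (i, j) (bvec i)))"
        unfolding sum.distrib[symmetric] using Nt by (intro sum.cong refl) (auto simp: coord_add)
    qed
    moreover have "f (x v) = x (f v)" if x: "x \<in> carrier R0" and v: "v \<in> tors" for x v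
    proof -
      have "f (x v) = (\<Sum>j<m. \<Sum>i<m. x (coord v j (N (i, j) (bvec i))))"
        unfolding f_def restrict_apply'[OF R0_closed_tors[OF x v]] using Nt
        by (intro sum.cong refl) (auto simp: coord_scale[OF x v] compose_def)
      also have "\<dots> = (\<Sum>j<m. x (\<Sum>i<m. coord v j (N (i, j) (bvec i))))"
        by (intro sum.cong refl R0_app_sum[OF x, symmetric] coord_closed[OF v] Nt) auto
      also have "\<dots> = x (f v)"
        unfolding f_def restrict_apply'[OF v]
        by (intro R0_app_sum[OF x, symmetric] tors_sum coord_closed[OF v] Nt) auto
      finally show ?thesis .
    qed
    ultimately have fR: "f \<in> carrier R" by (simp add: carrier_R)
    have fv: "f (bvec j) = (\<Sum>i<m. N (i, j) (bvec i))" if j: "j < m" for j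
    proof -
      have "f (bvec j) = (\<Sum>k<m. \<Sum>i<m. if k = j then N (i, j) (bvec i) else 0)"
        unfolding f_def restrict_apply'[OF bvec_tors] using j Nt
        by (intro sum.cong refl) (auto simp: coord_bvec)
      also have "\<dots> = (\<Sum>i<m. \<Sum>k<m. if k = j then N (i, j) (bvec i) else 0)" by (rule sum.swap)
      also have "\<dots> = (\<Sum>i<m. N (i, j) (bvec i))" using j by simp
      finally show ?thesis .
    qed
    have "to_mat f = N"
    proof
      fix x
      show "to_mat f x = N x"
      proof (cases "x \<in> {..<m} \<times> {..<m}")
        case False
        hence "N x = undefined" using N by (intro PiE_arb) (auto simp: mat_ring_def)
        moreover have "to_mat f x = undefined" using False by (simp only: to_mat_def restrict_def if_False)
        ultimately show ?thesis by simp
      next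
        case True
        then obtain i j where x: "x = (i, j)" "i < m" "j < m" by auto
        have "coord (f (bvec j)) i = N (i, j)"
        proof (rule coord_unique[where x = "\<lambda>i. N (i, j)", OF _ _ fv[OF x(3)] x(2)])
          show "f (bvec j) \<in> tors" by (rule E_closed[OF R_in_E[OF fR]]) simp
        qed (use N' x in auto)
        thus ?thesis using x by (simp add: to_mat_app)
      qed
    qed
    thus ?thesis using fR by blast
  qed
  show ?thesis
    unfolding ring_iso_def ring_hom_def bij_betw_def
    using closed mult add one inj surj by (auto simp del: R_simps)
qed

text \<open>
  Scalars of \<open>\<kappa>\<close> lie in \<open>R\<^sub>0\<close> and therefore go to scalar matrices.
\<close>
lemma R_isomorphic_matrix_ring:
  "algebra_isomorphic K (kappa_scalar r n t p) R
     (\<lambda>x. scalar_mat m R0 (kappa_scalar r n t p x)) Mat"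
  unfolding algebra_isomorphic_def
proof (rule bexI[OF _ to_mat_iso], rule ballI)
  fix x assume "x \<in> carrier K"
  then obtain a where x: "x = residue_class p a" by (auto simp: carrier_residue_ring_poly)
  have "coord (scal a (bvec j)) i = (if i = j then scal a else \<zero>\<^bsub>R0\<^esub>)" if ij: "i < m" "j < m" for i j
    unfolding coord_scale[OF scal_in_R0 bvec_tors ij(1)] coord_bvec[OF ij] using scal_in_R0 by (simp del: R0_simps)
  thus "to_mat (kappa_scalar r n t p x) = scalar_mat m R0 (kappa_scalar r n t p x)"
    unfolding x kappa_scalar_residue_class to_mat_def scalar_mat_def
    by (auto simp: restrict_def fun_eq_iff simp del: R0_simps scal_app)
qed

end

section \<open>Conjugation by Frobenius on the ring K\<close>

lemma frobenius_poly_add: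
  fixes F G :: "'a::finite_field alg_closure poly"
  shows "(F + G) ^ (CARD('a) ^ e) = F ^ (CARD('a) ^ e) + G ^ (CARD('a) ^ e)"
proof (induction e arbitrary: F G)
  case (Suc e)
  let ?q = "CARD('a)"
  have q: "?q > 1" by (rule card_field_gt_1)
  have bin: "(of_nat (?q choose i) :: 'a alg_closure poly) = 0" if "0 < i" "i < ?q" for i
    using of_nat_binomial_card_eq_0[OF that] by (simp add: of_nat_poly)
  have "(F + G) ^ ?q = (\<Sum>i\<le>?q. of_nat (?q choose i) * F ^ i * G ^ (?q - i))" by (rule binomial_ring)
  also have "\<dots> = (\<Sum>i\<in>{0, ?q}. of_nat (?q choose i) * F ^ i * G ^ (?q - i))"
    by (rule sum.mono_neutral_right) (use bin in \<open>auto simp: order_le_less\<close>)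
  also have "\<dots> = F ^ ?q + G ^ ?q" using q by simp
  finally show ?case by (simp add: power_mult Suc.IH)
qed simp

lemma frob_cong:
  assumes "[a = b] (mod k)" "frob k x = x"
  shows "frob a x = frob b x"
proof -
  have "frob c x = frob (c mod k) x" for c
  proof -
    have "frob c x = frob (c mod k + k * (c div k)) x" by simp
    also have "\<dots> = frob (c mod k) (frob (k * (c div k)) x)" by (simp only: frob_frob)
    finally show ?thesis by (simp add: frob_mult_index[OF assms(2)])
  qed
  thus ?thesis using assms(1) unfolding cong_def by metis
qed

lemma star_zero_right [simp]: "star n t G 0 = 0"
  by (induction G) (simp_all add: star_pCons)

lemma star_add_right: "star n t G (v + w) = star n t G v + star n t G w"
  by (induction G arbitrary: v w) (simp_all add: star_pCons Phi_add algebra_simps)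

lemma star_Phi:
  "(\<And>i. frob n (poly.coeff G i) = poly.coeff G i) \<Longrightarrow> star n t G (Phi n t v) = Phi n t (star n t G v)"
proof (induction G arbitrary: v)
  case (pCons c G)
  have "frob n c = c" "\<And>i. frob n (poly.coeff G i) = poly.coeff G i"
    using pCons.prems[of 0] pCons.prems[of "Suc _"] by simp_all
  thus ?case by (simp add: star_pCons Phi_add Phi_scale pCons.IH)
qed simp

text \<open>
  Coefficients fixed by \<open>\<tau>^n\<close> commute with \<open>\<phi>\<^sub>T\<close>, so for such polynomials the action is
  multiplicative. In particular they commute with every \<open>\<phi>\<^sub>a\<close> and preserve the torsion.
\<close>
lemma star_mult:
  assumes "\<And>i. frob n (poly.coeff H i) = poly.coeff H i"
  shows "star n t (G * H) v = star n t G (star n t H v)"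
proof (induction G arbitrary: v)
  case (pCons c G)
  thus ?case by (simp add: star_add star_smult star_pCons star_Phi[OF assms])
qed simp

lemma star_frob:
  assumes "frob r t = t"
  shows "frob r (star n t G v) = star n t (map_poly (frob r) G) (frob r v)"
  by (induction G arbitrary: v)
    (simp_all add: star_pCons map_poly_pCons frob_add frob_mult Phi_frob[OF assms] flip: Phi_frob[OF assms])

lemma star_monom: "star n t (Polynomial.monom c k) v = c * (Phi n t ^^ k) v"
proof -
  have "star n t (Polynomial.monom c k) v = (\<Sum>i\<le>k. poly.coeff (Polynomial.monom c k) i * (Phi n t ^^ i) v)"
    by (rule star_eq_sum) (rule degree_monom_le)
  also have "\<dots> = (\<Sum>i\<le>k. if i = k then c * (Phi n t ^^ k) v else 0)" by (intro sum.cong) auto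
  finally show ?thesis by simp
qed

lemma star_sum: "star n t (\<Sum>i\<in>A. f i) v = (\<Sum>i\<in>A. star n t (f i) v)"
  by (induction A rule: infinite_finite_induct) (simp_all add: star_add)

text \<open>
  Fermat's theorem in the residue field with \<open>q^d\<close> elements, iterated \<open>e / d\<close> times.
\<close>
lemma irreducible_dvd_power_card_minus:
  fixes p :: "'a::finite_field poly"
  assumes irr: "Factorial_Ring.irreducible p" and e: "Polynomial.degree p dvd e"
  shows "p dvd a ^ (CARD('a) ^ e) - a"
proof -
  let ?K = "residue_ring_poly p" and ?d = "Polynomial.degree p"
  interpret K: field ?K by (rule residue_ring_poly_field[OF irr])
  have card: "card (carrier ?K) = CARD('a) ^ ?d" and fin: "finite (carrier ?K)"
    using card_residue_ring_poly[OF irreducible_degree_pos[OF irr]] by simp_all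
  have step: "p dvd a ^ (CARD('a) ^ ?d) - a" for a
  proof (cases "p dvd a")
    case True
    moreover have "CARD('a) ^ ?d > 0" by simp
    ultimately show ?thesis by (intro dvd_diff) (auto intro: dvd_trans dvd_power)
  next
    case False
    hence "residue_class p a \<noteq> \<zero>\<^bsub>?K\<^esub>" by (simp add: residue_class_zero residue_class_eq_iff)
    hence a: "residue_class p a \<in> carrier (Multiplicative_Group.mult_of ?K)"
      by (simp add: residue_class_in_carrier)
    have "residue_class p a [^]\<^bsub>?K\<^esub> (CARD('a) ^ ?d - 1) = \<one>\<^bsub>?K\<^esub>"
      using group.pow_order_eq_1[OF K.field_mult_group a] K.order_mult_of[OF fin] card
      by (simp add: Coset.order_def Multiplicative_Group.nat_pow_mult_of)
    hence "p dvd a ^ (CARD('a) ^ ?d - 1) - 1"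
      by (simp add: residue_class_pow residue_class_simps residue_class_eq_iff)
    hence "p dvd a * (a ^ (CARD('a) ^ ?d - 1) - 1)" by (rule dvd_mult)
    also have "a * (a ^ (CARD('a) ^ ?d - 1) - 1) = a ^ (CARD('a) ^ ?d) - a"
      by (simp add: right_diff_distrib power_eq_if[of a "CARD('a) ^ ?d"])
    finally show ?thesis .
  qed
  from e obtain k where "e = ?d * k" ..
  have "p dvd a ^ (CARD('a) ^ (?d * k)) - a" for k
  proof (induction k)
    case (Suc k)
    have "a ^ (CARD('a) ^ (?d * Suc k)) = (a ^ (CARD('a) ^ (?d * k))) ^ (CARD('a) ^ ?d)"
      by (simp add: power_add mult.commute flip: power_mult)
    thus ?case using dvd_add[OF step[of "a ^ (CARD('a) ^ (?d * k))"] Suc] by simp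
  qed simp
  thus ?thesis using \<open>e = _\<close> by simp
qed

context drinfeld_code
begin

abbreviation "KR \<equiv> K_ring m r n t p"

lemma KR_simps: "f \<otimes>\<^bsub>KR\<^esub> g = compose tors f g" "\<one>\<^bsub>KR\<^esub> = (\<lambda>v\<in>tors. v)"
  "f \<oplus>\<^bsub>KR\<^esub> g = (\<lambda>v\<in>tors. f v + g v)"
  by (simp_all add: K_ring_def)

text \<open>
  The action of \<open>\<Sum> g\<^sub>i T^i\<close> on the torsion, for coefficients in \<open>L = GF(q^m)\<close> an element of \<open>K\<close>.
\<close>
definition K_elem :: "'a alg_closure poly \<Rightarrow> 'a alg_closure \<Rightarrow> 'a alg_closure"
  where "K_elem G = (\<lambda>v\<in>tors. star n t G v)"

definition Lpolys :: "'a alg_closure poly set"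
  where "Lpolys = {G. \<forall>i. frob m (poly.coeff G i) = poly.coeff G i}"

lemma Lpolys_fixed: "G \<in> Lpolys \<Longrightarrow> frob n (poly.coeff G i) = poly.coeff G i"
  unfolding nms by (rule frob_mult_index) (simp add: Lpolys_def)

lemma Lpolys_mult: "G \<in> Lpolys \<Longrightarrow> H \<in> Lpolys \<Longrightarrow> G * H \<in> Lpolys"
  by (simp add: Lpolys_def coeff_mult frob_sum frob_mult)

lemma Lpolys_power: "G \<in> Lpolys \<Longrightarrow> G ^ k \<in> Lpolys"
  by (induction k) (simp_all add: Lpolys_mult, simp add: Lpolys_def coeff_1)

lemma ph_star: "G \<in> Lpolys \<Longrightarrow> ph a (star n t G v) = star n t G (ph a v)"
  unfolding phi_def
  by (simp add: Lpolys_fixed mult.commute map_poly_to_ac_simps flip: star_mult)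

lemma star_tors: "G \<in> Lpolys \<Longrightarrow> v \<in> tors \<Longrightarrow> star n t G v \<in> tors"
  by (simp add: tors_def ph_star)

lemma K_elem_closed: "G \<in> Lpolys \<Longrightarrow> K_elem G \<in> carrier E"
  unfolding K_elem_def by (rule E_memI) (simp_all add: star_tors star_add_right ph_star)

lemma carrier_KR_iff: "f \<in> carrier KR \<longleftrightarrow> (\<exists>(k::nat) l C.
    (\<forall>i<k. l i \<in> GF_ac m \<and> C i \<in> carrier K) \<and> f = (\<lambda>v\<in>tors. \<Sum>i<k. l i * (C i \<odot>\<^bsub>V\<^esub> v)))"
  by (simp add: K_ring_def)

text \<open>
  A sum \<open>\<Sum> l\<^sub>i \<otimes> a\<^sub>i\<close> with \<open>a\<^sub>i \<in> A\<close> is the polynomial \<open>\<Sum> l\<^sub>i a\<^sub>i\<close> over \<open>L\<close>, so \<open>K\<close> is the image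
  of \<open>L[T]\<close>.
\<close>
lemma carrier_KR: "carrier KR = K_elem ` Lpolys"
proof (intro equalityI subsetI)
  fix f assume "f \<in> carrier KR"
  then obtain k :: nat and l C where lC: "\<forall>i<k. l i \<in> GF_ac m \<and> C i \<in> carrier K"
    and f: "f = (\<lambda>v\<in>tors. \<Sum>i<k. l i * (C i \<odot>\<^bsub>V\<^esub> v))"
    unfolding carrier_KR_iff by blast
  have "\<forall>i. \<exists>a. i < k \<longrightarrow> C i = residue_class p a" using lC by (auto simp: carrier_residue_ring_poly)
  then obtain a where a: "\<And>i. i < k \<Longrightarrow> C i = residue_class p (a i)" by metis
  define G where "G = (\<Sum>i<k. Polynomial.smult (l i) (map_poly to_ac (a i)))"
  have "G \<in> Lpolys"
    using lC by (simp add: Lpolys_def G_def coeff_sum frob_sum frob_mult GF_ac_altdef map_poly_to_ac_simps)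
  moreover have "f = K_elem G"
    unfolding f K_elem_def G_def by (rule restrict_ext) (simp add: a star_sum star_smult flip: phi_def)
  ultimately show "f \<in> K_elem ` Lpolys" by blast
next
  fix f assume "f \<in> K_elem ` Lpolys"
  then obtain G where G: "G \<in> Lpolys" "f = K_elem G" by blast
  have mon: "ph (Polynomial.monom 1 i) v = (Phi n t ^^ i) v" for i v
    by (simp add: phi_def map_poly_monom star_monom)
  have "f = (\<lambda>v\<in>tors. \<Sum>i<Suc (Polynomial.degree G). poly.coeff G i * (residue_class p (Polynomial.monom 1 i) \<odot>\<^bsub>V\<^esub> v))"
    unfolding G(2) K_elem_def by (rule restrict_ext) (simp add: star_def mon lessThan_Suc_atMost)
  moreover have "\<forall>i<Suc (Polynomial.degree G). poly.coeff G i \<in> GF_ac m \<and> residue_class p (Polynomial.monom 1 i) \<in> carrier K"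
    using G(1) by (simp add: Lpolys_def GF_ac_altdef residue_class_in_carrier)
  ultimately show "f \<in> carrier KR" unfolding carrier_KR_iff
    by (intro exI[of _ "Suc (Polynomial.degree G)"] exI[of _ "poly.coeff G"]
        exI[of _ "\<lambda>i. residue_class p (Polynomial.monom 1 i)"] conjI)
qed

lemma KR_in_E: "x \<in> carrier KR \<Longrightarrow> x \<in> carrier E"
  using K_elem_closed by (auto simp: carrier_KR)

lemma frob_inverse_on_tors:
  obtains j where "\<And>v. v \<in> tors \<Longrightarrow> frob (r + r * j) v = v"
proof -
  obtain k where k: "k \<ge> 1" "\<And>v. v \<in> tors \<Longrightarrow> frob (r * k) v = v"
    using exists_frob_period_on_tors by blast
  then obtain j where "k = Suc j" by (cases k) auto
  thus ?thesis using k(2) that[of j] by simp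
qed

text \<open>
  \<open>\<pi>\<close> has finite order on the torsion, so its inverse in \<open>E\<close> is again a power of the Frobenius.
  Stating the result at the vectors \<open>\<pi> v\<close> keeps that inverse out of all later arguments.
\<close>
lemma sigma_app:
  assumes "x \<in> carrier E" "v \<in> tors"
  shows "sigma r n t p x (frob r v) = frob r (x v)"
proof -
  obtain j where j: "\<And>v. v \<in> tors \<Longrightarrow> frob (r + r * j) v = v" using frob_inverse_on_tors by blast
  \<comment> \<open>The inverse of \<open>\<pi>\<close>.\<close>
  define \<rho> where "\<rho> = (\<lambda>v\<in>tors. frob (r * j) v)"
  have \<rho>: "\<rho> \<in> carrier E" unfolding \<rho>_def by (rule frob_closed)
  have "\<pi> \<otimes>\<^bsub>E\<^esub> \<rho> = \<one>\<^bsub>E\<^esub>" "\<rho> \<otimes>\<^bsub>E\<^esub> \<pi> = \<one>\<^bsub>E\<^esub>"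
    by (auto simp: \<rho>_def pi_eq compose_def restrict_def fun_eq_iff frob_frob j add.commute[of _ r] tors_frob tors_frob_mult)
  hence inv: "inv\<^bsub>E\<^esub> \<pi> = \<rho>" using E.inv_unique'[OF pi_closed \<rho>] by simp
  have "\<rho> (frob r v) = v"
    using assms(2) by (simp add: \<rho>_def frob_frob j add.commute[of _ r] tors_frob)
  thus ?thesis using assms unfolding sigma_def inv
    by (simp add: compose_def tors_frob pi_eq E_closed)
qed

lemma frob_surj_tors:
  assumes "v \<in> tors"
  obtains w where "w \<in> tors" "v = frob r w"
proof -
  obtain j where j: "\<And>v. v \<in> tors \<Longrightarrow> frob (r + r * j) v = v" using frob_inverse_on_tors by blast
  have "v = frob r (frob (r * j) v)" using j[OF assms] by (simp add: frob_frob)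
  thus ?thesis using that[of "frob (r * j) v"] tors_frob_mult[OF assms] by blast
qed

lemma sigma_ext: "sigma r n t p x \<in> extensional tors"
  by (simp add: sigma_def compose_def)

lemma fun_eq_on_frob_image:
  assumes "f \<in> extensional tors" "g \<in> extensional tors" "\<And>v. v \<in> tors \<Longrightarrow> f (frob r v) = g (frob r v)"
  shows "f = g"
proof (rule extensionalityI[OF assms(1,2)])
  fix v assume "v \<in> tors"
  then obtain w where "w \<in> tors" "v = frob r w" by (rule frob_surj_tors)
  thus "f v = g v" using assms(3) by simp
qed

lemma Lpolys_frob: "G \<in> Lpolys \<Longrightarrow> map_poly (frob k) G \<in> Lpolys"
  by (simp add: Lpolys_def coeff_map_poly frob_frob add.commute[of m] flip: frob_frob[of k m])

lemma sigma_K_elem: "G \<in> Lpolys \<Longrightarrow> sigma r n t p (K_elem G) = K_elem (map_poly (frob r) G)"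
proof (rule fun_eq_on_frob_image)
  fix v assume "G \<in> Lpolys" "v \<in> tors"
  thus "sigma r n t p (K_elem G) (frob r v) = K_elem (map_poly (frob r) G) (frob r v)"
    by (simp add: sigma_app K_elem_closed) (simp add: K_elem_def tors_frob star_frob[OF t])
qed (simp_all add: sigma_ext K_elem_def)

lemma sigma_ring_iso: "sigma r n t p \<in> ring_iso KR KR"
proof -
  let ?\<sigma> = "sigma r n t p"
  have "?\<sigma> \<in> ring_hom KR KR"
  proof (rule ring_hom_memI)
    fix x assume x: "x \<in> carrier KR"
    thus "?\<sigma> x \<in> carrier KR" by (auto simp: carrier_KR sigma_K_elem Lpolys_frob)
    note xE = KR_in_E[OF x]
    fix y assume y: "y \<in> carrier KR"
    note yE = KR_in_E[OF y]
    have xy: "compose tors x y \<in> carrier E" "(\<lambda>v\<in>tors. x v + y v) \<in> carrier E"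
      using E.m_closed[OF xE yE] E.a_closed[OF xE yE] by simp_all
    show "?\<sigma> (x \<otimes>\<^bsub>KR\<^esub> y) = ?\<sigma> x \<otimes>\<^bsub>KR\<^esub> ?\<sigma> y" unfolding KR_simps
      by (rule fun_eq_on_frob_image)
        (simp_all add: sigma_ext sigma_app xy xE yE tors_frob E_closed compose_def[of tors "?\<sigma> x"], simp add: compose_def)
    show "?\<sigma> (x \<oplus>\<^bsub>KR\<^esub> y) = ?\<sigma> x \<oplus>\<^bsub>KR\<^esub> ?\<sigma> y" unfolding KR_simps
      by (rule fun_eq_on_frob_image) (simp_all add: sigma_ext sigma_app xy xE yE tors_frob frob_add)
  next
    have "(\<lambda>v\<in>tors. v) \<in> carrier E" using E.one_closed by simp
    thus "?\<sigma> \<one>\<^bsub>KR\<^esub> = \<one>\<^bsub>KR\<^esub>" unfolding KR_simps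
      by (intro fun_eq_on_frob_image) (simp_all add: sigma_ext sigma_app tors_frob)
  qed
  moreover have "inj_on ?\<sigma> (carrier KR)"
  proof (rule inj_onI)
    fix x y assume x: "x \<in> carrier KR" and y: "y \<in> carrier KR" and eq: "?\<sigma> x = ?\<sigma> y"
    have "x v = y v" if "v \<in> tors" for v
      using fun_cong[OF eq, of "frob r v"] that by (simp add: sigma_app KR_in_E x y)
    thus "x = y" by (intro E_eqI KR_in_E x y)
  qed
  moreover have "carrier KR \<subseteq> ?\<sigma> ` carrier KR"
  proof
    fix y assume "y \<in> carrier KR"
    then obtain H where H: "H \<in> Lpolys" "y = K_elem H" by (auto simp: carrier_KR)
    obtain m' where m': "m = Suc m'" using m_pos by (cases m) auto
    \<comment> \<open>Applying \<open>x \<mapsto> x^[r]\<close> \<open>m\<close> times in all fixes \<open>GF(q^m)\<close>.\<close>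
    define G where "G = map_poly (frob (r * m')) H"
    have G: "G \<in> Lpolys" unfolding G_def by (rule Lpolys_frob[OF H(1)])
    have rm: "r + r * m' = m * r" by (simp add: m')
    have "map_poly (frob r) G = H"
      using H(1) by (intro poly_eqI)
        (simp add: G_def coeff_map_poly frob_frob rm frob_mult_index Lpolys_def)
    hence "y = ?\<sigma> (K_elem G)" using sigma_K_elem[OF G] H(2) by simp
    thus "y \<in> ?\<sigma> ` carrier KR" using G by (auto simp: carrier_KR)
  qed
  ultimately show ?thesis unfolding ring_iso_def bij_betw_def by (auto dest: ring_hom_closed)
qed

lemma K_elem_power: "G \<in> Lpolys \<Longrightarrow> K_elem G [^]\<^bsub>KR\<^esub> (k :: nat) = K_elem (G ^ k)"
proof (induction k)
  case 0
  show ?case by (simp add: nat_pow_def KR_simps K_elem_def restrict_def)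
next
  case (Suc k)
  have "K_elem G [^]\<^bsub>KR\<^esub> Suc k = compose tors (K_elem (G ^ k)) (K_elem G)"
    using Suc by (simp add: nat_pow_def KR_simps)
  also have "\<dots> = K_elem (G ^ k * G)"
    unfolding K_elem_def compose_def
    by (rule restrict_ext) (simp add: star_tors Suc.prems star_mult Lpolys_fixed[OF Suc.prems])
  finally show ?case by (simp add: mult.commute)
qed

lemma Frob_funpow_K_elem: "G \<in> Lpolys \<Longrightarrow> (Frob m r n t p ^^ e) (K_elem G) = K_elem (G ^ (CARD('a) ^ e))"
proof (induction e)
  case (Suc e)
  thus ?case by (simp add: Frob_def K_elem_power Lpolys_power mult.commute flip: power_mult)
qed simp

text \<open>
  \<open>G^(q^e)\<close> has the coefficients \<open>g\<^sub>i^[e]\<close> at \<open>T^(i q^e)\<close>, and \<open>T^(q^e)\<close> acts as \<open>T\<close> on the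
  torsion since \<open>d\<close> divides \<open>e\<close>.
\<close>
lemma star_power_card:
  assumes "d dvd e"
  shows "v \<in> tors \<Longrightarrow> star n t (G ^ (CARD('a) ^ e)) v = star n t (map_poly (frob e) G) v"
proof (induction G arbitrary: v)
  case 0
  have "CARD('a) ^ e > 0" by simp
  thus ?case by (simp add: zero_power)
next
  case (pCons c G)
  let ?N = "CARD('a) ^ e"
  have X: "star n t ([:0, 1:] ^ ?N) v = Phi n t v"
  proof -
    have "map_poly to_ac ([:0, 1:] ^ k) = [:0, 1 :: 'a alg_closure:] ^ k" for k
      by (induction k) (simp_all add: map_poly_to_ac_simps map_poly_pCons)
    hence "star n t ([:0, 1:] ^ ?N) v = ph ([:0, 1:] ^ ?N) v" by (simp only: phi_def)
    also have "\<dots> = ph [:0, 1:] v"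
      using irreducible_dvd_power_card_minus[OF irr_p assms] by (rule phi_eq_on_tors[OF pCons.prems])
    finally show ?thesis by (simp only: phi_T)
  qed
  have fixed: "frob n (poly.coeff ([:0, 1 :: 'a alg_closure:] ^ ?N) i) = poly.coeff ([:0, 1:] ^ ?N) i" for i
  proof -
    have X_pow: "[:0, 1 :: 'a alg_closure:] ^ ?N = Polynomial.monom 1 ?N" by (simp add: monom_altdef)
    show ?thesis unfolding X_pow by simp
  qed
  have const: "[:c:] ^ k = [:c ^ k:]" for k by (induction k) (simp_all add: one_pCons)
  have "pCons c G = [:c:] + G * [:0, 1:]" by simp
  hence "pCons c G ^ ?N = [:c:] ^ ?N + (G * [:0, 1:]) ^ ?N" by (simp only: frobenius_poly_add)
  also have "\<dots> = [:frob e c:] + G ^ ?N * [:0, 1:] ^ ?N"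
    by (simp only: const power_mult_distrib frob_def)
  finally have "star n t (pCons c G ^ ?N) v = frob e c * v + star n t (G ^ ?N) (star n t ([:0, 1:] ^ ?N) v)"
    by (simp only: star_add star_mult[OF fixed] star_pCons star_0 add_0_right)
  also have "\<dots> = frob e c * v + star n t (map_poly (frob e) G) (Phi n t v)"
    by (simp only: X pCons.IH[OF tors_Phi[OF pCons.prems]])
  finally show ?case by (simp add: map_poly_pCons star_pCons)
qed

lemma sigma_eq_Frob_funpow:
  assumes "[e = r] (mod m)" "d dvd e" "x \<in> carrier KR"
  shows "sigma r n t p x = (Frob m r n t p ^^ e) x"
proof -
  obtain G where G: "G \<in> Lpolys" "x = K_elem G" using assms(3) by (auto simp: carrier_KR)
  have "map_poly (frob r) G = map_poly (frob e) G"
  proof (rule poly_eqI)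
    fix i
    have "frob m (poly.coeff G i) = poly.coeff G i" using G(1) by (simp add: Lpolys_def)
    from frob_cong[OF assms(1) this] show "poly.coeff (map_poly (frob r) G) i = poly.coeff (map_poly (frob e) G) i"
      by (simp add: coeff_map_poly)
  qed
  hence "K_elem (map_poly (frob r) G) = K_elem (G ^ (CARD('a) ^ e))"
    unfolding K_elem_def by (intro restrict_ext) (simp add: star_power_card[OF assms(2)])
  thus ?thesis unfolding G(2) sigma_K_elem[OF G(1)] Frob_funpow_K_elem[OF G(1)] .
qed

end

section \<open>Realizing the parameters\<close>

theorem proposition6p6:
  fixes p :: "'a::finite_field poly" and c :: "'a poly set"
    and m s n d :: nat and e0 :: int
  assumes "m \<ge> 1" and "s \<ge> 1" and "n = m * s"
    and "Polynomial.lead_coeff p = 1" and "Factorial_Ring.irreducible p" and "Polynomial.degree p = d"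
    and "c \<in> Units (residue_ring_poly p)"
    and "gcd e0 (int m) = 1"
  shows "infinite (admissible_primes p c n m e0) \<and>
    (\<forall>p0 \<in> admissible_primes p c n m e0. \<forall>r. \<forall>t :: 'a alg_closure.
       r = Polynomial.degree p0 \<longrightarrow> t \<in> GF_ac r \<longrightarrow> poly (map_poly to_ac p0) t = 0 \<longrightarrow>
         supersingular r n t p0 \<and>
         p \<noteq> p0 \<and>
         residue_class p p0 = c \<and>
         algebra_isomorphic (residue_ring_poly p)
           (kappa_scalar r n t p) (R0_ring m r n t p)
           (binomial_quot_const (residue_ring_poly p) s c)
           (binomial_quot (residue_ring_poly p) s c) \<and>
         algebra_isomorphic (residue_ring_poly p)
           (kappa_scalar r n t p) (R_ring m r n t p)
           (\<lambda>x. scalar_mat m (R0_ring m r n t p) (kappa_scalar r n t p x))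
           (mat_ring m (R0_ring m r n t p)) \<and>
         skew_cyclic_codes m r n t p = {C. left_ideal C (R_ring m r n t p)} \<and>
         (gcd m d = 1 \<longrightarrow>
            sigma r n t p \<in> ring_iso (K_ring m r n t p) (K_ring m r n t p) \<and>
            (\<exists>e::nat. [int e = e0] (mod int m) \<and> [e = 0] (mod d)) \<and>
            (\<forall>e::nat. [int e = e0] (mod int m) \<longrightarrow> [e = 0] (mod d) \<longrightarrow>
               (\<forall>x\<in>carrier (K_ring m r n t p).
                  sigma r n t p x = (Frob m r n t p ^^ e) x))))"
proof (intro conjI ballI allI impI)
  show "infinite (admissible_primes p c n m e0)"
    by (rule infinite_admissible_primes[OF assms(1,2,3,4,5,7,8)])
next
  fix p0 r t
  assume p0: "p0 \<in> admissible_primes p c n m e0" and r: "r = Polynomial.degree p0"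
    and t: "t \<in> GF_ac r" and root: "poly (map_poly to_ac p0) t = 0"
  have p0': "monic_irreducible p0" "residue_class p p0 = c" "gcd r n = 1" "[int r = e0] (mod int m)"
    using p0 by (simp_all add: admissible_primes_def monic_irreducible_def r)
  have pmi: "monic_irreducible p" using assms(4,5) by (simp add: monic_irreducible_def)
  obtain a where a: "c = residue_class p a" "\<not> p dvd a"
    using unit_residue_class[OF assms(5,7)] by blast
  \<comment> \<open>\<open>p0\<close> represents the unit \<open>c\<close>, whereas \<open>p\<close> represents \<open>0\<close>.\<close>
  have neq: "p \<noteq> p0"
  proof
    assume "p = p0"
    hence "residue_class p p = residue_class p a" using p0'(2) a(1) by simp
    hence "p dvd p - a" by (simp add: residue_class_eq_iff)
    from dvd_diff[OF dvd_refl this] have "p dvd p - (p - a)" .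
    moreover have "p - (p - a) = a" by (rule diff_diff_eq2[THEN trans]) simp
    ultimately show False using a(2) by (simp only:)
  qed
  have n_pos: "n \<ge> 1" using assms(1,2,3) by (simp add: Suc_le_eq)
  have cop: "coprime n r" using p0'(3) by (simp add: coprime_iff_gcd_eq_1 gcd.commute)
  have frt: "frob r t = t" using t by (simp add: GF_ac_altdef)
  interpret drinfeld_torsion p p0 n r t
    by unfold_locales (use n_pos pmi p0'(1) neq r frt root cop in auto)
  obtain v0 where v0: "v0 \<in> tors" "\<And>w. w \<in> tors \<Longrightarrow> \<exists>A. w = pi_comb A v0"
      "\<And>A i. pi_comb A v0 = 0 \<Longrightarrow> i < n \<Longrightarrow> p dvd A i"
    by (rule exists_cyclic_vector) (rule that)
  interpret drinfeld_code p p0 n r t m s v0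
    by unfold_locales (use assms(3) v0 in auto)
  show "supersingular r n t p0"
    by (rule supersingular_characteristic[OF n_pos p0'(1) r frt root cop])
  show "p \<noteq> p0" by (rule neq)
  show "residue_class p p0 = c" by (rule p0'(2))
  show "algebra_isomorphic (residue_ring_poly p)
           (kappa_scalar r n t p) (R0_ring m r n t p)
           (binomial_quot_const (residue_ring_poly p) s c)
           (binomial_quot (residue_ring_poly p) s c)"
    using R0_isomorphic_binomial_quot unfolding p0'(2) .
  show "algebra_isomorphic (residue_ring_poly p)
           (kappa_scalar r n t p) (R_ring m r n t p)
           (\<lambda>x. scalar_mat m (R0_ring m r n t p) (kappa_scalar r n t p x))
           (mat_ring m (R0_ring m r n t p))"
    by (rule R_isomorphic_matrix_ring)
  show "skew_cyclic_codes m r n t p = {C. left_ideal C (R_ring m r n t p)}"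
    by (rule skew_cyclic_codes_def)
  show "sigma r n t p \<in> ring_iso (K_ring m r n t p) (K_ring m r n t p)"
    by (rule sigma_ring_iso)
  show "\<exists>e::nat. [int e = e0] (mod int m) \<and> [e = 0] (mod d)" if "gcd m d = 1"
  proof -
    have "coprime m d" using that by (simp add: coprime_iff_gcd_eq_1)
    then obtain e where "[e = r] (mod m)" "[e = 0] (mod d)"
      using binary_chinese_remainder_nat[of m d r 0] by blast
    thus ?thesis using p0'(4) by (metis cong_int_iff cong_trans)
  qed
  show "sigma r n t p x = (Frob m r n t p ^^ e) x"
    if "[int e = e0] (mod int m)" "[e = 0] (mod d)" "x \<in> carrier (K_ring m r n t p)" for e x
  proof (rule sigma_eq_Frob_funpow)
    have "[int e = int r] (mod int m)" using that(1) p0'(4) by (metis cong_sym cong_trans)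
    thus "[e = r] (mod m)" by (simp only: cong_int_iff)
    show "Polynomial.degree p dvd e" using that(2) assms(6) by (simp add: cong_0_iff)
    show "x \<in> carrier (K_ring m r n t p)" by (rule that(3))
  qed
qed

end
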